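(* There is a polynomial-time algorithm which, given a graph $G=(V,E)$ with an edge coloring $\mathcal{C}:E\to C$ and a set $S\subseteq V$ of terminals, produces either an alternating trail connecting distinct terminals (an alternating $s$-$t$ trail with $s,t\in S$, $s\neq t$) or a Tutte set.
   Context: Graphs are finite and undirected; parallel edges are allowed, loops are not. Colors come from a set $C$ with $\#C\ge 2$. A $v_0$-$v_m$ walk is a sequence $(v_0,e_1,v_1,\ldots,e_m,v_m)$, $m\ge 0$, where each $e_j\in E$ has endpoints $v_{j-1},v_j$. It is a trail when its edges are distinct. If $v_0\ne v_m$ it is alternating when $\mathcal{C}(e_j)\ne\mathcal{C}(e_{j+1})$ for $j=1,\ldots,m-1$. Tutte set: a subset $A\subseteq V-S$ is a Tutte set when (i) each component of $G-A$ contains at most one terminal; and (ii) $A$ can be written as a disjoint union $A=\dot\bigcup_{c\in C}A(c)$ (empty blocks allowed; $u\in A(c)$ is said to have color $c$) such that: (a) if a component $H$ of $G-A$ contains a terminal, no mismatched edge has an endpoint in $H$; (b) if a component $H$ of $G-A$ contains no terminal, at most one mismatched edge has an endpoint in $H$; (c) no mismatched edge has both endpoints in $A$. Here an edge $e$ is mismatched if either it connects $u\in A$ with $v\in V-A$ and $\mathcal{C}(e)$ differs from the color of $u$, or it connects $u,v\in A$ and $\mathcal{C}(e)$ differs from both the colors of $u$ and of $v$. *)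

theory Defs
  imports
    Complex_Main
    "HOL-Library.Disjoint_Sets"
    "HOL-Computational_Algebra.Polynomial"
begin

section \<open>Edge-coloured multigraphs\<close>

record ('v, 'e) multigraph =
  verts :: "'v set"
  edges :: "'e set"
  ends :: "'e \<Rightarrow> 'v set"

definition finite_multigraph :: "('v, 'e) multigraph \<Rightarrow> bool" where
  "finite_multigraph G \<longleftrightarrow> finite (verts G) \<and> finite (edges G) \<and>
     (\<forall>e\<in>edges G. ends G e \<subseteq> verts G \<and> card (ends G e) = 2)"

text \<open>The walk \<open>(v\<^sub>0, e\<^sub>1, v\<^sub>1, \<dots>, e\<^sub>m, v\<^sub>m)\<close> is given by its first vertex
  \<open>v\<^sub>0\<close> and the list of steps \<open>[(e\<^sub>1, v\<^sub>1), \<dots>, (e\<^sub>m, v\<^sub>m)]\<close>.\<close>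

fun walk :: "('v, 'e) multigraph \<Rightarrow> 'v \<Rightarrow> ('e \<times> 'v) list \<Rightarrow> 'v \<Rightarrow> bool" where
  "walk G v [] w \<longleftrightarrow> v \<in> verts G \<and> v = w"
| "walk G v ((e, u) # p) w \<longleftrightarrow> e \<in> edges G \<and> ends G e = {v, u} \<and> walk G u p w"

definition trail :: "('v, 'e) multigraph \<Rightarrow> 'v \<Rightarrow> ('e \<times> 'v) list \<Rightarrow> 'v \<Rightarrow> bool" where
  "trail G v p w \<longleftrightarrow> walk G v p w \<and> distinct (map fst p)"

text \<open>Only used for walks whose two end vertices are distinct.\<close>

definition alternating :: "('e \<Rightarrow> 'c) \<Rightarrow> ('e \<times> 'v) list \<Rightarrow> bool" where
  "alternating col p \<longleftrightarrow>
     (\<forall>j. Suc j < length p \<longrightarrow> col (fst (p ! j)) \<noteq> col (fst (p ! Suc j)))"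

definition delete_verts :: "('v, 'e) multigraph \<Rightarrow> 'v set \<Rightarrow> ('v, 'e) multigraph" where
  "delete_verts G A =
     \<lparr>verts = verts G - A, edges = {e \<in> edges G. ends G e \<inter> A = {}}, ends = ends G\<rparr>"

text \<open>Components are represented by their vertex sets.\<close>

definition components :: "('v, 'e) multigraph \<Rightarrow> 'v set set" where
  "components G = {{w. \<exists>p. walk G v p w} | v. v \<in> verts G}"

text \<open>\<open>B c\<close> is the block \<open>A(c)\<close>, and \<open>A\<close> is the disjoint union of the blocks over \<open>c \<in> C\<close>.\<close>

definition mismatched ::
  "('v, 'e) multigraph \<Rightarrow> ('e \<Rightarrow> 'c) \<Rightarrow> 'c set \<Rightarrow> 'v set \<Rightarrow> ('c \<Rightarrow> 'v set) \<Rightarrow> 'e \<Rightarrow> bool" where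
  "mismatched G col C A B e \<longleftrightarrow> e \<in> edges G \<and>
     ((\<exists>u\<in>A. \<exists>v\<in>verts G - A. ends G e = {u, v} \<and>
         (\<exists>c\<in>C. u \<in> B c \<and> col e \<noteq> c)) \<or>
      (\<exists>u\<in>A. \<exists>v\<in>A. ends G e = {u, v} \<and>
         (\<exists>c\<in>C. \<exists>d\<in>C. u \<in> B c \<and> v \<in> B d \<and> col e \<noteq> c \<and> col e \<noteq> d)))"

definition tutte_set ::
  "('v, 'e) multigraph \<Rightarrow> ('e \<Rightarrow> 'c) \<Rightarrow> 'c set \<Rightarrow> 'v set \<Rightarrow> 'v set \<Rightarrow> bool" where
  "tutte_set G col C S A \<longleftrightarrow> A \<subseteq> verts G - S \<and>
     (\<forall>H\<in>components (delete_verts G A). card (H \<inter> S) \<le> 1) \<and>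
     (\<exists>B. disjoint_family_on B C \<and> A = (\<Union>c\<in>C. B c) \<and>
        (\<forall>H\<in>components (delete_verts G A). H \<inter> S \<noteq> {} \<longrightarrow>
           \<not> (\<exists>e. mismatched G col C A B e \<and> ends G e \<inter> H \<noteq> {})) \<and>
        (\<forall>H\<in>components (delete_verts G A). H \<inter> S = {} \<longrightarrow>
           card {e. mismatched G col C A B e \<and> ends G e \<inter> H \<noteq> {}} \<le> 1) \<and>
        \<not> (\<exists>e. mismatched G col C A B e \<and> ends G e \<subseteq> A))"

section \<open>Model of computation\<close>

text \<open>
  Algorithms are programs of the WHILE language over binary trees (N. D. Jones,
  Computability and Complexity from a Programming Perspective, MIT Press, 1997).
  Jones shows that unit-cost WHILE programs decide in polynomial time exactly what Turing
  machines do. Here evaluating an expression costs, for every node of the expression, the size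
  of the tree computed at that node: a copied, constructed or compared tree is charged in full,
  and no tree ever built can be larger than the input size plus the running time.
\<close>

datatype tree = Atom | Pair tree tree

datatype expr =
  Var nat | Nil | Cons expr expr | Hd expr | Tl expr | Equal expr expr

datatype com =
  Skip | Assign nat expr | Seq com com | If expr com com | While expr com

type_synonym store = "nat \<Rightarrow> tree"

fun tree_hd :: "tree \<Rightarrow> tree" where
  "tree_hd Atom = Atom"
| "tree_hd (Pair x y) = x"

fun tree_tl :: "tree \<Rightarrow> tree" where
  "tree_tl Atom = Atom"
| "tree_tl (Pair x y) = y"

text \<open>As a truth value, \<open>Atom\<close> is false and every other tree is true.\<close>

fun val :: "expr \<Rightarrow> store \<Rightarrow> tree" where
  "val (Var i) s = s i"
| "val Nil s = Atom"
| "val (Cons a b) s = Pair (val a s) (val b s)"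
| "val (Hd a) s = tree_hd (val a s)"
| "val (Tl a) s = tree_tl (val a s)"
| "val (Equal a b) s = (if val a s = val b s then Pair Atom Atom else Atom)"

text \<open>The generated \<open>size\<close> of a tree is its number of \<open>Pair\<close> nodes.\<close>

definition node_cost :: "expr \<Rightarrow> store \<Rightarrow> nat" where
  "node_cost a s = Suc (size (val a s))"

fun cost :: "expr \<Rightarrow> store \<Rightarrow> nat" where
  "cost (Var i) s = node_cost (Var i) s"
| "cost Nil s = node_cost Nil s"
| "cost (Cons a b) s = cost a s + cost b s + node_cost (Cons a b) s"
| "cost (Hd a) s = cost a s + node_cost (Hd a) s"
| "cost (Tl a) s = cost a s + node_cost (Tl a) s"
| "cost (Equal a b) s = cost a s + cost b s + node_cost (Equal a b) s"

text \<open>\<open>exec c s t s'\<close>: started in store \<open>s\<close>, the program \<open>c\<close> terminates in store \<open>s'\<close>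
  after time \<open>t\<close>.\<close>

inductive exec :: "com \<Rightarrow> store \<Rightarrow> nat \<Rightarrow> store \<Rightarrow> bool" where
  exec_Skip: "exec Skip s 1 s"
| exec_Assign: "exec (Assign i a) s (Suc (cost a s)) (s(i := val a s))"
| exec_Seq: "exec c s t s' \<Longrightarrow> exec d s' t' s'' \<Longrightarrow> exec (Seq c d) s (Suc (t + t')) s''"
| exec_IfTrue: "val a s \<noteq> Atom \<Longrightarrow> exec c s t s' \<Longrightarrow>
    exec (If a c d) s (Suc (cost a s + t)) s'"
| exec_IfFalse: "val a s = Atom \<Longrightarrow> exec d s t s' \<Longrightarrow>
    exec (If a c d) s (Suc (cost a s + t)) s'"
| exec_WhileFalse: "val a s = Atom \<Longrightarrow> exec (While a c) s (Suc (cost a s)) s"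
| exec_WhileTrue: "val a s \<noteq> Atom \<Longrightarrow> exec c s t s' \<Longrightarrow> exec (While a c) s' t' s'' \<Longrightarrow>
    exec (While a c) s (Suc (cost a s + t + t')) s''"

inductive_cases exec_SkipE: "exec Skip s t s'"
inductive_cases exec_AssignE: "exec (Assign i a) s t s'"
inductive_cases exec_SeqE: "exec (Seq c d) s t s'"
inductive_cases exec_IfE: "exec (If a c d) s t s'"
inductive_cases exec_WhileE: "exec (While a c) s t s'"

lemma exec_deterministic:
  "exec c s t s' \<Longrightarrow> exec c s u s'' \<Longrightarrow> u = t \<and> s'' = s'"
proof (induction arbitrary: u s'' rule: exec.induct)
  case (exec_Skip s)
  then show ?case by (rule exec_SkipE) simp
next
  case (exec_Assign i a s)
  then show ?case by (rule exec_AssignE) simp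
next
  case (exec_Seq c s t s1 d t' s2)
  from exec_Seq.prems obtain v s3 v'
    where "exec c s v s3" "exec d s3 v' s''" "u = Suc (v + v')"
    by (rule exec_SeqE)
  with exec_Seq.IH show ?case by metis
next
  case (exec_IfTrue a s c t s1 d)
  from exec_IfTrue.prems exec_IfTrue.hyps(1) obtain v
    where "exec c s v s''" "u = Suc (cost a s + v)"
    by (elim exec_IfE) simp_all
  with exec_IfTrue.IH show ?case by metis
next
  case (exec_IfFalse a s d t s1 c)
  from exec_IfFalse.prems exec_IfFalse.hyps(1) obtain v
    where "exec d s v s''" "u = Suc (cost a s + v)"
    by (elim exec_IfE) simp_all
  with exec_IfFalse.IH show ?case by metis
next
  case (exec_WhileFalse a s c)
  from exec_WhileFalse.prems show ?case
    by (rule exec_WhileE) (use exec_WhileFalse.hyps in simp_all)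
next
  case (exec_WhileTrue a s c t s1 t' s2)
  from exec_WhileTrue.prems obtain v s3 v'
    where "exec c s v s3" "exec (While a c) s3 v' s''" "u = Suc (cost a s + v + v')"
    by (rule exec_WhileE) (use exec_WhileTrue.hyps(1) in simp_all)
  with exec_WhileTrue.IH show ?case by metis
qed

text \<open>The input is read from and the output is left in variable \<open>0\<close>.\<close>

definition computes :: "com \<Rightarrow> tree \<Rightarrow> nat \<Rightarrow> tree \<Rightarrow> bool" where
  "computes c x t y \<longleftrightarrow> (\<exists>s. exec c ((\<lambda>_. Atom)(0 := x)) t s \<and> s 0 = y)"

section \<open>Input and output formats\<close>

text \<open>Natural numbers are written in binary, least significant digit first.\<close>

fun enc_nat :: "nat \<Rightarrow> tree" where
  "enc_nat n = (if n = 0 then Atom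
     else Pair (if even n then Atom else Pair Atom Atom) (enc_nat (n div 2)))"

declare enc_nat.simps [simp del]

fun enc_list :: "('a \<Rightarrow> tree) \<Rightarrow> 'a list \<Rightarrow> tree" where
  "enc_list f [] = Atom"
| "enc_list f (x # xs) = Pair (f x) (enc_list f xs)"

text \<open>\<open>vs\<close>, \<open>es\<close>, \<open>ss\<close> list the vertices, the edges (each with its two endpoints) and the
  terminals, in any order.\<close>

definition lists_instance ::
  "(nat, nat) multigraph \<Rightarrow> nat set \<Rightarrow> nat list \<Rightarrow> (nat \<times> nat \<times> nat) list \<Rightarrow> nat list \<Rightarrow> bool"
where
  "lists_instance G S vs es ss \<longleftrightarrow>
     distinct vs \<and> set vs = verts G \<and>
     distinct (map fst es) \<and> fst ` set es = edges G \<and>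
     (\<forall>(e, u, v)\<in>set es. ends G e = {u, v}) \<and>
     distinct ss \<and> set ss = S"

definition enc_instance ::
  "(nat \<Rightarrow> nat) \<Rightarrow> nat list \<Rightarrow> (nat \<times> nat \<times> nat) list \<Rightarrow> nat list \<Rightarrow> tree" where
  "enc_instance col vs es ss =
     Pair (enc_list enc_nat vs)
       (Pair (enc_list (\<lambda>(e, u, v). enc_list enc_nat [e, u, v, col e]) es)
         (enc_list enc_nat ss))"

definition enc_trail :: "nat \<Rightarrow> (nat \<times> nat) list \<Rightarrow> tree" where
  "enc_trail v p = Pair Atom
     (Pair (enc_nat v) (enc_list (\<lambda>(e, w). Pair (enc_nat e) (enc_nat w)) p))"

definition enc_vertex_set :: "nat list \<Rightarrow> tree" where
  "enc_vertex_set xs = Pair (Pair Atom Atom) (enc_list enc_nat xs)"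

end

theory Submission
  imports Defs
begin

text \<open>
  Keep a set of explicit alternating trails starting at terminals. A reached vertex is inner if all
  its trails have the same last colour, and terminals never are. A trail is extended whenever this
  reaches a new vertex. Otherwise take an edge \<open>f = xy\<close> that extends a trail \<open>T\<close> to \<open>x\<close> and,
  backwards, a trail \<open>T'\<close> to \<open>y\<close>. If \<open>T\<close>, \<open>f\<close> and the reverse of \<open>T'\<close> are edge-disjoint, they form a
  trail between distinct terminals. If not, walking \<open>T'\<close> backwards only down to an inner vertex, as
  long as no edge repeats, gives that vertex a second last colour. When nothing of this applies,
  the inner vertices, coloured by their last colours, form a Tutte set.

  The invariant behind this is a forest of nodes as in Edmonds' blossom algorithm: inner vertices are
  singleton nodes, the other nodes are blossoms, each node other than a root is entered by one
  edge from its parent, and every stored trail descends through the nodes from the root. The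
  program never stores this forest. Whenever an edge between two branches makes
  vertices cease to be inner, the nodes on the cycle that it closes are contracted into one.

  Each round reaches a new vertex or makes an inner vertex outer, so \<open>2 |V|\<close> rounds suffice.
  For the running time, the functions on trees computed by WHILE programs in polynomial time are
  closed under pairing, case distinction, and folding a list as long as the intermediate
  results stay polynomially bounded. The stored trails are bounded because their edges are distinct.
\<close>

section \<open>Alternating trails in a dart graph\<close>

text \<open>Colours are the easy part: an outer vertex can be left by an edge of any colour, an
  inner one by any colour but its own. The obstacle is repeated edges, since two trails can be
  joined only if they are edge-disjoint. The forest answers this by giving every edge of a stored
  trail exactly one owner: the node that it enters, or the node that contains both its ends. A trail
  uses only edges owned by the nodes above its end, so an edge common to two trails is owned by a
  common ancestor. Hence trails from different trees can always be joined. Within one tree, let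
  \<open>z\<close> be the lowest common node. Both trails contain the edge entering
  \<open>z\<close>, so unwinding past \<open>z\<close> would repeat it, while unwinding to an inner
  vertex at or below \<open>z\<close> on the other path repeats nothing. The forest is not
  determined by the trails. For the Tutte set one with as few nodes as possible is taken: there
  every blossom other than a root is entered from an inner vertex. Removing the inner vertices then
  separates the blossoms from each other, and the entering edge is the only mismatched one that a
  blossom can have.\<close>

text \<open>Darts are edges with an orientation, \<open>D\<close> is the set of all darts of the graph. \<open>P\<close> contains
  fictitious loops at the terminals, with one edge name but two colours for each terminal. Every trail
  starts with such a loop. Thus a terminal always has two last colours, and trails from distinct
  terminals differ in their first edges.\<close>

locale dart_graph =
  fixes eid :: "'d \<Rightarrow> 'e" and src tgt :: "'d \<Rightarrow> 'v" and clr :: "'d \<Rightarrow> 'c" and rv :: "'d \<Rightarrow> 'd"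
    and D P :: "'d set"
  assumes rv [simp]: "eid (rv d) = eid d" "src (rv d) = tgt d" "tgt (rv d) = src d"
      "clr (rv d) = clr d"
    and finite_D: "finite D" and finite_P: "finite P"
    and D_rv: "d \<in> D \<Longrightarrow> rv d \<in> D"
    and D_neq: "d \<in> D \<Longrightarrow> src d \<noteq> tgt d"
    and D_inj: "d \<in> D \<Longrightarrow> d' \<in> D \<Longrightarrow> eid d = eid d' \<Longrightarrow>
      clr d = clr d' \<and> (src d = src d' \<and> tgt d = tgt d' \<or> src d = tgt d' \<and> tgt d = src d')"
    and P_inj: "p \<in> P \<Longrightarrow> p' \<in> P \<Longrightarrow> eid p = eid p' \<longleftrightarrow> tgt p = tgt p'"
    and P_D: "p \<in> P \<Longrightarrow> d \<in> D \<Longrightarrow> eid p \<noteq> eid d"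
    and P_two: "p \<in> P \<Longrightarrow> \<exists>p'\<in>P. tgt p' = tgt p \<and> clr p' \<noteq> clr p"
begin

text \<open>Trails are lists of darts with the last dart first, so that trails are extended by \<open>(#)\<close> and
  a final segment of a trail is a prefix of the list.\<close>

fun alt :: "'d list \<Rightarrow> bool" where
  "alt [] \<longleftrightarrow> False"
| "alt [p] \<longleftrightarrow> p \<in> P"
| "alt (d # d' # T) \<longleftrightarrow> d \<in> D \<and> src d = tgt d' \<and> clr d \<noteq> clr d' \<and> alt (d' # T)"

definition eids :: "'d list \<Rightarrow> 'e set" where
  "eids T = eid ` set T"

lemma eids_simps [simp]: "eids [] = {}" "eids (d # T) = insert (eid d) (eids T)"
  "eids (T @ T') = eids T \<union> eids T'" "eids (map rv T) = eids T" "eids (rev T) = eids T"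
  by (auto simp: eids_def image_image)

abbreviation endv :: "'d list \<Rightarrow> 'v" where
  "endv T \<equiv> tgt (hd T)"

definition dtrail :: "'d list \<Rightarrow> bool" where
  "dtrail T \<longleftrightarrow> alt T \<and> distinct (map eid T)"

definition reached :: "'d list set \<Rightarrow> 'v set" where
  "reached K = endv ` K"

definition full :: "'d list set \<Rightarrow> 'v \<Rightarrow> bool" where
  "full K v \<longleftrightarrow> (\<exists>T\<in>K. \<exists>T'\<in>K. endv T = v \<and> endv T' = v \<and> clr (hd T) \<noteq> clr (hd T'))"

definition inner :: "'d list set \<Rightarrow> 'v set" where
  "inner K = {v \<in> reached K. \<not> full K v}"

definition usable :: "'d \<Rightarrow> 'd list \<Rightarrow> bool" where
  "usable d T \<longleftrightarrow> src d = endv T \<and> clr d \<noteq> clr (hd T) \<and> eid d \<notin> eids T"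

text \<open>The edges owned by the node \<open>b\<close>. Values of \<open>base\<close> at unreached
  vertices carry no meaning, hence the two conditions on \<open>reached K\<close>.\<close>

definition node_edges :: "'d list set \<Rightarrow> ('v \<Rightarrow> 'v) \<Rightarrow> ('v \<Rightarrow> 'e) \<Rightarrow> 'v \<Rightarrow> 'e set" where
  "node_edges K base en b = insert (en b)
     {eid d | d. d \<in> D \<and> src d \<in> reached K \<and> tgt d \<in> reached K \<and> base (src d) = b \<and> base (tgt d) = b}"

lemma alt_Cons: "T \<noteq> [] \<Longrightarrow> alt (d # T) \<longleftrightarrow> d \<in> D \<and> src d = endv T \<and> clr d \<noteq> clr (hd T) \<and> alt T"
  by (cases T) auto

lemma alt_nonempty: "alt T \<Longrightarrow> T \<noteq> []"
  by auto

text \<open>Reversal keeps the colour changes. The reversed part arrives at \<open>endv Tv\<close>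
  along the dart by which \<open>Q\<close> leaves it, and \<open>alt\<close> makes that dart differ
  in colour from the last dart of \<open>Tv\<close>; for empty \<open>Q\<close> the difference is
  the hypothesis. This is where the second last colour of an inner vertex comes from.\<close>

lemma alt_unwind:
  assumes "alt W" "alt (Q @ Tv)" "Tv \<noteq> []" "endv (Q @ Tv) = endv W" "clr (hd (Q @ Tv)) \<noteq> clr (hd W)"
  shows "alt (map rv (rev Q) @ W) \<and> endv (map rv (rev Q) @ W) = endv Tv \<and>
    clr (hd (map rv (rev Q) @ W)) \<noteq> clr (hd Tv)"
  using assms
proof (induction Q arbitrary: W)
  case Nil
  then show ?case by simp
next
  case (Cons q Q)
  have W: "W \<noteq> []" using Cons.prems(1) by auto
  have q: "q \<in> D" "src q = endv (Q @ Tv)" "clr q \<noteq> clr (hd (Q @ Tv))" "alt (Q @ Tv)"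
    using Cons.prems(2,3) by (simp_all add: alt_Cons)
  have "alt (rv q # W)"
    using W q Cons.prems D_rv by (auto simp: alt_Cons)
  then have "alt (map rv (rev Q) @ rv q # W) \<and> endv (map rv (rev Q) @ rv q # W) = endv Tv \<and>
    clr (hd (map rv (rev Q) @ rv q # W)) \<noteq> clr (hd Tv)"
    using q Cons.prems(3) by (intro Cons.IH) auto
  then show ?case by simp
qed

lemma alt_ends:
  assumes "alt T" "d \<in> set T"
  shows "d \<in> D \<union> P"
  using assms by (induction T rule: alt.induct) auto

lemma reached_mono: "K \<subseteq> K' \<Longrightarrow> reached K \<subseteq> reached K'"
  by (auto simp: reached_def)

text \<open>The trail \<open>T\<close>, the dart \<open>d\<close>, and then \<open>T'\<close> backwards, down to a vertex where an initial
  segment \<open>Tv\<close> of \<open>T'\<close> ends.\<close>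

definition unwinds :: "'d list set \<Rightarrow> 'd \<Rightarrow> 'd list \<Rightarrow> 'd list \<Rightarrow> 'd list set" where
  "unwinds K d T T' = {map rv (rev Q) @ d # T | Q Tv. T' = Q @ Tv \<and> Tv \<in> K \<and> endv Tv \<in> inner K \<and>
     distinct (map eid (map rv (rev Q) @ d # T))}"

lemma distinct_unwind:
  "distinct (map eid (map rv (rev Q) @ W)) \<longleftrightarrow>
    distinct (map eid Q) \<and> distinct (map eid W) \<and> eids Q \<inter> eids W = {}"
proof -
  have "map eid (map rv (rev Q) @ W) = rev (map eid Q) @ map eid W"
    by (simp add: rev_map comp_def)
  then show ?thesis by (auto simp: eids_def)
qed

text \<open>The three conclusions exclude growth, a connecting trail and an unwinding. Only
  \<open>T'\<close> is unwound, but passing from \<open>d\<close> to \<open>rv d\<close> exchanges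
  \<open>T\<close> and \<open>T'\<close>.\<close>

definition stable :: "'d list set \<Rightarrow> bool" where
  "stable K \<longleftrightarrow> (\<forall>d\<in>D. \<forall>T\<in>K. usable d T \<longrightarrow> tgt d \<in> reached K \<and>
     (\<forall>T'\<in>K. usable (rv d) T' \<longrightarrow>
       \<not> distinct (map eid (map rv (rev T') @ d # T)) \<and> unwinds K d T T' = {}))"

end

text \<open>Nodes are named by their base vertices, and \<open>base v\<close> is the node of \<open>v\<close>. The node \<open>b\<close> is entered
  by the edge \<open>en b\<close> from the vertex \<open>pv b\<close>, and \<open>anc v\<close> is the set of nodes on the path from the
  root to the node of \<open>v\<close>. Giving \<open>anc\<close> explicitly makes contraction a mere set difference.\<close>

locale node_tree = dart_graph eid src tgt clr rv D P
  for eid :: "'d \<Rightarrow> 'e" and src tgt :: "'d \<Rightarrow> 'v" and clr :: "'d \<Rightarrow> 'c" and rv :: "'d \<Rightarrow> 'd"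
    and D P :: "'d set" +
  fixes K :: "'d list set" and base pv :: "'v \<Rightarrow> 'v" and en :: "'v \<Rightarrow> 'e" and anc :: "'v \<Rightarrow> 'v set"
  assumes base: "v \<in> reached K \<Longrightarrow> base v \<in> reached K \<and> base (base v) = base v \<and>
      anc (base v) = anc v \<and> base v \<in> anc v"
    and anc: "v \<in> reached K \<Longrightarrow> b \<in> anc v \<Longrightarrow> b \<in> reached K \<and> base b = b \<and> anc b \<subseteq> anc v"
    and chain: "v \<in> reached K \<Longrightarrow> b \<in> anc v \<Longrightarrow> c \<in> anc v \<Longrightarrow> b \<in> anc c \<or> c \<in> anc b"
    and parent: "b \<in> reached K \<Longrightarrow> base b = b \<Longrightarrow> b \<notin> tgt ` P \<Longrightarrow>
      pv b \<in> reached K \<and> anc b = insert b (anc (pv b)) \<and> b \<notin> anc (pv b) \<and>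
      (\<exists>d\<in>D. eid d = en b \<and> src d = pv b \<and> tgt d = b)"
    and root: "p \<in> P \<Longrightarrow> base (tgt p) = tgt p \<and> anc (tgt p) = {tgt p} \<and> en (tgt p) = eid p"
begin

abbreviation "nedges \<equiv> node_edges K base en"
abbreviation "tedges v \<equiv> (\<Union>b\<in>anc v. nedges b)"

text \<open>No node is an ancestor of its own parent vertex. A strict ancestor of \<open>b\<close>
  lies above \<open>pv b\<close>, so \<open>b\<close> cannot be above it.\<close>

lemma anc_antisym:
  assumes "v \<in> reached K" "b \<in> reached K" "base b = b" "v \<in> anc b" "b \<in> anc v" 
  shows "v = b"
proof (rule ccontr)
  assume n: "v \<noteq> b"
  have vb: "base v = v" using anc[OF assms(2,4)] by simp
  show False
  proof (cases "b \<in> tgt ` P")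
    case True
    then have "anc b = {b}" using root by auto
    then show ?thesis using assms n by auto
  next
    case False
    from parent[OF assms(2,3) this] have p: "pv b \<in> reached K" "anc b = insert b (anc (pv b))" "b \<notin> anc (pv b)"
      by auto
    then have "v \<in> anc (pv b)" using assms n by auto
    then have "anc v \<subseteq> anc (pv b)" using anc p by blast
    then show ?thesis using p assms by auto
  qed
qed

text \<open>An entering edge ends at the base of the node that it enters, so as an internal edge it
  could belong to that node only. If one edge entered two nodes, each would be the parent vertex of
  the other. Fictitious loops are kept apart by \<open>P_inj\<close> and \<open>P_D\<close>.\<close>

lemma nedges_disjoint:
  assumes b: "b \<in> reached K" "base b = b" and c: "c \<in> reached K" "base c = c"
    and e: "e \<in> nedges b" "e \<in> nedges c"
  shows "b = c"
proof -
  have int_en: "x = y" if x: "x \<in> reached K" "base x = x" and y: "y \<in> reached K" "base y = y"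
    and d: "d \<in> D" "base (src d) = x" "base (tgt d) = x" "eid d = en y" for x y d
  proof (cases "y \<in> tgt ` P")
    case True
    then show ?thesis using root P_D d by fastforce
  next
    case False
    from parent[OF y this] obtain d' where "d' \<in> D" "eid d' = en y" "tgt d' = y" by auto
    with D_inj[of d d'] d y show ?thesis by auto
  qed
  have en_en: "b = c" if ee: "en b = en c"
  proof (cases "b \<in> tgt ` P"; cases "c \<in> tgt ` P")
    assume "b \<in> tgt ` P" "c \<in> tgt ` P"
    then show ?thesis using ee root P_inj by (metis imageE)
  next
    assume "b \<in> tgt ` P" "c \<notin> tgt ` P"
    then show ?thesis using ee root parent[OF c] P_D by (metis imageE)
  next
    assume "b \<notin> tgt ` P" "c \<in> tgt ` P"
    then show ?thesis using ee root parent[OF b] P_D by (metis imageE)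
  next
    assume bs: "b \<notin> tgt ` P" and cs: "c \<notin> tgt ` P"
    from parent[OF b bs] obtain d where d: "d \<in> D" "eid d = en b" "src d = pv b" "tgt d = b" by auto
    from parent[OF c cs] obtain d' where d': "d' \<in> D" "eid d' = en c" "src d' = pv c" "tgt d' = c" by auto
    show ?thesis
    proof (rule ccontr)
      assume n: "b \<noteq> c"
      then have eq: "pv b = c" "pv c = b" using D_inj[OF d(1) d'(1)] d d' ee by auto
      have "b \<in> anc (pv c)" using base[OF b(1)] b eq by simp
      then have "b \<in> anc c" using parent[OF c cs] by auto
      then show False using parent[OF b bs] eq by auto
    qed
  qed
  show ?thesis
    using e unfolding node_edges_def
  proof (elim insertE)
    assume "e = en b" "e = en c"
    then show ?thesis using en_en by simp
  next
    assume "e = en b" "e \<in> {eid d |d. d \<in> D \<and> src d \<in> reached K \<and> tgt d \<in> reached K \<and> base (src d) = c \<and> base (tgt d) = c}"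
    then show ?thesis using int_en[OF c b] by auto
  next
    assume "e = en c" "e \<in> {eid d |d. d \<in> D \<and> src d \<in> reached K \<and> tgt d \<in> reached K \<and> base (src d) = b \<and> base (tgt d) = b}"
    then show ?thesis using int_en[OF b c] by auto
  next
    assume "e \<in> {eid d |d. d \<in> D \<and> src d \<in> reached K \<and> tgt d \<in> reached K \<and> base (src d) = b \<and> base (tgt d) = b}"
      "e \<in> {eid d |d. d \<in> D \<and> src d \<in> reached K \<and> tgt d \<in> reached K \<and> base (src d) = c \<and> base (tgt d) = c}"
    then obtain d d' where "d \<in> D" "d' \<in> D" "eid d = eid d'" "base (src d) = b" "base (tgt d) = b"
      "base (src d') = c" "base (tgt d') = c" by auto
    then show ?thesis using D_inj[of d d'] by auto
  qed
qed

text \<open>The form in which unique ownership is used: a shared edge of two trails yields a shared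
  ancestor.\<close>

lemma tedges_disjoint:
  assumes "v \<in> reached K" "w \<in> reached K" "e \<in> tedges v" "e \<in> tedges w"
  obtains b where "b \<in> anc v" "b \<in> anc w" "e \<in> nedges b"
proof -
  obtain b where b: "b \<in> anc v" "e \<in> nedges b" using assms(3) by blast
  obtain c where c: "c \<in> anc w" "e \<in> nedges c" using assms(4) by blast
  have "b = c"
    using nedges_disjoint[of b c e] anc[OF assms(1) b(1)] anc[OF assms(2) c(1)] b c by blast
  then show thesis using that b c by blast
qed

lemma tedges_mono: "v \<in> reached K \<Longrightarrow> b \<in> anc v \<Longrightarrow> tedges b \<subseteq> tedges v"
  using anc by blast

end

text \<open>\<open>K_edges\<close> and \<open>K_entries\<close> confine a trail to the nodes above
  its end and make it use all their entering edges. By \<open>K_split\<close>, a trail that passes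
  an inner ancestor \<open>a\<close> begins with the stored trail of \<open>a\<close>, unique by
  \<open>inner_unique\<close>, and never returns to edges owned by \<open>a\<close> or above. This
  makes unwinding down to \<open>a\<close> possible.\<close>

locale forest = node_tree eid src tgt clr rv D P K base pv en anc
  for eid :: "'d \<Rightarrow> 'e" and src tgt :: "'d \<Rightarrow> 'v" and clr :: "'d \<Rightarrow> 'c" and rv :: "'d \<Rightarrow> 'd"
    and D P :: "'d set" and K :: "'d list set" and base pv :: "'v \<Rightarrow> 'v" and en :: "'v \<Rightarrow> 'e"
    and anc :: "'v \<Rightarrow> 'v set" +
  assumes K_trail: "T \<in> K \<Longrightarrow> dtrail T"
    and K_init: "p \<in> P \<Longrightarrow> [p] \<in> K"
    and K_edges: "T \<in> K \<Longrightarrow> eids T \<subseteq> (\<Union>b\<in>anc (endv T). node_edges K base en b)"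
    and K_entries: "T \<in> K \<Longrightarrow> en ` anc (endv T) \<subseteq> eids T"
    and K_split: "T \<in> K \<Longrightarrow> a \<in> anc (endv T) \<Longrightarrow> a \<in> inner K \<Longrightarrow>
      \<exists>Q Ta. T = Q @ Ta \<and> Ta \<in> K \<and> endv Ta = a \<and> eids Q \<inter> (\<Union>b\<in>anc a. node_edges K base en b) = {}"
    and inner_base: "w \<in> reached K \<Longrightarrow> base w \<in> inner K \<Longrightarrow> w = base w"
    and inner_self: "v \<in> inner K \<Longrightarrow> base v = v"
    and inner_last: "T \<in> K \<Longrightarrow> endv T \<in> inner K \<Longrightarrow> eid (hd T) = en (endv T)"
    and inner_unique: "T \<in> K \<Longrightarrow> T' \<in> K \<Longrightarrow> endv T = endv T' \<Longrightarrow> endv T \<in> inner K \<Longrightarrow> T = T'"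
begin

section \<open>Contracting a connected set of nodes\<close>

lemma endv_reached: "T \<in> K \<Longrightarrow> endv T \<in> reached K"
  by (auto simp: reached_def)

lemma inner_reached: "v \<in> inner K \<Longrightarrow> v \<in> reached K"
  by (auto simp: inner_def)

text \<open>By \<open>M_parent\<close>, the edge entering a node of \<open>M\<close> other than
  \<open>z\<close> starts in a node of \<open>M\<close>, so it becomes an internal edge of the
  contracted node. All other edges keep their owner, with \<open>z\<close> in place of the nodes of
  \<open>M\<close>.\<close>

lemma contract_nedges:
  assumes zM: "z \<in> M" and M_base: "\<And>m. m \<in> M \<Longrightarrow> m \<in> reached K \<and> base m = m"
    and M_parent: "\<And>m. m \<in> M \<Longrightarrow> m \<noteq> z \<Longrightarrow> m \<notin> tgt ` P \<and> base (pv m) \<in> M"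
    and base'_def: "base' = (\<lambda>v. if base v \<in> M then z else base v)"
    and b: "b \<in> reached K" "base b = b"
  shows "nedges b \<subseteq> node_edges K base' en (if b \<in> M then z else b)"
proof -
  have b'1: "base' v = z" if "base v \<in> M" for v using that by (simp add: base'_def)
  have b'2: "base' v = base v" if "base v \<notin> M" for v using that by (simp add: base'_def)
  show ?thesis
  proof (cases "b \<in> M \<and> b \<noteq> z")
    case True
    from M_parent[of b] True have bp: "b \<notin> tgt ` P" "base (pv b) \<in> M" by auto
    from parent[OF b bp(1)] obtain d where d: "d \<in> D" "eid d = en b" "src d = pv b" "tgt d = b" "pv b \<in> reached K"
      by auto
    have "en b \<in> node_edges K base' en z"
      unfolding node_edges_def using d b bp True b'1[OF bp(2)] b'1[of b] by (auto intro!: exI[of _ d])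
    moreover have "base' v = z" if "base v = b" for v using that b'1[of v] True by simp
    ultimately show ?thesis using True unfolding node_edges_def by auto
  next
    case False
    then have *: "base' v = b" if "base v = b" for v using that b'1[of v] b'2[of v] by metis
    show ?thesis using False * unfolding node_edges_def by auto
  qed
qed

text \<open>\<open>M\<close> is a connected piece of the tree with top \<open>z\<close>. As
  \<open>pv\<close> names a vertex and not a node, \<open>pv\<close> and \<open>en\<close> stay as
  they are: a node hanging below \<open>M\<close> is still entered by the same edge. The lemma is
  applied with new trails in \<open>merge\<close> and with \<open>K' = K\<close> in
  \<open>inner_parent\<close>.\<close>

lemma contract:
  assumes zM: "z \<in> M" and M_base: "\<And>m. m \<in> M \<Longrightarrow> m \<in> reached K \<and> base m = m"
    and z_anc: "\<And>m. m \<in> M \<Longrightarrow> z \<in> anc m" and M_anc: "\<And>m. m \<in> M \<Longrightarrow> anc m \<subseteq> anc z \<union> M"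
    and M_parent: "\<And>m. m \<in> M \<Longrightarrow> m \<noteq> z \<Longrightarrow> m \<notin> tgt ` P \<and> base (pv m) \<in> M"
    and base'_def: "base' = (\<lambda>v. if base v \<in> M then z else base v)"
    and anc'_def: "anc' = (\<lambda>v. anc v - (M - {z}))"
    and KK': "K \<subseteq> K'" and inner': "inner K' = inner K - M"
    and new_trail: "\<And>T. T \<in> K' - K \<Longrightarrow> dtrail T" "\<And>T. T \<in> K' - K \<Longrightarrow> endv T \<in> M"
    and new_edges: "\<And>T. T \<in> K' - K \<Longrightarrow> eids T \<subseteq> (\<Union>b\<in>anc z. node_edges K base' en b)"
    and new_entries: "\<And>T. T \<in> K' - K \<Longrightarrow> en ` anc z \<subseteq> eids T"
    and new_split: "\<And>T a. T \<in> K' - K \<Longrightarrow> a \<in> anc z \<Longrightarrow> a \<in> inner K - M \<Longrightarrow>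
      \<exists>Q Ta. T = Q @ Ta \<and> Ta \<in> K \<and> endv Ta = a \<and> eids Q \<inter> tedges a = {}"
  shows "forest eid src tgt clr rv D P K' base' pv en anc'"
proof -
  have zR: "z \<in> reached K" "base z = z" using M_base zM by auto
  have R': "reached K' = reached K"
  proof
    show "reached K' \<subseteq> reached K"
    proof
      fix v assume "v \<in> reached K'"
      then obtain T where T: "T \<in> K'" "v = endv T" by (auto simp: reached_def)
      show "v \<in> reached K"
        using T new_trail(2)[of T] M_base endv_reached by (cases "T \<in> K") auto
    qed
  qed (rule reached_mono[OF KK'])
  have N': "node_edges K' base' en = node_edges K base' en"
    by (simp add: node_edges_def R' fun_eq_iff)
  have b'1: "base' v = z" if "base v \<in> M" for v using that by (simp add: base'_def)
  have b'2: "base' v = base v" if "base v \<notin> M" for v using that by (simp add: base'_def)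
  have b'3: "base' b = (if b \<in> M then z else b)" if "base b = b" for b using that by (simp add: base'_def)
  have Mz: "m = z" if "m \<in> M" "m \<in> anc z" for m
    using that z_anc anc_antisym M_base zR by metis
  have sub: "nedges b \<subseteq> node_edges K base' en (if b \<in> M then z else b)"
    if b: "b \<in> reached K" "base b = b" for b
    using contract_nedges[OF zM M_base M_parent base'_def b] .
  have anc'z: "anc' z = anc z" using Mz by (auto simp: anc'_def)
  have anc'M: "anc' v = anc z" if "v \<in> reached K" "base v \<in> M" for v
  proof -
    have "anc (base v) = anc v" using base that by simp
    moreover have "anc z \<subseteq> anc (base v)" using that z_anc anc M_base by blast
    ultimately show ?thesis using M_anc[OF that(2)] Mz zM z_anc[OF zM] by (auto simp: anc'_def)
  qed
  have base': "base' v \<in> reached K \<and> base' (base' v) = base' v \<and> anc' (base' v) = anc' v \<and> base' v \<in> anc' v"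
    if v: "v \<in> reached K" for v
  proof (cases "base v \<in> M")
    case True
    then show ?thesis using zR zM anc'M[OF v] anc'z z_anc[OF zM] b'1[OF True] b'3[OF zR(2)] by simp
  next
    case False
    then show ?thesis using base[OF v] b'2[OF False] b'3[of "base v"] anc'_def by auto
  qed
  have anc': "b \<in> reached K \<and> base' b = b \<and> anc' b \<subseteq> anc' v" if "v \<in> reached K" "b \<in> anc' v" for v b
    using that anc[of v b] b'3[of b] unfolding anc'_def by auto
  have chain': "b \<in> anc' c \<or> c \<in> anc' b" if "v \<in> reached K" "b \<in> anc' v" "c \<in> anc' v" for v b c
    using that chain[of v b c] by (auto simp: anc'_def)
  have base'_fix: "base b = b \<and> (b \<in> M \<longrightarrow> b = z)" if "b \<in> reached K" "base' b = b" for b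
    using that zR b'1[of b] b'2[of b] by metis
  have parent': "pv b \<in> reached K \<and> anc' b = insert b (anc' (pv b)) \<and> b \<notin> anc' (pv b) \<and>
      (\<exists>d\<in>D. eid d = en b \<and> src d = pv b \<and> tgt d = b)"
    if b: "b \<in> reached K" "base' b = b" "b \<notin> tgt ` P" for b
    using base'_fix[OF b(1,2)] parent[of b] b by (auto simp: anc'_def)
  have root': "base' (tgt p) = tgt p \<and> anc' (tgt p) = {tgt p} \<and> en (tgt p) = eid p" if "p \<in> P" for p
    using root[OF that] M_parent[of "tgt p"] that b'3[of "tgt p"] unfolding anc'_def by auto
  have conv: "\<exists>c\<in>anc' v. e \<in> node_edges K base' en c" if v: "v \<in> reached K" and e: "e \<in> tedges v" for v e
  proof -
    obtain b where b: "b \<in> anc v" "e \<in> nedges b" using e by blast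
    have e': "e \<in> node_edges K base' en (if b \<in> M then z else b)"
      using sub b anc[OF v b(1)] by blast
    show ?thesis
    proof (cases "b \<in> M")
      case True
      then have "z \<in> anc v" using z_anc anc[OF v b(1)] by blast
      then show ?thesis using e' True by (auto simp: anc'_def)
    next
      case False
      then show ?thesis using e' b by (auto simp: anc'_def)
    qed
  qed
  have K'_cases: "T \<in> K \<or> T \<in> K' - K" if "T \<in> K'" for T using that by auto
  have new_anc: "anc' (endv T) = anc z" if "T \<in> K' - K" for T
    using new_trail(2)[OF that] anc'M M_base by metis
  \<comment> \<open>The ancestors of such an \<open>a\<close> lie strictly above \<open>z\<close>,
    out of reach of the contraction.\<close>
  have old_anc: "nedges b = node_edges K base' en b" if b: "b \<in> anc a" and a: "a \<in> anc z" "a \<notin> M" for a b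
  proof -
    have "b \<notin> M"
    proof
      assume "b \<in> M"
      then have "z \<in> anc a" using z_anc b anc a zR by blast
      moreover have "a \<in> reached K" using anc zR a by blast
      ultimately show False using anc_antisym[of z a] anc[OF zR(1) a(1)] zR a zM by metis
    qed
    moreover have "base v = b \<longleftrightarrow> base' v = b" for v
      using b'1[of v] b'2[of v] \<open>b \<notin> M\<close> zM by metis
    ultimately show ?thesis unfolding node_edges_def by (simp only:)
  qed
  \<comment> \<open>The tree axioms come before the others because unique ownership in the new tree
    is needed to check \<open>K_split\<close> for the old trails.\<close>
  interpret T': node_tree eid src tgt clr rv D P K' base' pv en anc'
    apply unfold_locales
        apply (unfold R')
        apply (rule base', assumption)
       apply (rule anc', assumption, assumption)
      apply (rule chain', assumption, assumption, assumption)
     apply (rule parent', assumption, assumption, assumption)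
    apply (rule root', assumption)
    done
  note disj' = T'.nedges_disjoint[unfolded R' N']
  show ?thesis
  proof unfold_locales
    fix T assume "T \<in> K'"
    then show "dtrail T" using K'_cases K_trail new_trail by blast
  next
    fix p assume "p \<in> P" then show "[p] \<in> K'" using K_init KK' by auto
  next
    fix T assume T: "T \<in> K'"
    show "eids T \<subseteq> (\<Union>b\<in>anc' (endv T). node_edges K' base' en b)"
    proof (cases "T \<in> K")
      case True
      then show ?thesis unfolding N' using K_edges[OF True] conv[OF endv_reached[OF True]] by blast
    next
      case False
      then show ?thesis unfolding N' using new_edges[of T] T new_anc[of T] by simp
    qed
  next
    fix T assume T: "T \<in> K'"
    show "en ` anc' (endv T) \<subseteq> eids T"
    proof (cases "T \<in> K")
      case True
      then show ?thesis using K_entries[OF True] unfolding anc'_def by blast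
    next
      case False
      then show ?thesis using new_entries[of T] T new_anc[of T] by simp
    qed
  next
    fix T a assume T: "T \<in> K'" and a: "a \<in> anc' (endv T)" "a \<in> inner K'"
    have aA: "a \<in> inner K" "a \<notin> M" using a inner' by auto
    show "\<exists>Q Ta. T = Q @ Ta \<and> Ta \<in> K' \<and> endv Ta = a \<and>
      eids Q \<inter> (\<Union>b\<in>anc' a. node_edges K' base' en b) = {}"
    proof (cases "T \<in> K")
      case True
      note vR = endv_reached[OF True]
      have av: "a \<in> anc (endv T)" using a unfolding anc'_def by auto
      obtain Q Ta where Q: "T = Q @ Ta" "Ta \<in> K" "endv Ta = a" "eids Q \<inter> tedges a = {}"
        using K_split[OF True av aA(1)] by auto
      \<comment> \<open>An edge of \<open>Q\<close> owned by a node of \<open>M\<close> passes to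
        \<open>z\<close>. That could hurt only with \<open>z\<close> above \<open>a\<close>. But
        \<open>a\<close> is above that node of \<open>M\<close> and not in \<open>M\<close>, so it
        is also above \<open>z\<close>, and would equal \<open>z\<close>.\<close>
      have "e \<notin> node_edges K base' en c" if e: "e \<in> eids Q" and c: "c \<in> anc' a" for e c
      proof
        assume ec: "e \<in> node_edges K base' en c"
        have "e \<in> eids T" using e Q by auto
        then obtain b where b: "b \<in> anc (endv T)" "e \<in> nedges b" using K_edges[OF True] by blast
        have bR: "b \<in> reached K" "base b = b" using anc[OF vR b(1)] by auto
        have aR: "a \<in> reached K" using aA inner_reached by auto
        define \<beta> where "\<beta> = (if b \<in> M then z else b)"
        have "e \<in> node_edges K base' en \<beta>" using sub[OF bR] b by (auto simp: \<beta>_def)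
        moreover have "\<beta> \<in> reached K" "base' \<beta> = \<beta>"
          using bR zR zM b'3[of \<beta>] by (auto simp: \<beta>_def)
        ultimately have c\<beta>: "c = \<beta>" using disj'[OF _ _ _ _ ec] anc'[OF aR c] by blast
        have b_a: "b \<notin> anc a" using e Q(4) b by blast
        show False
        proof (cases "b \<in> M")
          case True
          then have "z \<in> anc a" using c c\<beta> unfolding anc'_def \<beta>_def by auto
          have "a \<in> anc b" using chain[OF vR b(1) av] b_a by auto
          then have "a \<in> anc z" using M_anc[OF True] aA by auto
          then have "a = z" using anc_antisym[of a z] aR zR inner_self aA \<open>z \<in> anc a\<close> by metis
          then show False using aA zM by simp
        next
          case False
          then show False using c c\<beta> b_a unfolding anc'_def \<beta>_def by auto
        qed
      qed
      then show ?thesis unfolding N' using Q KK' by blast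
    next
      case False
      then have Tn: "T \<in> K' - K" using T by auto
      have az: "a \<in> anc z" using a new_anc[OF Tn] by simp
      obtain Q Ta where Q: "T = Q @ Ta" "Ta \<in> K" "endv Ta = a" "eids Q \<inter> tedges a = {}"
        using new_split[OF Tn az] aA by auto
      have "(\<Union>b\<in>anc' a. node_edges K' base' en b) \<subseteq> tedges a"
        unfolding N' using old_anc[OF _ az aA(2)] by (auto simp: anc'_def)
      then show ?thesis using Q KK' by blast
    qed
  next
    fix w assume "w \<in> reached K'" "base' w \<in> inner K'"
    then show "w = base' w"
      using inner_base[of w] zM b'1[of w] b'2[of w] unfolding R' inner' by (cases "base w \<in> M") auto
  next
    fix v assume "v \<in> inner K'"
    then show "base' v = v" using inner_self[of v] b'3[of v] inner' by auto
  next
    fix T assume T: "T \<in> K'" "endv T \<in> inner K'"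
    then have "T \<in> K" using new_trail(2)[of T] inner' by auto
    then show "eid (hd T) = en (endv T)" using inner_last T inner' by auto
  next
    fix T T' assume T: "T \<in> K'" "T' \<in> K'" "endv T = endv T'" "endv T \<in> inner K'"
    then have "T \<in> K" "T' \<in> K" using new_trail(2)[of T] new_trail(2)[of T'] inner' by auto
    then show "T = T'" using inner_unique[of T T'] T inner' by blast
  qed
qed

section \<open>Attaching a new vertex as a singleton node\<close>

lemma grow:
  assumes T: "T \<in> K" and d: "d \<in> D" "usable d T" "tgt d \<notin> reached K"
  shows "forest eid src tgt clr rv D P (insert (d # T) K) (base(tgt d := tgt d)) (pv(tgt d := src d))
    (en(tgt d := eid d)) (anc(tgt d := insert (tgt d) (anc (src d))))" (is ?forest)
    "reached (insert (d # T) K) = insert (tgt d) (reached K)"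
    "inner (insert (d # T) K) = insert (tgt d) (inner K)"
proof -
  define y where "y = tgt d"
  define K' where "K' = insert (d # T) K"
  define base' where "base' = base(y := y)"
  define en' where "en' = en(y := eid d)"
  define anc' where "anc' = anc(y := insert y (anc (src d)))"
  have x: "src d = endv T" "src d \<in> reached K" using d T by (auto simp: usable_def reached_def)
  have yR: "y \<notin> reached K" using d by (simp add: y_def)
  have R': "reached K' = insert y (reached K)" by (auto simp: reached_def K'_def y_def)
  have hy: "endv U = y \<longleftrightarrow> U = d # T" if "U \<in> K'" for U
  proof
    assume "endv U = y"
    then have "U \<notin> K" using yR by (auto simp: reached_def)
    then show "U = d # T" using that by (simp add: K'_def)
  qed (simp add: y_def)
  have full': "full K' v \<longleftrightarrow> full K v" for v
  proof (cases "v = y")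
    case True
    have "\<not> full K y" using yR by (auto simp: full_def reached_def)
    moreover have "\<not> full K' y" unfolding full_def using hy by metis
    ultimately show ?thesis using True by simp
  next
    case False
    then show ?thesis by (auto simp: full_def K'_def y_def)
  qed
  have "\<not> full K y" using yR by (auto simp: full_def reached_def)
  then have inner': "inner K' = insert y (inner K)" unfolding inner_def R' full' by auto
  have yb: "base v \<noteq> y" if "v \<in> reached K" for v using base[OF that] yR by auto
  have ya: "y \<notin> anc v" if "v \<in> reached K" for v using anc[OF that] yR by auto
  have N_old: "node_edges K' base' en' b = nedges b" if "b \<noteq> y" for b
    using that yR unfolding node_edges_def R' by (auto simp: base'_def en'_def)
  have N_y: "node_edges K' base' en' y = {eid d}"
  proof -
    have "False" if "e \<in> D" "src e \<in> insert y (reached K)" "tgt e \<in> insert y (reached K)" "base' (src e) = y" "base' (tgt e) = y" for e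
      using that yb D_neq[OF that(1)] by (auto simp: base'_def split: if_splits)
    then show ?thesis unfolding node_edges_def R' en'_def by auto
  qed
  have S: "p \<in> P \<Longrightarrow> tgt p \<noteq> y" for p using K_init yR unfolding reached_def by force
  have TE: "tedges v = (\<Union>b\<in>anc' v. node_edges K' base' en' b)" if "v \<in> reached K" for v
  proof -
    have "anc' v = anc v" using that yR by (auto simp: anc'_def)
    moreover have "nedges b = node_edges K' base' en' b" if "b \<in> anc v" for b
      using that ya[OF \<open>v \<in> reached K\<close>] N_old by metis
    ultimately show ?thesis by simp
  qed
  have TEy: "(\<Union>b\<in>anc' y. node_edges K' base' en' b) = insert (eid d) (tedges (src d))"
    using TE[OF x(2)] N_y ya[OF x(2)] by (auto simp: anc'_def)
  \<comment> \<open>Apart from the fictitious loops, both ends of an owned edge are reached, and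
    \<open>y\<close> is not.\<close>
  have d_new: "eid d \<notin> tedges v" if v: "v \<in> reached K" for v
  proof
    assume "eid d \<in> tedges v"
    then obtain b where b: "b \<in> anc v" "eid d \<in> nedges b" by auto
    have bR: "b \<in> reached K" "base b = b" using anc[OF v b(1)] by auto
    show False
    proof (cases "eid d = en b")
      case True
      show False
      proof (cases "b \<in> tgt ` P")
        case True
        then show False using root P_D d(1) \<open>eid d = en b\<close> by force
      next
        case False
        from parent[OF bR False] obtain e where "e \<in> D" "eid e = en b" "src e \<in> reached K" "tgt e \<in> reached K"
          using bR by auto
        then show False using D_inj[of d e] d(1) True yR by (auto simp: y_def)
      qed
    next
      case False
      then obtain e where "e \<in> D" "eid e = eid d" "src e \<in> reached K" "tgt e \<in> reached K"
        using b(2) by (auto simp: node_edges_def)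
      then show False using D_inj[of d e] d(1) yR by (auto simp: y_def)
    qed
  qed
  have T_tr: "dtrail T" using K_trail T .
  then have T_ne: "T \<noteq> []" by (auto simp: dtrail_def)
  have dT: "dtrail (d # T)"
    using T_tr d T_ne by (auto simp: dtrail_def alt_Cons usable_def eids_def)
  have "forest eid src tgt clr rv D P K' base' (pv(y := src d)) en' anc'"
  proof (unfold_locales, unfold R')
    fix v assume v: "v \<in> insert y (reached K)"
    show "base' v \<in> insert y (reached K) \<and> base' (base' v) = base' v \<and> anc' (base' v) = anc' v \<and> base' v \<in> anc' v"
      using v base[of v] yb[of v] by (cases "v = y") (auto simp: base'_def anc'_def)
  next
    fix v b assume v: "v \<in> insert y (reached K)" and b: "b \<in> anc' v"
    show "b \<in> insert y (reached K) \<and> base' b = b \<and> anc' b \<subseteq> anc' v"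
    proof (cases "b = y")
      case True
      then show ?thesis using v b ya[of v] by (cases "v = y") (auto simp: base'_def anc'_def)
    next
      case False
      then show ?thesis using v b anc[of v b] anc[OF x(2), of b]
        by (cases "v = y") (auto simp: base'_def anc'_def)
    qed
  next
    fix v b c assume v: "v \<in> insert y (reached K)" and bc: "b \<in> anc' v" "c \<in> anc' v"
    show "b \<in> anc' c \<or> c \<in> anc' b"
    proof (cases "v = y")
      case True
      then show ?thesis using bc chain[OF x(2), of b c] ya[OF x(2)] by (auto simp: anc'_def)
    next
      case False
      then show ?thesis using bc v chain[of v b c] ya[of v] by (auto simp: anc'_def)
    qed
  next
    fix b assume b: "b \<in> insert y (reached K)" "base' b = b" "b \<notin> tgt ` P"
    show "(pv(y := src d)) b \<in> insert y (reached K) \<and> anc' b = insert b (anc' ((pv(y := src d)) b)) \<and>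
        b \<notin> anc' ((pv(y := src d)) b) \<and>
        (\<exists>e\<in>D. eid e = en' b \<and> src e = (pv(y := src d)) b \<and> tgt e = b)"
    proof (cases "b = y")
      case True
      then show ?thesis using x d ya[OF x(2)] yR by (auto simp: en'_def anc'_def y_def)
    next
      case False
      then have "b \<in> reached K" "base b = b" using b by (auto simp: base'_def)
      from parent[OF this b(3)] show ?thesis using False yR by (auto simp: anc'_def en'_def)
    qed
  next
    fix p assume "p \<in> P"
    then show "base' (tgt p) = tgt p \<and> anc' (tgt p) = {tgt p} \<and> en' (tgt p) = eid p"
      using root[of p] S[of p] by (auto simp: base'_def anc'_def en'_def)
  next
    fix U assume "U \<in> K'"
    then show "dtrail U" using K_trail dT by (auto simp: K'_def)
  next
    fix p assume "p \<in> P"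
    then show "[p] \<in> K'" using K_init by (auto simp: K'_def)
  next
    fix U assume U: "U \<in> K'"
    show "eids U \<subseteq> (\<Union>b\<in>anc' (endv U). node_edges K' base' en' b)"
    proof (cases "endv U = y")
      case True
      then have "U = d # T" using hy U by auto
      then show ?thesis unfolding True TEy using K_edges[OF T] x by auto
    next
      case False
      then have "U \<in> K" using hy U by (auto simp: K'_def)
      then show ?thesis using K_edges[of U] TE[of "endv U"] endv_reached by auto
    qed
  next
    fix U assume U: "U \<in> K'"
    show "en' ` anc' (endv U) \<subseteq> eids U"
    proof (cases "endv U = y")
      case True
      then have U: "U = d # T" using hy U by auto
      show ?thesis unfolding True using K_entries[OF T] x ya[OF x(2)] 
        by (auto simp: U anc'_def en'_def)
    next
      case False
      then have "U \<in> K" using hy U by (auto simp: K'_def)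
      then show ?thesis using K_entries[of U] False ya[of "endv U"] endv_reached[of U]
        by (auto simp: anc'_def en'_def)
    qed
  next
    fix U a assume U: "U \<in> K'" and a: "a \<in> anc' (endv U)" "a \<in> inner K'"
    show "\<exists>Q Ta. U = Q @ Ta \<and> Ta \<in> K' \<and> endv Ta = a \<and> eids Q \<inter> (\<Union>b\<in>anc' a. node_edges K' base' en' b) = {}"
    proof (cases "a = y")
      case True
      then have "endv U = y" using a ya[of "endv U"] U endv_reached[of U] hy[OF U]
        by (auto simp: anc'_def K'_def split: if_splits)
      then show ?thesis using True U by (intro exI[of _ "[]"] exI[of _ U]) auto
    next
      case False
      then have aA: "a \<in> inner K" "a \<in> reached K" using a inner' inner_reached by auto
      show ?thesis
      proof (cases "endv U = y")
        case True
        then have Ud: "U = d # T" using hy U by auto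
        have "a \<in> anc (endv T)" using a False True x by (auto simp: anc'_def)
        from K_split[OF T this aA(1)] obtain Q Ta where "T = Q @ Ta" "Ta \<in> K" "endv Ta = a" "eids Q \<inter> tedges a = {}"
          by auto
        then show ?thesis using d_new[OF aA(2)] TE[OF aA(2)] Ud
          by (intro exI[of _ "d # Q"] exI[of _ Ta]) (auto simp: K'_def)
      next
        case f: False
        then have UK: "U \<in> K" using hy U by (auto simp: K'_def)
        have "a \<in> anc (endv U)" using a f by (auto simp: anc'_def)
        from K_split[OF UK this aA(1)] show ?thesis using TE[OF aA(2)] by (auto simp: K'_def)
      qed
    qed
  next
    fix w assume w: "w \<in> insert y (reached K)" "base' w \<in> inner K'"
    then show "w = base' w" using inner_base[of w] yb[of w] unfolding inner' 
      by (cases "w = y") (auto simp: base'_def)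
  next
    fix v assume "v \<in> inner K'"
    then show "base' v = v" using inner_self inner' by (auto simp: base'_def)
  next
    fix U assume U: "U \<in> K'" "endv U \<in> inner K'"
    show "eid (hd U) = en' (endv U)"
    proof (cases "endv U = y")
      case True
      then show ?thesis using hy[OF U(1)] by (auto simp: en'_def y_def)
    next
      case False
      then have "U \<in> K" using hy U by (auto simp: K'_def)
      then show ?thesis using inner_last[of U] False U inner' by (auto simp: en'_def)
    qed
  next
    fix U U' assume U: "U \<in> K'" "U' \<in> K'" "endv U = endv U'" "endv U \<in> inner K'"
    show "U = U'"
    proof (cases "endv U = y")
      case True
      then show ?thesis using hy[OF U(1)] hy[OF U(2)] U(3) by auto
    next
      case False
      then have "U \<in> K" "U' \<in> K" using hy[OF U(1)] hy[OF U(2)] U by (auto simp: K'_def)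
      then show ?thesis using inner_unique[of U U'] U inner' False by blast
    qed
  qed
  then show ?forest "reached (insert (d # T) K) = insert (tgt d) (reached K)"
    "inner (insert (d # T) K) = insert (tgt d) (inner K)"
    using R' inner' unfolding K'_def base'_def en'_def anc'_def y_def by simp_all
qed

section \<open>Common ancestors and the cycle closed by an edge\<close>

lemma finite_reached: "finite (reached K)"
proof -
  have "reached K \<subseteq> tgt ` (D \<union> P)"
  proof
    fix v assume "v \<in> reached K"
    then obtain T where T: "T \<in> K" "v = endv T" by (auto simp: reached_def)
    then have "alt T" using K_trail by (auto simp: dtrail_def)
    then have "hd T \<in> D \<union> P" using alt_ends[of T "hd T"] alt_nonempty[of T] by auto
    then show "v \<in> tgt ` (D \<union> P)" using T by auto
  qed
  then show ?thesis using finite_D finite_P by (meson finite_UnI finite_imageI finite_subset)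
qed

text \<open>The common ancestors form a chain, so the one with the most ancestors lies below all the
  others.\<close>

lemma lowest_common_ancestor:
  assumes v: "v \<in> reached K" and w: "w \<in> reached K" and ne: "anc v \<inter> anc w \<noteq> {}"
  obtains z where "z \<in> reached K" "base z = z" "anc v \<inter> anc w = anc z"
proof -
  have fin: "finite (anc u)" if "u \<in> reached K" for u
    using anc[OF that] finite_reached by (meson finite_subset subsetI)
  have fI: "finite (anc v \<inter> anc w)" using fin[OF v] by auto
  let ?C = "(\<lambda>z. card (anc z)) ` (anc v \<inter> anc w)"
  have "Max ?C \<in> ?C" using fI ne by (intro Max_in) auto
  then obtain z where z: "z \<in> anc v \<inter> anc w" "card (anc z) = Max ?C" by force
  have z_max: "card (anc u) \<le> card (anc z)" if "u \<in> anc v \<inter> anc w" for u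
    unfolding z(2) using fI that by (intro Max_ge) auto
  have zR: "z \<in> reached K" "base z = z" using anc[OF v] z by auto
  have zz: "u \<in> reached K \<Longrightarrow> base u = u \<Longrightarrow> u \<in> anc u" for u using base[of u] by auto
  have "u \<in> anc z" if u: "u \<in> anc v \<inter> anc w" for u
  proof (rule ccontr)
    assume n: "u \<notin> anc z"
    have uR: "u \<in> reached K" "base u = u" using anc[OF v] u by auto
    have "z \<in> anc u" using chain[OF v, of u z] u z n by auto
    then have "anc z \<subseteq> anc u" using anc uR by blast
    moreover have "u \<in> anc u" using zz uR by auto
    ultimately have "anc z \<subset> anc u" using n by auto
    then have "card (anc z) < card (anc u)" using fin[OF uR(1)] psubset_card_mono by blast
    then show False using z_max[OF u] by simp
  qed
  moreover have "anc z \<subseteq> anc v \<inter> anc w" using z anc v w by blast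
  ultimately have "anc v \<inter> anc w = anc z" by blast
  then show thesis using that zR by blast
qed

text \<open>Without a common ancestor the two trails have no owner in common and hence no edge, so
  the edge between their ends would complete a connecting trail.\<close>

lemma link_meets:
  assumes "d \<in> D" "T \<in> K" "T' \<in> K" "usable d T" "usable (rv d) T'"
    and "\<not> distinct (map eid (map rv (rev T') @ d # T))"
  shows "anc (endv T) \<inter> anc (endv T') \<noteq> {}"
proof
  assume e: "anc (endv T) \<inter> anc (endv T') = {}"
  have "eids T \<inter> eids T' = {}"
  proof (rule ccontr)
    assume "eids T \<inter> eids T' \<noteq> {}"
    then obtain e where e': "e \<in> eids T" "e \<in> eids T'" by auto
    have "e \<in> tedges (endv T)" "e \<in> tedges (endv T')"
      using K_edges[OF assms(2)] K_edges[OF assms(3)] e' by blast+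
    from tedges_disjoint[OF endv_reached[OF assms(2)] endv_reached[OF assms(3)] this] e
    show False by blast
  qed
  moreover have "distinct (map eid T)" "distinct (map eid T')" using K_trail assms by (auto simp: dtrail_def)
  moreover have "eid d \<notin> eids T" "eid d \<notin> eids T'" using assms by (auto simp: usable_def)
  ultimately have "distinct (map eid (map rv (rev T') @ d # T))"
    unfolding distinct_unwind by (auto simp: eids_def)
  then show False using assms by simp
qed

text \<open>\<open>M\<close> is the cycle closed by \<open>d\<close>: \<open>z\<close> and the two
  paths below it. Only unwinding along \<open>T'\<close> is treated; for the inner vertices on the
  other path, \<open>merge\<close> applies the lemma once more to \<open>rv d\<close>.\<close>

lemma merge_half:
  assumes d: "d \<in> D" "usable d T" "usable (rv d) T'" and T: "T \<in> K" and T': "T' \<in> K"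
    and z: "anc (endv T) \<inter> anc (endv T') = anc z" "z \<in> reached K" "base z = z"
    and M: "M = anc (endv T) \<union> anc (endv T') - (anc z - {z})"
  shows "U \<in> unwinds K d T T' \<Longrightarrow> dtrail U \<and> endv U \<in> M \<inter> inner K \<and> (\<exists>Tv\<in>K. endv Tv = endv U \<and> clr (hd Tv) \<noteq> clr (hd U)) \<and>
      eids U \<subseteq> (\<Union>b\<in>anc z. node_edges K (\<lambda>v. if base v \<in> M then z else base v) en b) \<and>
      en ` anc z \<subseteq> eids U \<and>
      (\<forall>a\<in>anc z. a \<in> inner K - M \<longrightarrow> (\<exists>Q Ta. U = Q @ Ta \<and> Ta \<in> K \<and> endv Ta = a \<and> eids Q \<inter> tedges a = {}))"
      (is "_ \<Longrightarrow> ?sound")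
    and "v \<in> inner K \<Longrightarrow> v \<in> M \<Longrightarrow> v \<in> anc (endv T') \<Longrightarrow> \<exists>U\<in>unwinds K d T T'. endv U = v"
    and "z \<in> M \<and> (\<forall>m\<in>M. m \<in> reached K \<and> base m = m \<and> z \<in> anc m \<and> anc m \<subseteq> anc z \<union> M \<and>
       (m \<noteq> z \<longrightarrow> m \<notin> tgt ` P \<and> base (pv m) \<in> M))" (is ?M)
proof -
  define x where "x = endv T"
  define y where "y = endv T'"
  have xR: "x \<in> reached K" and yR: "y \<in> reached K" using T T' endv_reached by (auto simp: x_def y_def)
  note z = z[folded x_def y_def] and M = M[folded x_def y_def]
  have zz: "z \<in> anc z" using base[OF z(2)] z(3) by auto
  have zx: "z \<in> anc x" and zy: "z \<in> anc y" using zz z(1) by auto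
  have ancz: "anc z \<subseteq> anc x" "anc z \<subseteq> anc y" using z(1) by auto
  have side: "m \<in> reached K \<and> base m = m \<and> z \<in> anc m \<and> anc m \<subseteq> anc z \<union> M \<and>
       (m \<noteq> z \<longrightarrow> m \<notin> tgt ` P \<and> base (pv m) \<in> M)"
    if m: "m \<in> anc w" "m \<in> M" and w: "w \<in> reached K" "z \<in> anc w" "anc w \<subseteq> anc x \<union> anc y" for m w
  proof -
    have mR: "m \<in> reached K" "base m = m" "anc m \<subseteq> anc w" using anc[OF w(1) m(1)] by auto
    have mm: "m \<in> anc m" using base[OF mR(1)] mR(2) by auto
    have zm: "z \<in> anc m" using chain[OF w(1) m(1) w(2)] m(2) M zz by auto
    have sub: "anc m \<subseteq> anc z \<union> M" using mR w M by auto
    have "m \<notin> tgt ` P \<and> base (pv m) \<in> M" if mz: "m \<noteq> z"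
    proof
      show nS: "m \<notin> tgt ` P"
      proof
        assume "m \<in> tgt ` P"
        then have "anc m = {m}" using root by auto
        then show False using zm mz by auto
      qed
      from parent[OF mR(1,2) nS] have p: "pv m \<in> reached K" "anc m = insert m (anc (pv m))" "m \<notin> anc (pv m)"
        by auto
      have bp: "base (pv m) \<in> anc (pv m)" "base (pv m) \<in> reached K" "anc (base (pv m)) = anc (pv m)"
        "base (base (pv m)) = base (pv m)"
        using base[OF p(1)] by auto
      have "z \<in> anc (base (pv m))" using p zm mz bp by auto
      moreover have "base (pv m) \<noteq> z \<Longrightarrow> base (pv m) \<notin> anc z"
        using anc_antisym[of "base (pv m)" z] bp z calculation by metis
      ultimately show "base (pv m) \<in> M" using bp p mR w unfolding M by auto
    qed
    then show ?thesis using mR zm sub by auto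
  qed
  have zM: "z \<in> M" using M zz zx by auto
  have Mp: "m \<in> reached K \<and> base m = m \<and> z \<in> anc m \<and> anc m \<subseteq> anc z \<union> M \<and>
       (m \<noteq> z \<longrightarrow> m \<notin> tgt ` P \<and> base (pv m) \<in> M)" if "m \<in> M" for m
  proof (cases "m \<in> anc x")
    case True
    then show ?thesis using side[OF True that xR zx] by blast
  next
    case False
    then have "m \<in> anc y" using that M by auto
    then show ?thesis using side[OF _ that yR zy] by blast
  qed
  then show ?M using zM by blast
  have dx: "src d = x" "tgt d = y" using d by (auto simp: usable_def x_def y_def)
  have Ttr: "dtrail T" "dtrail T'" using K_trail T T' by auto
  have Tne: "T \<noteq> []" using Ttr by (auto simp: dtrail_def)
  have altd: "alt (d # T)" using Tne Ttr d by (auto simp: alt_Cons dtrail_def usable_def)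
  have distd: "distinct (map eid (d # T))" using Ttr d by (auto simp: dtrail_def usable_def eids_def)
  have dT': "eid d \<notin> eids T'" using d by (auto simp: usable_def)
  have TE: "eids T \<subseteq> tedges x" "eids T' \<subseteq> tedges y" using K_edges T T' by (auto simp: x_def y_def)
  have TEn: "en ` anc x \<subseteq> eids T" "en ` anc y \<subseteq> eids T'" using K_entries T T' by (auto simp: x_def y_def)
  define base' where "base' = (\<lambda>v. if base v \<in> M then z else base v)"
  have baseM: "base w \<in> M" if w: "w = x \<or> w = y" for w
  proof -
    have wR: "w \<in> reached K" and zw: "z \<in> anc w" using w xR yR zx zy by auto
    have bw: "base w \<in> reached K" "base (base w) = base w" "anc (base w) = anc w" "base w \<in> anc w"
      using base[OF wR] by auto
    have "base w \<in> anc z \<Longrightarrow> base w = z"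
      using anc_antisym[of "base w" z] bw z zw by metis
    then show ?thesis using bw w M by auto
  qed
  have sub: "nedges b \<subseteq> node_edges K base' en (if b \<in> M then z else b)" if "b \<in> reached K" "base b = b" for b
    using contract_nedges[OF zM _ _ base'_def that] Mp by blast
  have TE': "tedges w \<subseteq> (\<Union>b\<in>anc z. node_edges K base' en b)" if w: "w = x \<or> w = y" for w
  proof
    fix e assume "e \<in> tedges w"
    then obtain b where b: "b \<in> anc w" "e \<in> nedges b" by blast
    have "b \<in> reached K" "base b = b" using anc b w xR yR by auto
    from sub[OF this] b have e: "e \<in> node_edges K base' en (if b \<in> M then z else b)" by blast
    show "e \<in> (\<Union>b\<in>anc z. node_edges K base' en b)"
    proof (cases "b \<in> M")
      case True
      then show ?thesis using e zz by auto
    next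
      case False
      then have "b \<in> anc z" using b w M by auto
      then show ?thesis using e False by auto
    qed
  qed
  have dE: "eid d \<in> node_edges K base' en z"
    using d(1) dx xR yR baseM[of x] baseM[of y] unfolding node_edges_def base'_def by auto
  show ?sound if U: "U \<in> unwinds K d T T'"
  proof -
    obtain Q Tv where Q: "T' = Q @ Tv" "Tv \<in> K" "endv Tv \<in> inner K" "U = map rv (rev Q) @ d # T"
      "distinct (map eid U)"
      using U by (auto simp: unwinds_def)
    have Tvne: "Tv \<noteq> []" using K_trail[OF Q(2)] by (auto simp: dtrail_def)
    have aU: "alt U" "endv U = endv Tv" "clr (hd U) \<noteq> clr (hd Tv)"
      using alt_unwind[OF altd, of Q Tv] Ttr(2) Tvne d Q unfolding usable_def dtrail_def by auto
    define v where "v = endv Tv"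
    have vA: "v \<in> inner K" "base v = v" "v \<in> reached K"
      using Q inner_self inner_reached by (auto simp: v_def)
    have vv: "v \<in> anc v" using base[OF vA(3)] vA(2) by auto
    \<comment> \<open>Why \<open>v\<close> is above \<open>y\<close>: the trail \<open>T'\<close>
      contains the edge entering \<open>v\<close>, and \<open>v\<close> is the only owner of that
      edge.\<close>
    have "en v = eid (hd Tv)" using inner_last Q v_def by auto
    then have env: "en v \<in> eids T'" using Q Tvne by (auto simp: eids_def)
    then obtain b where b: "b \<in> anc y" "en v \<in> nedges b" using TE by blast
    have "b = v" using nedges_disjoint[of b v "en v"] anc[OF yR b(1)] b vA by (auto simp: node_edges_def)
    then have vy: "v \<in> anc y" using b by simp
    \<comment> \<open>Strictly above \<open>z\<close> nothing can be unwound to: \<open>T\<close>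
      and \<open>T'\<close> both contain \<open>en z\<close> and the trail of \<open>v\<close> does
      not, so \<open>en z\<close> would occur in \<open>Q\<close> and again in
      \<open>T\<close>.\<close>
    have vM: "v \<in> M"
    proof (rule ccontr)
      assume "v \<notin> M"
      then have vz: "v \<in> anc z" "v \<noteq> z" using vy M by auto
      have "z \<notin> anc v" using anc_antisym[of z v] vz vA z by metis
      have "en z \<notin> eids Tv"
      proof
        assume "en z \<in> eids Tv"
        then have "en z \<in> tedges v" using K_edges[OF Q(2)] by (auto simp: v_def)
        then obtain c where c: "c \<in> anc v" "en z \<in> nedges c" by blast
        have "c = z" using nedges_disjoint[of c z "en z"] anc[OF vA(3) c(1)] c z by (auto simp: node_edges_def)
        then show False using c \<open>z \<notin> anc v\<close> by simp
      qed
      moreover have "en z \<in> eids T'" "en z \<in> eids T" using TEn zx zy by auto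
      ultimately have "en z \<in> eids Q" "en z \<in> eids (d # T)" using Q by auto
      then show False using Q(5) unfolding Q(4) distinct_unwind by blast
    qed
    obtain Q2 where Q2: "T' = Q2 @ Tv" "eids Q2 \<inter> tedges v = {}"
    proof -
      obtain Q2 Tw where w: "T' = Q2 @ Tw" "Tw \<in> K" "endv Tw = v" "eids Q2 \<inter> tedges v = {}"
        using K_split[OF T' vy[unfolded y_def] vA(1)] by blast
      moreover have "Tw = Tv" using inner_unique[OF w(2) Q(2)] w(3) vA(1) v_def by simp
      ultimately show ?thesis using that by blast
    qed
    have QQ: "eids Q \<inter> tedges v = {}" using Q Q2 by auto
    have zv: "anc z \<subseteq> anc v" using Mp[OF vM] anc[OF vA(3)] by blast
    have e1: "eids U \<subseteq> (\<Union>b\<in>anc z. node_edges K base' en b)"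
    proof -
      have "eids U \<subseteq> insert (eid d) (eids T \<union> eids T')" using Q by auto
      also have "\<dots> \<subseteq> insert (eid d) (tedges x \<union> tedges y)" using TE by blast
      also have "\<dots> \<subseteq> (\<Union>b\<in>anc z. node_edges K base' en b)" using TE'[of x] TE'[of y] dE zz by blast
      finally show ?thesis .
    qed
    have "en ` anc z \<subseteq> eids T" using TEn(1) ancz(1) by blast
    then have e2: "en ` anc z \<subseteq> eids U" using Q(4) by auto
    have e3: "\<exists>R Ta. U = R @ Ta \<and> Ta \<in> K \<and> endv Ta = a \<and> eids R \<inter> tedges a = {}"
      if a: "a \<in> anc z" "a \<in> inner K - M" for a
    proof -
      have aR: "a \<in> reached K" "base a = a" using anc[OF z(2) a(1)] by auto
      have ax: "a \<in> anc (endv T)" using a ancz by (auto simp: x_def)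
      obtain R Ta where R: "T = R @ Ta" "Ta \<in> K" "endv Ta = a" "eids R \<inter> tedges a = {}"
        using K_split[OF T ax] a by auto
      have av: "tedges a \<subseteq> tedges v" using zv a tedges_mono[OF vA(3)] by blast
      have "z \<notin> anc a" using anc_antisym[of z a] a z aR zM by auto
      \<comment> \<open>As the entering edge of a node above \<open>a\<close>, this edge would
        already occur in \<open>T\<close>. As an internal edge it would place the node of
        \<open>x\<close> above \<open>a\<close>, but that node is in \<open>M\<close>.\<close>
      have "eid d \<notin> tedges a"
      proof
        assume "eid d \<in> tedges a"
        then obtain b where b: "b \<in> anc a" "eid d \<in> nedges b" by blast
        have bR: "b \<in> reached K" "base b = b" using anc[OF aR(1) b(1)] by auto
        have bM: "b \<notin> M" using Mp[of b] b(1) \<open>z \<notin> anc a\<close> anc[OF aR(1)] by blast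
        show False
        proof (cases "eid d = en b")
          case True
          have "b \<in> anc z" using b(1) a(1) anc[OF z(2)] by blast
          then have "en b \<in> eids T" using TEn ancz by blast
          then show False using True d by (auto simp: usable_def)
        next
          case False
          then obtain e where "e \<in> D" "eid e = eid d" "base (src e) = b" "base (tgt e) = b"
            using b(2) by (auto simp: node_edges_def)
          then have "base x = b" using D_inj[of e d] d(1) dx by auto
          then show False using baseM[of x] bM by simp
        qed
      qed
      moreover have "eids (map rv (rev Q) @ d # R) = insert (eid d) (eids Q \<union> eids R)" by simp
      moreover have "insert e (A \<union> B) \<inter> X = {}" if "e \<notin> X" "A \<inter> Y = {}" "X \<subseteq> Y" "B \<inter> X = {}" for e A B X and Y :: "'e set"
        using that by blast
      ultimately have "eids (map rv (rev Q) @ d # R) \<inter> tedges a = {}" using R(4) QQ av by metis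
      then show ?thesis using Q R by (intro exI[of _ "map rv (rev Q) @ d # R"] exI[of _ Ta]) auto
    qed
    have "dtrail U" using aU Q by (auto simp: dtrail_def)
    moreover have "endv U \<in> M \<inter> inner K" using aU vM vA by (auto simp: v_def)
    moreover have "\<exists>Tv\<in>K. endv Tv = endv U \<and> clr (hd Tv) \<noteq> clr (hd U)" using aU Q by metis
    ultimately show ?thesis using e1 e2 e3 unfolding base'_def by blast
  qed
  show "\<exists>U\<in>unwinds K d T T'. endv U = v" if v: "v \<in> inner K" "v \<in> M" "v \<in> anc (endv T')"
  proof -
    have vA: "base v = v" "v \<in> reached K" using v inner_self inner_reached by auto
    obtain Q Tv where Q: "T' = Q @ Tv" "Tv \<in> K" "endv Tv = v" "eids Q \<inter> tedges v = {}"
      using K_split[OF T' v(3,1)] by auto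
    have Tvne: "Tv \<noteq> []" using K_trail[OF Q(2)] by (auto simp: dtrail_def)
    have zv: "z \<in> anc v" using Mp v by blast
    then have zv: "anc z \<subseteq> anc v" using anc vA by blast
    \<comment> \<open>A common edge is owned by a common ancestor of \<open>x\<close> and
      \<open>y\<close>. This is an ancestor of \<open>z\<close>, hence of \<open>v\<close>, and by
      \<open>K_split\<close> \<open>Q\<close> avoids all edges owned there.\<close>
    have "eids Q \<inter> eids T = {}"
    proof (rule ccontr)
      assume "eids Q \<inter> eids T \<noteq> {}"
      then obtain e where e: "e \<in> eids Q" "e \<in> eids T" by auto
      have "e \<in> tedges x" "e \<in> tedges y" using e Q TE by auto
      from tedges_disjoint[OF xR yR this] obtain b where "b \<in> anc x" "b \<in> anc y" "e \<in> nedges b" by blast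
      then have "e \<in> tedges v" using z(1) zv by blast
      then show False using Q e by blast
    qed
    moreover have "eid d \<notin> eids Q" using dT' Q by auto
    moreover have "distinct (map eid Q)" using Ttr Q by (auto simp: dtrail_def)
    ultimately have dU: "distinct (map eid (map rv (rev Q) @ d # T))"
      using distd unfolding distinct_unwind by auto
    have "endv (map rv (rev Q) @ d # T) = endv Tv"
      using alt_unwind[OF altd, of Q Tv] Ttr(2) Tvne d Q unfolding usable_def dtrail_def by auto
    then show ?thesis using Q dU v unfolding unwinds_def by blast
  qed
qed

text \<open>Every inner vertex of \<open>M\<close> lies on one of the two paths, so some unwinding
  ends there and makes it full. \<open>N\<close> only has to contain one unwinding per end vertex;
  this freedom lets the program add few trails.\<close>

lemma merge:
  assumes d: "d \<in> D" "usable d T" "usable (rv d) T'" and T: "T \<in> K" "T' \<in> K"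
    and meet: "\<not> distinct (map eid (map rv (rev T') @ d # T))"
    and N: "N \<subseteq> unwinds K d T T' \<union> unwinds K (rv d) T' T" "N \<noteq> {}"
      "\<And>U. U \<in> unwinds K d T T' \<union> unwinds K (rv d) T' T \<Longrightarrow> \<exists>U'\<in>N. endv U' = endv U"
  shows "\<exists>base' pv' en' anc'. forest eid src tgt clr rv D P (K \<union> N) base' pv' en' anc'"
    and "reached (K \<union> N) = reached K" and "inner (K \<union> N) \<subset> inner K"
proof -
  obtain z where z: "z \<in> reached K" "base z = z" "anc (endv T) \<inter> anc (endv T') = anc z"
    using lowest_common_ancestor[OF _ _ link_meets[OF d(1) T d(2,3) meet]] endv_reached T by blast
  define M where "M = anc (endv T) \<union> anc (endv T') - (anc z - {z})"
  have d': "rv d \<in> D" "usable (rv d) T'" "usable (rv (rv d)) T" using d D_rv by (auto simp: usable_def)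
  have z': "anc (endv T') \<inter> anc (endv T) = anc z" using z by auto
  have M': "M = anc (endv T') \<union> anc (endv T) - (anc z - {z})" by (auto simp: M_def)
  note h1 = merge_half[OF d T z(3,1,2) M_def] and h2 = merge_half[OF d' T(2,1) z' z(1,2) M']
  define base' where "base' = (\<lambda>v. if base v \<in> M then z else base v)"
  have sound: "dtrail U \<and> endv U \<in> M \<inter> inner K \<and> (\<exists>Tv\<in>K. endv Tv = endv U \<and> clr (hd Tv) \<noteq> clr (hd U)) \<and>
      eids U \<subseteq> (\<Union>b\<in>anc z. node_edges K base' en b) \<and>
      en ` anc z \<subseteq> eids U \<and>
      (\<forall>a\<in>anc z. a \<in> inner K - M \<longrightarrow> (\<exists>Q Ta. U = Q @ Ta \<and> Ta \<in> K \<and> endv Ta = a \<and> eids Q \<inter> tedges a = {}))"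
    if "U \<in> N" for U
    using h1(1)[of U] h2(1)[of U] that N(1) unfolding base'_def by blast
  show R: "reached (K \<union> N) = reached K"
    using sound inner_reached by (fastforce simp: reached_def)
  have full_new: "full (K \<union> N) v" if v: "v \<in> inner K \<inter> M" for v
  proof -
    have "\<exists>U\<in>unwinds K d T T' \<union> unwinds K (rv d) T' T. endv U = v"
      using h1(2)[of v] h2(2)[of v] v unfolding M_def by blast
    then obtain U where U: "U \<in> N" "endv U = v" using N(3) by metis
    then obtain Tv where "Tv \<in> K" "endv Tv = v" "clr (hd Tv) \<noteq> clr (hd U)" using sound by blast
    then show ?thesis using U unfolding full_def by blast
  qed
  have NM: "endv U \<in> inner K \<inter> M" if "U \<in> N" for U using sound[OF that] by blast
  have full_old: "full (K \<union> N) v \<longleftrightarrow> full K v" if "v \<notin> inner K \<inter> M" for v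
    using that NM unfolding full_def by (metis UnE UnI1)
  have I: "inner (K \<union> N) = inner K - M"
  proof
    show "inner (K \<union> N) \<subseteq> inner K - M"
      using full_new full_old unfolding inner_def R by blast
    show "inner K - M \<subseteq> inner (K \<union> N)"
      using full_old unfolding inner_def R by blast
  qed
  have "\<exists>U. U \<in> N" using N by auto
  then show "inner (K \<union> N) \<subset> inner K" using sound unfolding I by blast
  have "forest eid src tgt clr rv D P (K \<union> N) base' pv en (\<lambda>v. anc v - (M - {z}))"
  proof (rule contract[OF _ _ _ _ _ base'_def refl _ I])
    show "z \<in> M" using h1(3) by blast
    show "\<And>m. m \<in> M \<Longrightarrow> m \<in> reached K \<and> base m = m" "\<And>m. m \<in> M \<Longrightarrow> z \<in> anc m"
      "\<And>m. m \<in> M \<Longrightarrow> anc m \<subseteq> anc z \<union> M" "\<And>m. m \<in> M \<Longrightarrow> m \<noteq> z \<Longrightarrow> m \<notin> tgt ` P \<and> base (pv m) \<in> M"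
      using h1(3) by blast+
    show "K \<subseteq> K \<union> N" by auto
  next
    fix U assume "U \<in> K \<union> N - K"
    then have "U \<in> N" by auto
    from sound[OF this] show "dtrail U" "endv U \<in> M" "eids U \<subseteq> (\<Union>b\<in>anc z. node_edges K base' en b)"
      "en ` anc z \<subseteq> eids U" by blast+
  next
    fix U a assume "U \<in> K \<union> N - K" "a \<in> anc z" "a \<in> inner K - M"
    then show "\<exists>Q Ta. U = Q @ Ta \<and> Ta \<in> K \<and> endv Ta = a \<and> eids Q \<inter> tedges a = {}" using sound[of U] by blast
  qed
  then show "\<exists>base' pv' en' anc'. forest eid src tgt clr rv D P (K \<union> N) base' pv' en' anc'" by blast
qed

text \<open>Otherwise the edge \<open>en b\<close> joins two blossoms, and contracting it gives a forest with fewer nodes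
  for the same trails.\<close>

lemma inner_parent:
  assumes min: "\<And>base' pv' en' anc'. forest eid src tgt clr rv D P K base' pv' en' anc' \<Longrightarrow>
      card {b \<in> reached K. base b = b} \<le> card {b \<in> reached K. base' b = b}"
    and b: "b \<in> reached K" "base b = b" "b \<notin> inner K" "b \<notin> tgt ` P"
  shows "pv b \<in> inner K"
proof (rule ccontr)
  assume np: "pv b \<notin> inner K"
  from parent[OF b(1,2,4)] have p: "pv b \<in> reached K" "anc b = insert b (anc (pv b))" "b \<notin> anc (pv b)"
    by auto
  define z where "z = base (pv b)"
  have z: "z \<in> reached K" "base z = z" "anc z = anc (pv b)" "z \<in> anc (pv b)"
    using base[OF p(1)] by (auto simp: z_def)
  have "b \<noteq> z" using p z by metis
  define base' where "base' = (\<lambda>v. if base v \<in> {z, b} then z else base v)"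
  have "z \<notin> inner K" using inner_base[OF p(1)] np by (auto simp: z_def)
  then have I: "inner K = inner K - {z, b}" using b by auto
  \<comment> \<open>The conditions on new trails are vacuous, and since \<open>z\<close> and
    \<open>b\<close> are both outer, no inner vertex is lost.\<close>
  have "forest eid src tgt clr rv D P K base' pv en (\<lambda>v. anc v - ({z, b} - {z}))"
    by (rule contract[OF _ _ _ _ _ base'_def refl subset_refl I]) (use z p b in \<open>auto simp: z_def\<close>)
  from min[OF this] have le: "card {b \<in> reached K. base b = b} \<le> card {b \<in> reached K. base' b = b}" .
  have "base' b \<noteq> b" using b \<open>b \<noteq> z\<close> by (simp add: base'_def)
  moreover have "base c = c" if "base' c = c" for c
    using that z by (auto simp: base'_def split: if_splits)
  ultimately have "{b \<in> reached K. base' b = b} \<subset> {b \<in> reached K. base b = b}" using b by auto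
  then have "card {b \<in> reached K. base' b = b} < card {b \<in> reached K. base b = b}"
    using finite_reached by (intro psubset_card_mono) auto
  then show False using le by simp
qed

section \<open>Edges in a stable forest\<close>

context
  assumes stab: "stable K"
    and blob_parent: "\<And>b. b \<in> reached K \<Longrightarrow> base b = b \<Longrightarrow> b \<notin> inner K \<Longrightarrow> b \<notin> tgt ` P \<Longrightarrow> pv b \<in> inner K"
begin

text \<open>Stability leaves no inner vertex in \<open>M\<close>. If the base of one end were not an
  ancestor of the other end, it would be a non-root node of \<open>M\<close> strictly below
  \<open>z\<close>. Its parent would then be inner and lie between it and \<open>z\<close>, hence
  again in \<open>M\<close>. So each base is an ancestor of the other end, and the two
  coincide.\<close>

lemma link_base:
  assumes d: "d \<in> D" "usable d T" "usable (rv d) T'" and T: "T \<in> K" "T' \<in> K"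
  shows "base (src d) = base (tgt d) \<and> src d \<notin> inner K \<and> tgt d \<notin> inner K"
proof -
  define x where "x = endv T"
  define y where "y = endv T'"
  have dx: "src d = x" "tgt d = y" using d by (auto simp: usable_def x_def y_def)
  have xR: "x \<in> reached K" and yR: "y \<in> reached K" using T endv_reached by (auto simp: x_def y_def)
  have d': "rv d \<in> D" "usable (rv d) T'" "usable (rv (rv d)) T" using d D_rv by (auto simp: usable_def)
  have meet: "\<not> distinct (map eid (map rv (rev T') @ d # T))"
    using stab d T unfolding stable_def by blast
  obtain z where z: "z \<in> reached K" "base z = z" "anc (endv T) \<inter> anc (endv T') = anc z"
    using lowest_common_ancestor[OF _ _ link_meets[OF d(1) T d(2,3) meet]] endv_reached T by blast
  define M where "M = anc (endv T) \<union> anc (endv T') - (anc z - {z})"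
  have z': "anc (endv T') \<inter> anc (endv T) = anc z" using z by auto
  have M': "M = anc (endv T') \<union> anc (endv T) - (anc z - {z})" by (auto simp: M_def)
  note h1 = merge_half[OF d T z(3,1,2) M_def] and h2 = merge_half[OF d' T(2,1) z' z(1,2) M']
  have "unwinds K d T T' = {}" using stab d T unfolding stable_def by blast
  moreover have "unwinds K (rv d) T' T = {}" using stab d' T unfolding stable_def by blast
  ultimately have MI: "v \<notin> inner K" if "v \<in> M" for v
    using h1(2)[of v] h2(2)[of v] that unfolding M_def by blast
  have zz: "z \<in> anc z" using base[OF z(1)] z(2) by auto
  have key: "base v \<in> anc w" if vw: "{v, w} = {x, y}" for v w
  proof (rule ccontr)
    assume n: "base v \<notin> anc w"
    have vwR: "v \<in> reached K" "w \<in> reached K" "anc v \<inter> anc w = anc z" "M = anc v \<union> anc w - (anc z - {z})"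
      using vw xR yR z(3) M_def unfolding x_def y_def by (auto simp: doubleton_eq_iff)
    have bv: "base v \<in> reached K" "base (base v) = base v" "anc (base v) = anc v" "base v \<in> anc v"
      using base[OF vwR(1)] by auto
    have bM: "base v \<in> M" using n vwR bv by auto
    have bS: "base v \<notin> tgt ` P"
    proof
      assume "base v \<in> tgt ` P"
      then have "anc v = {base v}" using root bv by auto
      then show False using n vwR zz by auto
    qed
    from parent[OF bv(1,2) bS] have p: "pv (base v) \<in> reached K" "anc v = insert (base v) (anc (pv (base v)))"
      "base v \<notin> anc (pv (base v))" using bv by auto
    have pI: "pv (base v) \<in> inner K" using blob_parent[OF bv(1,2) MI[OF bM] bS] .
    then have pb: "base (pv (base v)) = pv (base v)" "pv (base v) \<in> anc (pv (base v))"
      using inner_self base[OF p(1)] by auto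
    have "pv (base v) \<notin> M" using MI pI by blast
    then have pz: "pv (base v) \<in> anc z" "pv (base v) \<noteq> z" using vwR p pb by auto
    have "z \<noteq> base v" using n zz vwR by auto
    then have "z \<in> anc (pv (base v))" using zz vwR p by auto
    then show False using anc_antisym[of z "pv (base v)"] pz pb z p by metis
  qed
  have b: "base x \<in> anc y" "base y \<in> anc x" using key[of x y] key[of y x] by auto
  have beq: "base x = base y"
    using anc_antisym[of "base x" "base y"] b base[OF xR] base[OF yR] by metis
  have "x \<noteq> y" using D_neq d dx by auto
  then show ?thesis using beq inner_self inner_base xR yR dx by metis
qed

text \<open>The owner of the edge is an ancestor of the end of \<open>T\<close>. If the edge enters
  its owner, the end of \<open>T\<close> cannot be the parent vertex and so is the base. That base
  is not inner, because an inner vertex is reached along its entering edge, here of the colour of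
  \<open>d\<close>.\<close>

lemma used_dart:
  assumes d: "d \<in> D" and T: "T \<in> K" "src d = endv T" "clr d \<noteq> clr (hd T)" "eid d \<in> eids T"
  shows "tgt d \<in> reached K \<and> (base (src d) = base (tgt d) \<or>
    base (src d) = src d \<and> src d \<notin> inner K \<and> src d \<notin> tgt ` P \<and> eid d = en (src d) \<and> tgt d = pv (src d))"
proof -
  have xR: "src d \<in> reached K" using T endv_reached by auto
  obtain b where b: "b \<in> anc (src d)" "eid d \<in> nedges b" using K_edges[OF T(1)] T by auto
  have bR: "b \<in> reached K" "base b = b" using anc[OF xR b(1)] by auto
  show ?thesis
  proof (cases "eid d = en b")
    case True
    have bS: "b \<notin> tgt ` P" using True root P_D d by force
    from parent[OF bR bS] obtain e where e: "e \<in> D" "eid e = en b" "src e = pv b" "tgt e = b"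
      and p: "pv b \<in> reached K" "b \<notin> anc (pv b)" by auto
    have "src d \<noteq> pv b" using b p by auto
    then have s: "src d = b" "tgt d = pv b" using D_inj[OF d e(1)] e True by auto
    have "b \<notin> inner K"
    proof
      assume "b \<in> inner K"
      then have h: "eid (hd T) = eid d" using inner_last[OF T(1)] T(2) s True by auto
      have "alt T" using K_trail T by (auto simp: dtrail_def)
      then have "hd T \<in> D \<union> P" using alt_ends[of T "hd T"] alt_nonempty[of T] by auto
      then have "hd T \<in> D" using h P_D[of "hd T" d] d by auto
      then show False using D_inj[OF _ d] h T by metis
    qed
    then show ?thesis using s bR bS True p by auto
  next
    case False
    then obtain e where e: "e \<in> D" "eid e = eid d" "src e \<in> reached K" "tgt e \<in> reached K"
      "base (src e) = b" "base (tgt e) = b" using b by (auto simp: node_edges_def)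
    from D_inj[OF e(1) d e(2)] show ?thesis using e by auto
  qed
qed

text \<open>If the colours fit at both ends, the dart is either usable in both directions, which is
  the case of \<open>link_base\<close>, or contained in one of the two trails, which is the case of
  \<open>used_dart\<close>.\<close>

lemma dart_cases:
  assumes d: "d \<in> D" and T: "T \<in> K" "src d = endv T" "clr d \<noteq> clr (hd T)"
    and T': "T' \<in> K" "tgt d = endv T'" "clr d \<noteq> clr (hd T')"
  shows "base (src d) = base (tgt d) \<and> src d \<notin> inner K \<and> tgt d \<notin> inner K \<or>
    base (src d) = src d \<and> src d \<notin> inner K \<and> src d \<notin> tgt ` P \<and> eid d = en (src d) \<and> tgt d \<in> inner K \<or>
    base (tgt d) = tgt d \<and> tgt d \<notin> inner K \<and> tgt d \<notin> tgt ` P \<and> eid d = en (tgt d) \<and> src d \<in> inner K"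
proof -
  have R: "src d \<in> reached K" "tgt d \<in> reached K" using T T' endv_reached by auto
  have same: "src d \<notin> inner K \<and> tgt d \<notin> inner K" if "base (src d) = base (tgt d)"
    using that inner_self inner_base R D_neq[OF d] by metis
  show ?thesis
  proof (cases "usable d T \<and> usable (rv d) T'")
    case True
    then show ?thesis using link_base[OF d _ _ T(1) T'(1)] by blast
  next
    case False
    then consider "eid d \<in> eids T" | "eid (rv d) \<in> eids T'" using T T' by (auto simp: usable_def)
    then show ?thesis
    proof cases
      case 1
      from used_dart[OF d T 1] show ?thesis using same blob_parent R by metis
    next
      case 2
      have "rv d \<in> D" "src (rv d) = endv T'" "clr (rv d) \<noteq> clr (hd T')" using d T' D_rv by auto
      from used_dart[OF this(1) T'(1) this(2,3) 2] show ?thesis using same blob_parent R by (metis rv)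
    qed
  qed
qed

lemma dart_reaches:
  assumes "d \<in> D" "T \<in> K" "src d = endv T" "clr d \<noteq> clr (hd T)"
  shows "tgt d \<in> reached K"
  using used_dart[OF assms] stab assms unfolding stable_def usable_def by blast

lemma outer_trail:
  assumes "v \<in> reached K" "v \<notin> inner K"
  obtains T where "T \<in> K" "endv T = v" "c \<noteq> clr (hd T)"
proof -
  have "full K v" using assms by (auto simp: inner_def)
  then obtain T T' where "T \<in> K" "T' \<in> K" "endv T = v" "endv T' = v" "clr (hd T) \<noteq> clr (hd T')"
    unfolding full_def by blast
  then show thesis using that[of T] that[of T'] by (cases "c = clr (hd T)") auto
qed

text \<open>The Tutte conditions edge by edge. Neighbouring outer vertices share a blossom. An edge
  mismatched at an inner vertex either enters a non-root blossom or has the colour of its inner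
  other end.\<close>

lemma certificate_aux:
  "\<forall>d\<in>D.
    (src d \<notin> inner K \<longrightarrow> tgt d \<notin> inner K \<longrightarrow> src d \<in> reached K \<longrightarrow> tgt d \<in> reached K \<and> base (src d) = base (tgt d)) \<and>
    ((\<exists>T\<in>K. endv T = src d \<and> clr (hd T) \<noteq> clr d) \<longrightarrow> src d \<in> inner K \<longrightarrow>
      (tgt d \<notin> inner K \<longrightarrow> tgt d \<in> reached K \<and> base (tgt d) \<notin> tgt ` P \<and> eid d = en (base (tgt d))) \<and>
      (tgt d \<in> inner K \<longrightarrow> (\<forall>T\<in>K. endv T = tgt d \<longrightarrow> clr (hd T) = clr d)))"
proof (intro ballI conjI impI)
  fix d assume d: "d \<in> D" and o: "src d \<notin> inner K" "tgt d \<notin> inner K" and x: "src d \<in> reached K"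
  obtain T where T: "T \<in> K" "endv T = src d" "clr d \<noteq> clr (hd T)" using outer_trail[OF x o(1)] .
  show y: "tgt d \<in> reached K" using dart_reaches d T by metis
  obtain T' where T': "T' \<in> K" "endv T' = tgt d" "clr d \<noteq> clr (hd T')" using outer_trail[OF y o(2)] .
  show "base (src d) = base (tgt d)" using dart_cases[OF d T(1) _ T(3) T'(1)] T T' o by metis
next
  fix d assume d: "d \<in> D" and "\<exists>T\<in>K. endv T = src d \<and> clr (hd T) \<noteq> clr d" and x: "src d \<in> inner K"
    and o: "tgt d \<notin> inner K"
  then obtain T where T: "T \<in> K" "endv T = src d" "clr d \<noteq> clr (hd T)" by auto
  show y: "tgt d \<in> reached K" using dart_reaches d T by metis
  obtain T' where T': "T' \<in> K" "endv T' = tgt d" "clr d \<noteq> clr (hd T')" using outer_trail[OF y o] .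
  have "base (tgt d) = tgt d \<and> tgt d \<notin> tgt ` P \<and> eid d = en (tgt d)"
    using dart_cases[OF d T(1) _ T(3) T'(1)] T T' x by metis
  then show "base (tgt d) \<notin> tgt ` P" "eid d = en (base (tgt d))" by auto
next
  fix d T' assume d: "d \<in> D" and "\<exists>T\<in>K. endv T = src d \<and> clr (hd T) \<noteq> clr d" and x: "src d \<in> inner K"
    and y: "tgt d \<in> inner K" and T': "T' \<in> K" "endv T' = tgt d"
  then obtain T where T: "T \<in> K" "endv T = src d" "clr d \<noteq> clr (hd T)" by auto
  show "clr (hd T') = clr d"
    using dart_cases[OF d T(1) _ T(3) T'(1)] T T' x y by metis
qed

end

text \<open>A loop has a twin of another colour at the same terminal, contrary to
  \<open>inner_unique\<close>.\<close>

lemma inner_last_dart: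
  assumes "T \<in> K" "endv T \<in> inner K"
  shows "hd T \<in> D"
proof -
  have "alt T" using K_trail assms by (auto simp: dtrail_def)
  then have "hd T \<in> D \<union> P" using alt_ends[of T "hd T"] alt_nonempty[of T] by auto
  moreover have "hd T \<notin> P"
  proof
    assume p: "hd T \<in> P"
    obtain p' where p': "p' \<in> P" "tgt p' = endv T" "clr p' \<noteq> clr (hd T)" using P_two[OF p] by auto
    have "[p'] = [hd T]" using inner_unique[OF K_init[OF p'(1)] K_init[OF p]] p' assms by auto
    then show False using p' by auto
  qed
  ultimately show ?thesis by auto
qed

lemma root_outer:
  assumes p: "p \<in> P"
  shows "tgt p \<in> reached K \<and> tgt p \<notin> inner K"
proof -
  obtain p' where p': "p' \<in> P" "tgt p' = tgt p" "clr p' \<noteq> clr p" using P_two[OF p] by auto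
  have "full K (tgt p)"
    unfolding full_def using K_init[OF p] K_init[OF p'(1)] p' by (intro bexI[of _ "[p]"] bexI[of _ "[p']"]) auto
  moreover have "tgt p \<in> reached K" using K_init[OF p] unfolding reached_def by force
  ultimately show ?thesis by (simp add: inner_def)
qed

end

section \<open>Existence of a certificate, and the initial forest\<close>

context dart_graph
begin

text \<open>\<open>cls\<close> labels the outer vertices so that adjacent ones have equal labels; \<open>ent\<close> gives the only
  edge that can be mismatched at the vertices with a given label.\<close>

definition certificate :: "'d list set \<Rightarrow> ('v \<Rightarrow> 'v) \<Rightarrow> ('v \<Rightarrow> 'e) \<Rightarrow> bool" where
  "certificate K cls ent \<longleftrightarrow>
    (\<forall>T\<in>K. endv T \<in> inner K \<longrightarrow> hd T \<in> D) \<and>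
    (\<forall>p\<in>P. tgt p \<in> reached K \<and> tgt p \<notin> inner K \<and> cls (tgt p) = tgt p) \<and>
    (\<forall>d\<in>D.
    (src d \<notin> inner K \<longrightarrow> tgt d \<notin> inner K \<longrightarrow> src d \<in> reached K \<longrightarrow> tgt d \<in> reached K \<and> cls (src d) = cls (tgt d)) \<and>
    ((\<exists>T\<in>K. endv T = src d \<and> clr (hd T) \<noteq> clr d) \<longrightarrow> src d \<in> inner K \<longrightarrow>
      (tgt d \<notin> inner K \<longrightarrow> tgt d \<in> reached K \<and> cls (tgt d) \<notin> tgt ` P \<and> eid d = ent (cls (tgt d))) \<and>
      (tgt d \<in> inner K \<longrightarrow> (\<forall>T\<in>K. endv T = tgt d \<longrightarrow> clr (hd T) = clr d))))"

text \<open>Among all forests for \<open>K\<close> one with the fewest nodes is chosen, so that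
  \<open>inner_parent\<close> applies to it.\<close>

lemma stable_certificate:
  assumes F: "forest eid src tgt clr rv D P K base0 pv0 en0 anc0" and stab: "stable K"
  shows "\<exists>cls ent. certificate K cls ent"
proof -
  define ok where "ok = (\<lambda>b. \<exists>pv en anc. forest eid src tgt clr rv D P K b pv en anc)"
  define m where "m = (\<lambda>base. card {b \<in> reached K. base b = b})"
  have "ok base0" using F by (auto simp: ok_def)
  then obtain base where b: "ok base" "\<And>b'. ok b' \<Longrightarrow> m base \<le> m b'"
    using ex_has_least_nat[of ok base0 m] by blast
  then obtain pv en anc where F': "forest eid src tgt clr rv D P K base pv en anc" by (auto simp: ok_def)
  interpret forest eid src tgt clr rv D P K base pv en anc by (fact F')
  have bp: "pv b \<in> inner K" if "b \<in> reached K" "base b = b" "b \<notin> inner K" "b \<notin> tgt ` P" for b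
    by (rule inner_parent[OF _ that]) (use b(2) in \<open>unfold ok_def m_def, blast\<close>)
  have "certificate K base en"
    unfolding certificate_def using certificate_aux[OF stab bp] inner_last_dart root_outer root by blast
  then show ?thesis by blast
qed

lemma initial_forest:
  "\<exists>base pv en anc. forest eid src tgt clr rv D P ((\<lambda>p. [p]) ` P) base pv en anc"
  "inner ((\<lambda>p. [p]) ` P) = {}"
proof -
  let ?K = "(\<lambda>p. [p]) ` P"
  \<comment> \<open>The choice is harmless, since by \<open>P_inj\<close> loops at the same terminal
    share their edge name.\<close>
  define en where "en = (\<lambda>s. eid (SOME p. p \<in> P \<and> tgt p = s))"
  have R: "reached ?K = tgt ` P" by (auto simp: reached_def image_image)
  have en: "en (tgt p) = eid p" if "p \<in> P" for p
    using someI[of "\<lambda>q. q \<in> P \<and> tgt q = tgt p" p] that P_inj unfolding en_def by blast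
  show I: "inner ?K = {}" using P_two unfolding inner_def R full_def by fastforce
  have "forest eid src tgt clr rv D P ?K id id en (\<lambda>v. {v})"
    by unfold_locales (use en in \<open>auto simp: I R dtrail_def node_edges_def\<close>)
  then show "\<exists>base pv en anc. forest eid src tgt clr rv D P ?K base pv en anc" by blast
qed

end

section \<open>Polynomial-time functions on trees\<close>

lemma poly_nat_mono: "a \<le> b \<Longrightarrow> poly (q :: nat poly) a \<le> poly q b"
  by (induction q) (auto intro!: add_mono mult_mono)

text \<open>Variables \<open>n, n + 1, \<dots>\<close> are preserved, and no other variable than \<open>0\<close> is assumed to be
  initialised: so programs are composed by keeping intermediate results in larger variables.\<close>

definition runs :: "com \<Rightarrow> nat \<Rightarrow> nat poly \<Rightarrow> tree set \<Rightarrow> (tree \<Rightarrow> tree) \<Rightarrow> bool" where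
  "runs c n q D f \<longleftrightarrow> (\<forall>s. s 0 \<in> D \<longrightarrow>
     size (f (s 0)) \<le> poly q (size (s 0)) \<and>
     (\<exists>t s'. exec c s t s' \<and> s' 0 = f (s 0) \<and> (\<forall>i\<ge>n. i \<noteq> 0 \<longrightarrow> s' i = s i) \<and> t \<le> poly q (size (s 0))))"

definition ptime :: "tree set \<Rightarrow> (tree \<Rightarrow> tree) \<Rightarrow> bool" where
  "ptime D f \<longleftrightarrow> (\<exists>c n q. runs c n q D f)"

lemma runsE:
  assumes "runs c n q D f" "s 0 \<in> D"
  obtains t s' where "exec c s t s'" "s' 0 = f (s 0)" "\<And>i. i \<ge> n \<Longrightarrow> i \<noteq> 0 \<Longrightarrow> s' i = s i"
    "t \<le> poly q (size (s 0))" "size (f (s 0)) \<le> poly q (size (s 0))"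
  using assms unfolding runs_def by blast

lemma ptime_expr:
  assumes "\<And>s. val a s = f (s 0)" "\<And>s. Suc (cost a s) \<le> poly q (size (s 0))"
    "\<And>x. size (f x) \<le> poly q (size x)"
  shows "ptime D f"
  unfolding ptime_def runs_def
proof (rule exI[of _ "Assign 0 a"], rule exI[of _ 1], rule exI[of _ q], intro allI impI conjI)
  fix s :: store
  show "size (f (s 0)) \<le> poly q (size (s 0))" by (rule assms)
  show "\<exists>t s'. exec (Assign 0 a) s t s' \<and> s' 0 = f (s 0) \<and> (\<forall>i\<ge>1. i \<noteq> 0 \<longrightarrow> s' i = s i) \<and> t \<le> poly q (size (s 0))"
    using assms(1,2)[of s] exec_Assign[of 0 a s]
    by (intro exI[of _ "Suc (cost a s)"] exI[of _ "s(0 := val a s)"]) auto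
qed

lemma ptime_id: "ptime D (\<lambda>x. x)"
  by (rule ptime_expr[of "Var 0" _ "[:2, 1:]"]) (auto simp: node_cost_def)

lemma ptime_comp:
  assumes g: "ptime D g" and f: "ptime D' f" and D: "\<And>x. x \<in> D \<Longrightarrow> g x \<in> D'"
  shows "ptime D (\<lambda>x. f (g x))"
proof -
  obtain c n q where c: "runs c n q D g" using g by (auto simp: ptime_def)
  obtain d m r where d: "runs d m r D' f" using f by (auto simp: ptime_def)
  show ?thesis
    unfolding ptime_def runs_def
  proof (rule exI[of _ "Seq c d"], rule exI[of _ "max n m"], rule exI[of _ "1 + q + pcompose r q"], intro allI impI)
    fix s :: store assume s: "s 0 \<in> D"
    obtain t s' where 1: "exec c s t s'" "s' 0 = g (s 0)" "\<And>i. i \<ge> n \<Longrightarrow> i \<noteq> 0 \<Longrightarrow> s' i = s i"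
      "t \<le> poly q (size (s 0))" "size (g (s 0)) \<le> poly q (size (s 0))"
      using runsE[of c n q D g s] c s by metis
    have s'D: "s' 0 \<in> D'" using 1 D s by auto
    obtain u s'' where 2: "exec d s' u s''" "s'' 0 = f (s' 0)" "\<And>i. i \<ge> m \<Longrightarrow> i \<noteq> 0 \<Longrightarrow> s'' i = s' i"
      "u \<le> poly r (size (s' 0))" "size (f (s' 0)) \<le> poly r (size (s' 0))"
      using runsE[of d m r D' f s'] d s'D by metis
    have r: "poly r (size (s' 0)) \<le> poly (pcompose r q) (size (s 0))"
      using 1 by (auto simp: poly_pcompose intro!: poly_nat_mono)
    have "exec (Seq c d) s (Suc (t + u)) s''" using 1 2 by (auto intro: exec_Seq)
    moreover have "\<forall>i\<ge>max n m. i \<noteq> 0 \<longrightarrow> s'' i = s i" using 1(3) 2(3) by auto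
    moreover have "Suc (t + u) \<le> poly (1 + q + pcompose r q) (size (s 0))"
      using 1(4) 2(4) r by simp
    moreover have "size (f (g (s 0))) \<le> poly (1 + q + pcompose r q) (size (s 0))"
      using 2(5) r 1(2) by simp
    ultimately show "size (f (g (s 0))) \<le> poly (1 + q + pcompose r q) (size (s 0)) \<and>
      (\<exists>t s'. exec (Seq c d) s t s' \<and> s' 0 = f (g (s 0)) \<and> (\<forall>i\<ge>max n m. i \<noteq> 0 \<longrightarrow> s' i = s i) \<and>
         t \<le> poly (1 + q + pcompose r q) (size (s 0)))"
      using 1(2) 2(2) by metis
  qed
qed

lemmas ptime_comp_UNIV = ptime_comp[where D' = UNIV, OF _ _ UNIV_I]

lemma size_hd: "size (tree_hd x) \<le> size x" by (cases x) auto
lemma size_tl: "size (tree_tl x) \<le> size x" by (cases x) auto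

lemma ptime_const: "ptime D (\<lambda>_. k)"
proof -
  \<comment> \<open>The constant \<open>k\<close> is spelled out by an expression with
    \<open>2 * size k + 1\<close> nodes, each of which costs at most
    \<open>size k + 1\<close>.\<close>
  have "\<exists>a. \<forall>s. val a s = k \<and> cost a s \<le> (2 * size k + 1) * (2 * size k + 1)"
  proof (induction k)
    case Atom
    then show ?case by (rule exI[of _ Nil]) (auto simp: node_cost_def)
  next
    case (Pair k1 k2)
    then obtain a b where ab: "\<And>s. val a s = k1 \<and> cost a s \<le> (2 * size k1 + 1) * (2 * size k1 + 1)"
      "\<And>s. val b s = k2 \<and> cost b s \<le> (2 * size k2 + 1) * (2 * size k2 + 1)" by auto
    show ?case
    proof (rule exI[of _ "Cons a b"], intro allI conjI)
      fix s
      show "val (Cons a b) s = Pair k1 k2" using ab by simp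
      have "cost (Cons a b) s \<le> (2 * size k1 + 1) * (2 * size k1 + 1) + (2 * size k2 + 1) * (2 * size k2 + 1) + (size k1 + size k2 + 2)"
        using ab[of s] by (simp add: node_cost_def)
      also have "\<dots> \<le> (2 * size (Pair k1 k2) + 1) * (2 * size (Pair k1 k2) + 1)"
        by (simp add: algebra_simps)
      finally show "cost (Cons a b) s \<le> (2 * size (Pair k1 k2) + 1) * (2 * size (Pair k1 k2) + 1)" .
    qed
  qed
  then obtain a Z where a: "\<And>s. val a s = k \<and> cost a s \<le> Z" by blast
  show ?thesis
    by (rule ptime_expr[of a _ "[:1 + size k + Z:]"]) (use a in \<open>auto intro: trans_le_add2\<close>)
qed

lemma ptime_hd: "ptime D f \<Longrightarrow> ptime D (\<lambda>x. tree_hd (f x))"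
  by (rule ptime_comp_UNIV, assumption, rule ptime_expr[of "Hd (Var 0)" _ "[:3, 2:]"])
    (auto simp: node_cost_def intro: order_trans[OF size_hd] le_SucI add_mono size_hd)

lemma ptime_tl: "ptime D f \<Longrightarrow> ptime D (\<lambda>x. tree_tl (f x))"
  by (rule ptime_comp_UNIV, assumption, rule ptime_expr[of "Tl (Var 0)" _ "[:3, 2:]"])
    (auto simp: node_cost_def intro: order_trans[OF size_tl] le_SucI add_mono size_tl)

lemma ptime_Pair:
  assumes f: "ptime D f" and g: "ptime D g"
  shows "ptime D (\<lambda>x. Pair (f x) (g x))"
proof -
  obtain c n q where c: "runs c n q D f" using f by (auto simp: ptime_def)
  obtain d m r where d: "runs d m r D g" using g by (auto simp: ptime_def)
  \<comment> \<open>Variables from \<open>k\<close> on save the input and the first result. The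
    \<open>Suc\<close> keeps \<open>k\<close> away from variable \<open>0\<close>, which is never
    preserved.\<close>
  define k where "k = Suc (max n m)"
  define p where "p = Seq (Assign k (Var 0)) (Seq c (Seq (Assign (Suc k) (Var 0)) (Seq (Assign 0 (Var k))
    (Seq d (Assign 0 (Cons (Var (Suc k)) (Var 0)))))))"
  define b where "b = [:20, 2:] + 4 * q + 4 * r"
  show ?thesis
    unfolding ptime_def runs_def
  proof (rule exI[of _ p], rule exI[of _ "k + 2"], rule exI[of _ b], intro allI impI)
    fix s :: store assume s: "s 0 \<in> D"
    define s1 where "s1 = s(k := s 0)"
    have s1: "s1 0 = s 0" by (simp add: s1_def k_def)
    obtain t2 s2 where 2: "exec c s1 t2 s2" "s2 0 = f (s 0)" "\<And>i. i \<ge> n \<Longrightarrow> i \<noteq> 0 \<Longrightarrow> s2 i = s1 i"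
      "t2 \<le> poly q (size (s 0))" "size (f (s 0)) \<le> poly q (size (s 0))"
      using runsE[of c n q D f s1] c s s1 by metis
    define s3 where "s3 = s2(Suc k := s2 0)"
    define s4 where "s4 = s3(0 := s3 k)"
    have k: "s2 k = s 0" using 2(3)[of k] by (simp add: s1_def k_def)
    then have s3k: "s3 k = s 0" by (simp add: s3_def)
    then have s4: "s4 0 = s 0" by (simp add: s4_def)
    obtain t5 s5 where 5: "exec d s4 t5 s5" "s5 0 = g (s 0)" "\<And>i. i \<ge> m \<Longrightarrow> i \<noteq> 0 \<Longrightarrow> s5 i = s4 i"
      "t5 \<le> poly r (size (s 0))" "size (g (s 0)) \<le> poly r (size (s 0))"
      using runsE[of d m r D g s4] d s s4 by metis
    have s5k: "s5 (Suc k) = f (s 0)" using 5(3)[of "Suc k"] 2(2) by (simp add: s4_def s3_def k_def)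
    define s6 where "s6 = s5(0 := Pair (f (s 0)) (g (s 0)))"
    have e1: "exec (Assign k (Var 0)) s (Suc (Suc (size (s 0)))) s1"
      using exec_Assign[of k "Var 0" s] by (simp add: node_cost_def s1_def)
    have e3: "exec (Assign (Suc k) (Var 0)) s2 (Suc (Suc (size (f (s 0))))) s3"
      using exec_Assign[of "Suc k" "Var 0" s2] 2 by (simp add: node_cost_def s3_def)
    have e4: "exec (Assign 0 (Var k)) s3 (Suc (Suc (size (s 0)))) s4"
      using exec_Assign[of 0 "Var k" s3] s3k by (simp add: node_cost_def s4_def)
    have e6: "exec (Assign 0 (Cons (Var (Suc k)) (Var 0))) s5 (2 * size (f (s 0)) + 2 * size (g (s 0)) + 5) s6"
    proof -
      have "Suc (cost (Cons (Var (Suc k)) (Var 0)) s5) = 2 * size (f (s 0)) + 2 * size (g (s 0)) + 5"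
        using 5(2) s5k by (simp add: node_cost_def)
      moreover have "s5(0 := val (Cons (Var (Suc k)) (Var 0)) s5) = s6" using 5(2) s5k by (simp add: s6_def)
      ultimately show ?thesis using exec_Assign[of 0 "Cons (Var (Suc k)) (Var 0)" s5] by metis
    qed
    have "\<exists>t. exec p s t s6 \<and> t \<le> poly b (size (s 0))"
      unfolding p_def
      by (rule exI, rule conjI, rule exec_Seq[OF e1 exec_Seq[OF 2(1) exec_Seq[OF e3 exec_Seq[OF e4 exec_Seq[OF 5(1) e6]]]]])
        (use 2(4,5) 5(4,5) in \<open>simp add: b_def algebra_simps\<close>)
    moreover have "s6 0 = Pair (f (s 0)) (g (s 0))" by (simp add: s6_def)
    moreover have "\<forall>i\<ge>k + 2. i \<noteq> 0 \<longrightarrow> s6 i = s i"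
      using 5(3) 2(3) by (auto simp: s6_def s4_def s3_def s1_def k_def)
    moreover have "size (Pair (f (s 0)) (g (s 0))) \<le> poly b (size (s 0))"
      using 2 5 by (simp add: b_def algebra_simps)
    ultimately show "size (Pair (f (s 0)) (g (s 0))) \<le> poly b (size (s 0)) \<and>
      (\<exists>t s'. exec p s t s' \<and> s' 0 = Pair (f (s 0)) (g (s 0)) \<and> (\<forall>i\<ge>k + 2. i \<noteq> 0 \<longrightarrow> s' i = s i) \<and> t \<le> poly b (size (s 0)))"
      by blast
  qed
qed

section \<open>Decisions and branching\<close>

abbreviation tt :: tree where "tt \<equiv> Pair Atom Atom"

definition tbool :: "bool \<Rightarrow> tree" where "tbool P = (if P then tt else Atom)"

lemma tbool_simps [simp]: "tbool True = tt" "tbool False = Atom" "tbool P = Atom \<longleftrightarrow> \<not> P"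
  by (auto simp: tbool_def)

abbreviation pdec :: "tree set \<Rightarrow> (tree \<Rightarrow> bool) \<Rightarrow> bool" where
  "pdec D P \<equiv> ptime D (\<lambda>x. tbool (P x))"

lemma pdec_eq:
  assumes "ptime D f" "ptime D g"
  shows "pdec D (\<lambda>x. f x = g x)"
proof -
  have "ptime UNIV (\<lambda>z. tbool (tree_hd z = tree_tl z))"
  proof (rule ptime_expr[of "Equal (Hd (Var 0)) (Tl (Var 0))" _ "[:10, 4:]"])
    fix s :: store
    show "Suc (cost (Equal (Hd (Var 0)) (Tl (Var 0))) s) \<le> poly [:10, 4:] (size (s 0))"
      using size_hd[of "s 0"] size_tl[of "s 0"] by (auto simp: node_cost_def)
  qed (auto simp: tbool_def)
  from ptime_comp_UNIV[OF ptime_Pair[OF assms] this] show ?thesis by simp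
qed

lemma ptime_If:
  assumes p: "pdec D P" and f: "ptime D f" and g: "ptime D g"
  shows "ptime D (\<lambda>x. if P x then f x else g x)"
proof -
  obtain e l o' where e: "runs e l o' D (\<lambda>x. tbool (P x))" using p by (auto simp: ptime_def)
  obtain c n q where c: "runs c n q D f" using f by (auto simp: ptime_def)
  obtain d m r where d: "runs d m r D g" using g by (auto simp: ptime_def)
  define k where "k = Suc (max l (max n m))"
  define p where "p = Seq (Assign k (Var 0)) (Seq e (Seq (Assign (Suc k) (Var 0)) (Seq (Assign 0 (Var k))
    (If (Var (Suc k)) c d))))"
  define b where "b = [:30, 2:] + o' + q + r"
  show ?thesis
    unfolding ptime_def runs_def
  proof (rule exI[of _ p], rule exI[of _ "k + 2"], rule exI[of _ b], intro allI impI)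
    fix s :: store assume s: "s 0 \<in> D"
    define s1 where "s1 = s(k := s 0)"
    have s1: "s1 0 = s 0" by (simp add: s1_def k_def)
    obtain t2 s2 where 2: "exec e s1 t2 s2" "s2 0 = tbool (P (s 0))" "\<And>i. i \<ge> l \<Longrightarrow> i \<noteq> 0 \<Longrightarrow> s2 i = s1 i"
      "t2 \<le> poly o' (size (s 0))"
      using runsE[of e l o' D "\<lambda>x. tbool (P x)" s1] e s s1 by metis
    define s3 where "s3 = s2(Suc k := s2 0)"
    define s4 where "s4 = s3(0 := s3 k)"
    have k: "s2 k = s 0" using 2(3)[of k] by (simp add: s1_def k_def)
    then have s3k: "s3 k = s 0" by (simp add: s3_def)
    then have s4: "s4 0 = s 0" by (simp add: s4_def)
    have s4k: "s4 (Suc k) = tbool (P (s 0))" using 2 by (simp add: s4_def s3_def)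
    have sb: "size (tbool B) \<le> 1" for B by (simp add: tbool_def)
    have e1: "exec (Assign k (Var 0)) s (Suc (Suc (size (s 0)))) s1"
      using exec_Assign[of k "Var 0" s] by (simp add: node_cost_def s1_def)
    have e3: "exec (Assign (Suc k) (Var 0)) s2 (Suc (Suc (size (tbool (P (s 0)))))) s3"
      using exec_Assign[of "Suc k" "Var 0" s2] 2 by (simp add: node_cost_def s3_def)
    have e4: "exec (Assign 0 (Var k)) s3 (Suc (Suc (size (s 0)))) s4"
      using exec_Assign[of 0 "Var k" s3] s3k by (simp add: node_cost_def s4_def)
    have cnd: "cost (Var (Suc k)) s4 \<le> 2" using sb s4k by (simp add: node_cost_def)
    obtain t5 s5 where 5: "exec (If (Var (Suc k)) c d) s4 t5 s5" "s5 0 = (if P (s 0) then f (s 0) else g (s 0))"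
      "\<And>i. i \<ge> k \<Longrightarrow> i \<noteq> 0 \<Longrightarrow> s5 i = s4 i"
      "t5 \<le> 3 + poly q (size (s 0)) + poly r (size (s 0))"
      "size (if P (s 0) then f (s 0) else g (s 0)) \<le> poly q (size (s 0)) + poly r (size (s 0))"
    proof (cases "P (s 0)")
      case True
      obtain t s' where *: "exec c s4 t s'" "s' 0 = f (s 0)" "\<And>i. i \<ge> n \<Longrightarrow> i \<noteq> 0 \<Longrightarrow> s' i = s4 i"
        "t \<le> poly q (size (s 0))" "size (f (s 0)) \<le> poly q (size (s 0))"
        using runsE[of c n q D f s4] c s s4 by metis
      have "exec (If (Var (Suc k)) c d) s4 (Suc (cost (Var (Suc k)) s4 + t)) s'"
        by (rule exec_IfTrue) (use s4k True * in auto)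
      then show thesis by (rule that) (use * True cnd in \<open>auto simp: k_def\<close>)
    next
      case False
      obtain t s' where *: "exec d s4 t s'" "s' 0 = g (s 0)" "\<And>i. i \<ge> m \<Longrightarrow> i \<noteq> 0 \<Longrightarrow> s' i = s4 i"
        "t \<le> poly r (size (s 0))" "size (g (s 0)) \<le> poly r (size (s 0))"
        using runsE[of d m r D g s4] d s s4 by metis
      have "exec (If (Var (Suc k)) c d) s4 (Suc (cost (Var (Suc k)) s4 + t)) s'"
        by (rule exec_IfFalse) (use s4k False * in auto)
      then show thesis by (rule that) (use * False cnd in \<open>auto simp: k_def\<close>)
    qed
    have "\<exists>t. exec p s t s5 \<and> t \<le> poly b (size (s 0))"
      unfolding p_def
      by (rule exI, rule conjI, rule exec_Seq[OF e1 exec_Seq[OF 2(1) exec_Seq[OF e3 exec_Seq[OF e4 5(1)]]]])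
        (use 2(4) 5(4) sb[of "P (s 0)"] in \<open>simp add: b_def algebra_simps\<close>)
    moreover have "\<forall>i\<ge>k + 2. i \<noteq> 0 \<longrightarrow> s5 i = s i"
      using 5(3) 2(3) by (auto simp: s4_def s3_def s1_def k_def)
    moreover have "size (if P (s 0) then f (s 0) else g (s 0)) \<le> poly b (size (s 0))"
      using 5(5) by (simp add: b_def)
    ultimately show "size (if P (s 0) then f (s 0) else g (s 0)) \<le> poly b (size (s 0)) \<and>
      (\<exists>t s'. exec p s t s' \<and> s' 0 = (if P (s 0) then f (s 0) else g (s 0)) \<and> (\<forall>i\<ge>k + 2. i \<noteq> 0 \<longrightarrow> s' i = s i) \<and> t \<le> poly b (size (s 0)))"
      using 5(2) by blast
  qed
qed

lemma pdec_not: "pdec D P \<Longrightarrow> pdec D (\<lambda>x. \<not> P x)"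
proof -
  have "(\<lambda>x. tbool (\<not> P x)) = (\<lambda>x. if P x then Atom else tt)"
    by (auto simp: tbool_def fun_eq_iff)
  then show "pdec D P \<Longrightarrow> pdec D (\<lambda>x. \<not> P x)"
    by (simp only: ptime_If ptime_const)
qed

lemma pdec_conj: "pdec D P \<Longrightarrow> pdec D Q \<Longrightarrow> pdec D (\<lambda>x. P x \<and> Q x)"
proof -
  have "(\<lambda>x. tbool (P x \<and> Q x)) = (\<lambda>x. if P x then tbool (Q x) else Atom)"
    by (auto simp: tbool_def fun_eq_iff)
  then show "pdec D P \<Longrightarrow> pdec D Q \<Longrightarrow> pdec D (\<lambda>x. P x \<and> Q x)"
    by (simp only: ptime_If ptime_const)
qed

section \<open>Lists as trees and loops over them\<close>

primrec to_list :: "tree \<Rightarrow> tree list" where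
  "to_list Atom = []"
| "to_list (Pair x y) = x # to_list y"

abbreviation of_list :: "tree list \<Rightarrow> tree" where
  "of_list \<equiv> enc_list (\<lambda>x. x)"

lemma to_of_list [simp]: "to_list (of_list xs) = xs"
  by (induction xs) auto

text \<open>Every tree is the code of exactly one list, so list functions are total on trees and
  carry no well-formedness conditions.\<close>

lemma of_to_list [simp]: "of_list (to_list x) = x"
  by (induction x) auto

lemma enc_list_map: "enc_list f xs = of_list (map f xs)"
  by (induction xs) auto

lemma size_of_list: "size (of_list xs) = sum_list (map size xs) + length xs"
  by (induction xs) auto

lemma size_to_list: "size x = sum_list (map size (to_list x)) + length (to_list x)"
  using size_of_list[of "to_list x"] by simp

text \<open>Variables \<open>k\<close>, \<open>k + 1\<close> and \<open>k + 2\<close> hold the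
  parameter, the rest of the list and the accumulator. As \<open>N\<close> bounds all three, the
  argument of \<open>h\<close>, formed with two more pairs, has size at most
  \<open>3 * N + 2\<close>.\<close>

lemma while_list:
  fixes h :: "tree \<Rightarrow> tree"
  assumes c: "runs c n q UNIV h" and k: "k > n"
    and l: "s (Suc k) = of_list ys" and x: "s k = x" and acc: "s (Suc (Suc k)) = a"
    and len: "size (of_list ys) \<le> N" and sx: "size x \<le> N"
    and bnd: "\<And>j. j \<le> length ys \<Longrightarrow> size (fold (\<lambda>e a. h (Pair x (Pair e a))) (take j ys) a) \<le> N"
  shows "\<exists>t s'. exec (While (Var (Suc k)) (Seq (Assign 0 (Cons (Var k) (Cons (Hd (Var (Suc k))) (Var (Suc (Suc k))))))
      (Seq c (Seq (Assign (Suc (Suc k)) (Var 0)) (Assign (Suc k) (Tl (Var (Suc k)))))))) s t s' \<and>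
    s' (Suc (Suc k)) = fold (\<lambda>e a. h (Pair x (Pair e a))) ys a \<and>
    (\<forall>i \<ge> k + 3. s' i = s i) \<and>
    t \<le> Suc (length ys) * (30 + 20 * N + poly q (3 * N + 2))"
  using l x acc len bnd
proof (induction ys arbitrary: s a)
  case Nil
  let ?W = "While (Var (Suc k)) (Seq (Assign 0 (Cons (Var k) (Cons (Hd (Var (Suc k))) (Var (Suc (Suc k))))))
      (Seq c (Seq (Assign (Suc (Suc k)) (Var 0)) (Assign (Suc k) (Tl (Var (Suc k)))))))"
  have "exec ?W s (Suc (cost (Var (Suc k)) s)) s"
    by (rule exec_WhileFalse) (use Nil in auto)
  then show ?case using Nil
    by (intro exI[of _ "Suc (cost (Var (Suc k)) s)"] exI[of _ s] conjI) (auto simp: node_cost_def)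
next
  case (Cons y ys)
  let ?B = "Seq (Assign 0 (Cons (Var k) (Cons (Hd (Var (Suc k))) (Var (Suc (Suc k))))))
      (Seq c (Seq (Assign (Suc (Suc k)) (Var 0)) (Assign (Suc k) (Tl (Var (Suc k))))))"
  let ?f = "\<lambda>e a. h (Pair x (Pair e a))"
  define z where "z = Pair x (Pair y a)"
  have sa: "size a \<le> N" using Cons.prems(5)[of 0] by simp
  have sh: "size (h z) \<le> N" using Cons.prems(5)[of 1] by (simp add: z_def)
  have sy: "size y + size (of_list ys) + 1 \<le> N" using Cons.prems(4) by simp
  have sz: "size z \<le> 3 * N + 2" using sa sy sx by (simp add: z_def)
  define s1 where "s1 = s(0 := z)"
  have e1: "exec (Assign 0 (Cons (Var k) (Cons (Hd (Var (Suc k))) (Var (Suc (Suc k)))))) s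
      (Suc (cost (Cons (Var k) (Cons (Hd (Var (Suc k))) (Var (Suc (Suc k))))) s)) s1"
    using exec_Assign[of 0 "Cons (Var k) (Cons (Hd (Var (Suc k))) (Var (Suc (Suc k))))" s] Cons.prems
    by (simp add: s1_def z_def)
  have c1: "cost (Cons (Var k) (Cons (Hd (Var (Suc k))) (Var (Suc (Suc k))))) s \<le> 10 + 10 * N"
    using Cons.prems sa sy sx by (simp add: node_cost_def)
  obtain t2 s2 where 2: "exec c s1 t2 s2" "s2 0 = h z" "\<And>i. i \<ge> n \<Longrightarrow> i \<noteq> 0 \<Longrightarrow> s2 i = s1 i"
      "t2 \<le> poly q (size z)"
    using runsE[of c n q UNIV h s1] c by (metis UNIV_I fun_upd_same s1_def)
  define s3 where "s3 = s2(Suc (Suc k) := h z)"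
  have e3: "exec (Assign (Suc (Suc k)) (Var 0)) s2 (Suc (Suc (size (h z)))) s3"
    using exec_Assign[of "Suc (Suc k)" "Var 0" s2] 2 by (simp add: node_cost_def s3_def)
  define s4 where "s4 = s3(Suc k := of_list ys)"
  have s3k: "s3 (Suc k) = of_list (y # ys)"
    using 2(3)[of "Suc k"] Cons.prems k by (simp add: s3_def s1_def)
  have e4: "exec (Assign (Suc k) (Tl (Var (Suc k)))) s3 (Suc (cost (Tl (Var (Suc k))) s3)) s4"
    using exec_Assign[of "Suc k" "Tl (Var (Suc k))" s3] s3k by (simp add: s4_def)
  have c4: "cost (Tl (Var (Suc k))) s3 \<le> 2 * N + 2"
    using s3k sy by (simp add: node_cost_def)
  have s4: "s4 (Suc k) = of_list ys" "s4 k = x" "s4 (Suc (Suc k)) = h z"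
    using 2(3)[of k] k Cons.prems by (auto simp: s4_def s3_def s1_def)
  obtain t5 s5 where 5: "exec (While (Var (Suc k)) ?B) s4 t5 s5" "s5 (Suc (Suc k)) = fold ?f ys (h z)"
    "\<forall>i \<ge> k + 3. s5 i = s4 i" "t5 \<le> Suc (length ys) * (30 + 20 * N + poly q (3 * N + 2))"
    using Cons.IH[OF s4] sy Cons.prems(5)[of "Suc _"] by (fastforce simp: z_def)
  have q: "t2 \<le> poly q (3 * N + 2)" using 2(4) poly_nat_mono[OF sz, of q] by simp
  have eB: "exec ?B s (Suc (Suc (cost (Cons (Var k) (Cons (Hd (Var (Suc k))) (Var (Suc (Suc k))))) s) +
     Suc (t2 + Suc (Suc (Suc (size (h z))) + Suc (cost (Tl (Var (Suc k))) s3))))) s4"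
    by (rule exec_Seq[OF e1 exec_Seq[OF 2(1) exec_Seq[OF e3 e4]]])
  have cw: "cost (Var (Suc k)) s \<le> N + 1" using Cons.prems by (simp add: node_cost_def)
  have nz: "val (Var (Suc k)) s \<noteq> Atom" using Cons.prems by simp
  show ?case
  proof (rule exI, intro exI[of _ s5] conjI)
    show "exec (While (Var (Suc k)) ?B) s (Suc (cost (Var (Suc k)) s + Suc (Suc (cost (Cons (Var k) (Cons (Hd (Var (Suc k))) (Var (Suc (Suc k))))) s) +
     Suc (t2 + Suc (Suc (Suc (size (h z))) + Suc (cost (Tl (Var (Suc k))) s3)))) + t5)) s5"
      by (rule exec_WhileTrue[OF nz eB 5(1)])
    show "s5 (Suc (Suc k)) = fold ?f (y # ys) a" using 5 by (simp add: z_def)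
    show "\<forall>i \<ge> k + 3. s5 i = s i"
    proof (intro allI impI)
      fix i assume i: "i \<ge> k + 3"
      then have "s5 i = s4 i" using 5 by simp
      also have "\<dots> = s2 i" using i by (simp add: s4_def s3_def)
      also have "\<dots> = s1 i" using 2(3) i k by simp
      also have "\<dots> = s i" using i by (simp add: s1_def)
      finally show "s5 i = s i" .
    qed
  qed (use 5(4) q c1 c4 cw sh in simp)
qed

text \<open>Only the results that actually arise on inputs in \<open>D\<close> must be small. This
  is how a property of the input can enter the running time, although the step \<open>h\<close>
  itself is polynomial on all trees.\<close>

lemma ptime_fold_bounded:
  assumes l: "ptime D l" and i: "ptime D i"
    and h: "ptime UNIV (\<lambda>z. h (tree_hd z) (tree_hd (tree_tl z)) (tree_tl (tree_tl z)))"
    and bnd: "\<And>x j. x \<in> D \<Longrightarrow> size (fold (h x) (take j (to_list (l x))) (i x)) \<le> poly B (size x)"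
  shows "ptime D (\<lambda>x. fold (h x) (to_list (l x)) (i x))"
proof -
  obtain c n q where c: "runs c n q D l" using l by (auto simp: ptime_def)
  obtain d m r where d: "runs d m r D i" using i by (auto simp: ptime_def)
  define h' where "h' = (\<lambda>z. h (tree_hd z) (tree_hd (tree_tl z)) (tree_tl (tree_tl z)))"
  obtain e n' q' where e: "runs e n' q' UNIV h'" using h by (auto simp: ptime_def h'_def)
  define k where "k = Suc (max n (max m n'))"
  define W where "W = While (Var (Suc k)) (Seq (Assign 0 (Cons (Var k) (Cons (Hd (Var (Suc k))) (Var (Suc (Suc k))))))
      (Seq e (Seq (Assign (Suc (Suc k)) (Var 0)) (Assign (Suc k) (Tl (Var (Suc k)))))))"
  define p where "p = Seq (Assign k (Var 0)) (Seq c (Seq (Assign (Suc k) (Var 0)) (Seq (Assign 0 (Var k))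
    (Seq d (Seq (Assign (Suc (Suc k)) (Var 0)) (Seq W (Assign 0 (Var (Suc (Suc k))))))))))"
  define R where "R = [:0, 1:] + q + B"
  define b where "b = 50 + 5 * q + 5 * r + 5 * B + [:0, 5:] + (1 + q) * (30 + 20 * R + pcompose q' (3 * R + 2))"
  show ?thesis
    unfolding ptime_def runs_def
  proof (rule exI[of _ p], rule exI[of _ "k + 3"], rule exI[of _ b], intro allI impI)
    fix s :: store assume s: "s 0 \<in> D"
    define x where "x = s 0"
    define s1 where "s1 = s(k := x)"
    have s1: "s1 0 = x" by (simp add: s1_def k_def x_def)
    have xD: "x \<in> D" using s by (simp add: x_def)
    obtain t2 s2 where 2: "exec c s1 t2 s2" "s2 0 = l x" "\<And>i. i \<ge> n \<Longrightarrow> i \<noteq> 0 \<Longrightarrow> s2 i = s1 i"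
      "t2 \<le> poly q (size x)" "size (l x) \<le> poly q (size x)"
      using runsE[of c n q D l s1] c xD s1 by metis
    define s3 where "s3 = s2(Suc k := s2 0)"
    define s4 where "s4 = s3(0 := s3 k)"
    have k2: "s2 k = x" using 2(3)[of k] by (simp add: s1_def k_def)
    then have s3k: "s3 k = x" by (simp add: s3_def)
    then have s4: "s4 0 = x" by (simp add: s4_def)
    obtain t5 s5 where 5: "exec d s4 t5 s5" "s5 0 = i x" "\<And>j. j \<ge> m \<Longrightarrow> j \<noteq> 0 \<Longrightarrow> s5 j = s4 j"
      "t5 \<le> poly r (size x)" "size (i x) \<le> poly r (size x)"
      using runsE[of d m r D i s4] d xD s4 by metis
    define s6 where "s6 = s5(Suc (Suc k) := i x)"
    have s6: "s6 (Suc k) = of_list (to_list (l x))" "s6 k = x" "s6 (Suc (Suc k)) = i x"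
      using 5(3)[of k] 5(3)[of "Suc k"] 2(2) s3k by (auto simp: s6_def s4_def s3_def k_def)
    define N where "N = poly R (size x)"
    have ha: "(\<lambda>e a. h' (Pair x (Pair e a))) = h x" by (simp add: h'_def fun_eq_iff)
    have kn: "k > n'" by (simp add: k_def)
    have "size (of_list (to_list (l x))) \<le> N" "size x \<le> N" using 2 by (auto simp: N_def R_def)
    moreover have "size (fold (\<lambda>e a. h' (Pair x (Pair e a))) (take j (to_list (l x))) (i x)) \<le> N" for j
      unfolding ha using bnd[OF xD, of j] by (simp add: N_def R_def)
    ultimately obtain t7 s7 where 7: "exec W s6 t7 s7"
      "s7 (Suc (Suc k)) = fold (h x) (to_list (l x)) (i x)" "\<forall>j \<ge> k + 3. s7 j = s6 j"
      "t7 \<le> Suc (length (to_list (l x))) * (30 + 20 * N + poly q' (3 * N + 2))"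
      using while_list[OF e kn s6, of N] unfolding W_def ha by blast
    let ?r = "fold (h x) (to_list (l x)) (i x)"
    define s8 where "s8 = s7(0 := ?r)"
    have sr: "size ?r \<le> poly B (size x)" using bnd[OF xD, of "length (to_list (l x))"] by simp
    have ll: "length (to_list (l x)) \<le> poly q (size x)" using size_to_list[of "l x"] 2(5) by linarith
    have t7: "t7 \<le> (1 + poly q (size x)) * (30 + 20 * N + poly q' (3 * N + 2))"
      by (rule order_trans[OF 7(4)], rule mult_le_mono1) (use ll in simp)
    have e1: "exec (Assign k (Var 0)) s (Suc (Suc (size x))) s1"
      using exec_Assign[of k "Var 0" s] by (simp add: node_cost_def s1_def x_def)
    have e3: "exec (Assign (Suc k) (Var 0)) s2 (Suc (Suc (size (l x)))) s3"
      using exec_Assign[of "Suc k" "Var 0" s2] 2 by (simp add: node_cost_def s3_def)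
    have e4: "exec (Assign 0 (Var k)) s3 (Suc (Suc (size x))) s4"
      using exec_Assign[of 0 "Var k" s3] s3k by (simp add: node_cost_def s4_def)
    have e6: "exec (Assign (Suc (Suc k)) (Var 0)) s5 (Suc (Suc (size (i x)))) s6"
      using exec_Assign[of "Suc (Suc k)" "Var 0" s5] 5 by (simp add: node_cost_def s6_def)
    have e8: "exec (Assign 0 (Var (Suc (Suc k)))) s7 (Suc (Suc (size ?r))) s8"
      using exec_Assign[of 0 "Var (Suc (Suc k))" s7] 7 by (simp add: node_cost_def s8_def)
    have "\<exists>t. exec p s t s8 \<and> t \<le> poly b (size x)"
      unfolding p_def
      by (rule exI, rule conjI, rule exec_Seq[OF e1 exec_Seq[OF 2(1) exec_Seq[OF e3 exec_Seq[OF e4 exec_Seq[OF 5(1)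
              exec_Seq[OF e6 exec_Seq[OF 7(1) e8]]]]]]])
        (use 2(4,5) 5(4,5) t7 sr in \<open>simp add: b_def N_def poly_pcompose\<close>)
    moreover have "s8 0 = ?r" by (simp add: s8_def)
    moreover have "\<forall>j\<ge>k + 3. j \<noteq> 0 \<longrightarrow> s8 j = s j"
      using 7(3) 5(3) 2(3) by (auto simp: s8_def s6_def s4_def s3_def s1_def k_def)
    moreover have "size ?r \<le> poly b (size x)" using sr by (simp add: b_def)
    ultimately show "size (fold (h (s 0)) (to_list (l (s 0))) (i (s 0))) \<le> poly b (size (s 0)) \<and>
      (\<exists>t s'. exec p s t s' \<and> s' 0 = fold (h (s 0)) (to_list (l (s 0))) (i (s 0)) \<and>
        (\<forall>i\<ge>k + 3. i \<noteq> 0 \<longrightarrow> s' i = s i) \<and> t \<le> poly b (size (s 0)))"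
      unfolding x_def by blast
  qed
qed

lemma ptime_size:
  assumes "ptime D f"
  shows "\<exists>q. \<forall>x\<in>D. size (f x) \<le> poly q (size x)"
proof -
  obtain c n q where c: "runs c n q D f" using assms by (auto simp: ptime_def)
  have "size (f x) \<le> poly q (size x)" if "x \<in> D" for x
    using c that unfolding runs_def by (auto dest: spec[of _ "\<lambda>_. x"])
  then show ?thesis by blast
qed

text \<open>Each step adds to the accumulator an amount that does not depend on the accumulator, so
  the growth over the whole list is additive and cannot become exponential.\<close>

lemma ptime_fold:
  assumes l: "ptime D l" and i: "ptime D i"
    and h: "ptime UNIV (\<lambda>z. h (tree_hd z) (tree_hd (tree_tl z)) (tree_tl (tree_tl z)))"
    and grow: "\<And>x e a. size (h x e a) \<le> size a + poly q (size x + size e)"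
  shows "ptime D (\<lambda>x. fold (h x) (to_list (l x)) (i x))"
proof -
  obtain pl where pl: "\<And>x. x \<in> D \<Longrightarrow> size (l x) \<le> poly pl (size x)" using ptime_size[OF l] by blast
  obtain pi where pi: "\<And>x. x \<in> D \<Longrightarrow> size (i x) \<le> poly pi (size x)" using ptime_size[OF i] by blast
  have *: "size (fold (h x) ys a) \<le> size a + length ys * poly q (size x + N)"
    if "\<And>y. y \<in> set ys \<Longrightarrow> size y \<le> N" for x ys a N
    using that
  proof (induction ys arbitrary: a)
    case (Cons y ys)
    have "size (fold (h x) ys (h x y a)) \<le> size (h x y a) + length ys * poly q (size x + N)"
      using Cons by simp
    also have "size (h x y a) \<le> size a + poly q (size x + N)"
      using grow[of x y a] poly_nat_mono[of "size x + size y" "size x + N" q] Cons.prems by fastforce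
    finally show ?case by simp
  qed simp
  show ?thesis
  proof (rule ptime_fold_bounded[OF l i h, of "pi + pl * pcompose q ([:0, 1:] + pl)"])
    fix x j assume x: "x \<in> D"
    have el: "size y \<le> poly pl (size x)" if "y \<in> set (take j (to_list (l x)))" for y
    proof -
      have "y \<in> set (to_list (l x))" using that by (rule in_set_takeD)
      then have "size y \<le> sum_list (map size (to_list (l x)))" by (intro member_le_sum_list) auto
      then show ?thesis using size_to_list[of "l x"] pl[OF x] by linarith
    qed
    have len: "length (take j (to_list (l x))) \<le> poly pl (size x)"
      using size_to_list[of "l x"] pl[OF x] by simp
    have "size (fold (h x) (take j (to_list (l x))) (i x)) \<le>
      size (i x) + length (take j (to_list (l x))) * poly q (size x + poly pl (size x))"
      by (rule *) (rule el)
    also have "\<dots> \<le> poly pi (size x) + poly pl (size x) * poly q (size x + poly pl (size x))"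
      by (intro add_mono mult_le_mono1 len pi x)
    finally show "size (fold (h x) (take j (to_list (l x))) (i x)) \<le> poly (pi + pl * pcompose q ([:0, 1:] + pl)) (size x)"
      by (simp add: poly_pcompose)
  qed
qed

lemma ptime_comp2:
  assumes "ptime UNIV (\<lambda>z. F (tree_hd z) (tree_tl z))" "ptime D f" "ptime D g"
  shows "ptime D (\<lambda>x. F (f x) (g x))"
  using ptime_comp_UNIV[OF ptime_Pair[OF assms(2,3)] assms(1)] by simp

lemma ptime_comp3:
  assumes "ptime UNIV (\<lambda>z. F (tree_hd z) (tree_hd (tree_tl z)) (tree_tl (tree_tl z)))"
    "ptime D f" "ptime D g" "ptime D h"
  shows "ptime D (\<lambda>x. F (f x) (g x) (h x))"
  using ptime_comp_UNIV[OF ptime_Pair[OF assms(2) ptime_Pair[OF assms(3,4)]] assms(1)] by simp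

abbreviation plist :: "tree set \<Rightarrow> (tree \<Rightarrow> tree list) \<Rightarrow> bool" where
  "plist D f \<equiv> ptime D (\<lambda>x. of_list (f x))"

lemma plist_to_list: "ptime D f \<Longrightarrow> plist D (\<lambda>x. to_list (f x))"
  by simp

lemma plist_Nil: "plist D (\<lambda>x. [])"
  by (simp add: ptime_const)

lemma plist_Cons: "ptime D f \<Longrightarrow> plist D l \<Longrightarrow> plist D (\<lambda>x. f x # l x)"
  by (simp add: ptime_Pair)

lemma plist_If: "pdec D P \<Longrightarrow> plist D f \<Longrightarrow> plist D g \<Longrightarrow> plist D (\<lambda>x. if P x then f x else g x)"
  using ptime_If[of D P "\<lambda>x. of_list (f x)" "\<lambda>x. of_list (g x)"]
  by (simp add: if_distrib)

lemma plist_fold: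
  assumes l: "plist D l" and i: "plist D i"
    and h: "plist UNIV (\<lambda>z. h (tree_hd z) (tree_hd (tree_tl z)) (to_list (tree_tl (tree_tl z))))"
    and grow: "\<And>x e a. size (of_list (h x e a)) \<le> size (of_list a) + poly q (size x + size e)"
  shows "plist D (\<lambda>x. fold (h x) (l x) (i x))"
proof -
  let ?h = "\<lambda>x e a. of_list (h x e (to_list a))"
  have g: "size (?h x e a) \<le> size a + poly q (size x + size e)" for x e a
    using grow[of x e "to_list a"] by simp
  have "fold (?h x) xs (of_list a) = of_list (fold (h x) xs a)" for x xs a
    by (induction xs arbitrary: a) auto
  with ptime_fold[where h = ?h, OF l i h g] show ?thesis by simp
qed

lemma plist_rev:
  assumes "plist D l"
  shows "plist D (\<lambda>x. rev (l x))"
proof -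
  have "plist D (\<lambda>x. fold (\<lambda>e a. e # a) (l x) [])"
    by (rule plist_fold[where q = "[:1, 1:]"])
      (intro assms plist_Nil plist_Cons plist_to_list ptime_hd ptime_tl ptime_id | simp)+
  moreover have "fold (\<lambda>e a. e # a) xs ys = rev xs @ ys" for xs ys :: "tree list"
    by (induction xs arbitrary: ys) auto
  ultimately show ?thesis by simp
qed

lemma plist_append:
  assumes "plist D l" "plist D m"
  shows "plist D (\<lambda>x. l x @ m x)"
proof -
  have "plist D (\<lambda>x. fold (\<lambda>e a. e # a) (rev (l x)) (m x))"
    by (rule plist_fold[where q = "[:1, 1:]"])
      (intro assms plist_rev plist_Cons plist_to_list ptime_hd ptime_tl ptime_id | simp)+
  moreover have "fold (\<lambda>e a. e # a) xs ys = rev xs @ ys" for xs ys :: "tree list"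
    by (induction xs arbitrary: ys) auto
  ultimately show ?thesis by simp
qed

lemma size_append: "size (of_list (xs @ ys)) = size (of_list xs) + size (of_list ys)"
  by (induction xs) auto

lemma plist_concat_map:
  assumes l: "plist D l" and f: "plist UNIV (\<lambda>z. f (tree_hd z) (tree_tl z))"
  shows "plist D (\<lambda>x. concat (map (f x) (l x)))"
proof -
  obtain q where q: "\<And>z. size (of_list (f (tree_hd z) (tree_tl z))) \<le> poly q (size z)"
    using ptime_size[OF f] by blast
  have g: "size (of_list (f x e)) \<le> poly (pcompose q [:1, 1:]) (size x + size e)" for x e
    using q[of "Pair x e"] by (simp add: poly_pcompose algebra_simps)
  have h: "plist UNIV (\<lambda>z. f (tree_hd z) (tree_hd (tree_tl z)) @ to_list (tree_tl (tree_tl z)))"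
    by (rule plist_append, rule ptime_comp2[where F = "\<lambda>a b. of_list (f a b)", OF f])
      (intro plist_to_list ptime_hd ptime_tl ptime_id)+
  have "plist D (\<lambda>x. fold (\<lambda>e a. f x e @ a) (rev (l x)) [])"
    by (rule plist_fold[where h = "\<lambda>x e a. f x e @ a", OF plist_rev[OF l] plist_Nil h])
      (use g in \<open>simp add: size_append\<close>)
  moreover have "fold (\<lambda>e a. f x e @ a) (rev xs) ys = concat (map (f x) xs) @ ys" for x xs ys
    by (induction xs arbitrary: ys) auto
  ultimately show ?thesis by simp
qed

lemma plist_map:
  assumes "plist D l" "ptime UNIV (\<lambda>z. f (tree_hd z) (tree_tl z))"
  shows "plist D (\<lambda>x. map (f x) (l x))"
proof -
  have "concat (map (\<lambda>e. [f x e]) xs) = map (f x) xs" for x xs by (induction xs) auto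
  with plist_concat_map[of D l "\<lambda>x e. [f x e]"] assms show ?thesis
    by (simp add: ptime_Pair ptime_const)
qed

lemma plist_filter:
  assumes "plist D l" "pdec UNIV (\<lambda>z. P (tree_hd z) (tree_tl z))"
  shows "plist D (\<lambda>x. filter (P x) (l x))"
proof -
  have e: "concat (map (\<lambda>e. if P x e then [e] else []) xs) = filter (P x) xs" for x xs
    by (induction xs) auto
  have "plist UNIV (\<lambda>z. if P (tree_hd z) (tree_tl z) then [tree_tl z] else [])"
    by (intro plist_If assms plist_Cons plist_Nil ptime_tl ptime_id)
  from plist_concat_map[OF assms(1), of "\<lambda>x e. if P x e then [e] else []", OF this]
  show ?thesis by (simp add: e)
qed

lemma pdec_Nil: "plist D l \<Longrightarrow> pdec D (\<lambda>x. l x = [])"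
proof -
  assume l: "plist D l"
  have "of_list xs = Atom \<longleftrightarrow> xs = []" for xs by (cases xs) auto
  then show ?thesis using pdec_eq[OF l ptime_const[of D Atom]] by simp
qed

lemma pdec_Bex:
  assumes "plist D l" "pdec UNIV (\<lambda>z. P (tree_hd z) (tree_tl z))"
  shows "pdec D (\<lambda>x. \<exists>e\<in>set (l x). P x e)"
proof -
  have "(\<exists>e\<in>set xs. P x e) \<longleftrightarrow> filter (P x) xs \<noteq> []" for x xs
    by (auto simp: filter_empty_conv)
  then show ?thesis using pdec_not[OF pdec_Nil[OF plist_filter[OF assms]]] by simp
qed

lemma pdec_listeq:
  assumes "plist D l" "plist D m"
  shows "pdec D (\<lambda>x. l x = m x)"
proof -
  have "(of_list xs = of_list ys) = (xs = ys)" for xs ys by (metis to_of_list)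
  then show ?thesis using pdec_eq[OF assms] by simp
qed

text \<open>The fold keeps first occurrences only, so it returns the reversed list exactly if
  nothing was skipped. The length bound, proved in the same induction, shows that a skipped element
  leaves the result too short.\<close>

lemma pdec_distinct:
  assumes "plist D l"
  shows "pdec D (\<lambda>x. distinct (l x))"
proof -
  let ?f = "\<lambda>e a. if \<exists>u\<in>set a. u = e then a else e # a"
  have f: "fold ?f xs ys = rev xs @ ys \<longleftrightarrow> distinct xs \<and> set xs \<inter> set ys = {}"
    "length (fold ?f xs ys) \<le> length xs + length ys" for xs ys :: "tree list"
  proof (induction xs arbitrary: ys)
    case (Cons x xs)
    {
      case 1
      show ?case
      proof (cases "x \<in> set ys")
        case True
        have "length (fold ?f xs ys) \<le> length xs + length ys" by (rule Cons)
        then have "fold ?f xs ys \<noteq> rev (x # xs) @ ys" by (metis length_append length_rev length_Cons add_Suc not_less_eq_eq le_refl)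
        then show ?thesis using True by auto
      next
        case False
        then show ?thesis using Cons(1)[of "x # ys"] by auto
      qed
    next
      case 2
      show ?case using Cons(2)[of ys] Cons(2)[of "x # ys"] by auto
    }
  qed auto
  have "plist D (\<lambda>x. fold ?f (l x) [])"
    by (rule plist_fold[where h = "\<lambda>_. ?f" and q = "[:1, 1:]"])
      (intro assms plist_Nil plist_Cons plist_If pdec_Bex pdec_eq plist_to_list ptime_hd ptime_tl ptime_id | simp)+
  from pdec_listeq[OF this plist_rev[OF assms]] show ?thesis
    using f(1)[of _ "[]"] by simp
qed

text \<open>\<open>l\<close> serves as a unary counter. Counting past the end is harmless because
  the tail of \<open>Atom\<close> is \<open>Atom\<close>.\<close>

lemma plist_drop:
  assumes "plist D l" "plist D m"
  shows "plist D (\<lambda>x. drop (length (l x)) (m x))"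
proof -
  have "plist D (\<lambda>x. fold (\<lambda>e a. to_list (tree_tl (of_list a))) (l x) (m x))"
    by (rule plist_fold[where q = 0])
      (intro assms plist_to_list ptime_hd ptime_tl ptime_id | simp add: size_tl)+
  moreover have "fold (\<lambda>e a. to_list (tree_tl (of_list a))) xs ys = drop (length xs) ys" for xs ys :: "tree list"
  proof (induction xs arbitrary: ys)
    case (Cons x xs)
    then show ?case by (cases ys) auto
  qed simp
  ultimately show ?thesis by simp
qed

lemma plist_take1:
  assumes "plist D l"
  shows "plist D (\<lambda>x. take 1 (l x))"
proof -
  have "plist D (\<lambda>x. if l x = [] then [] else [tree_hd (of_list (l x))])"
    by (intro plist_If pdec_Nil plist_Nil plist_Cons ptime_hd assms)
  moreover have "(if xs = [] then [] else [tree_hd (of_list xs)]) = take 1 xs" for xs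
    by (cases xs) auto
  ultimately show ?thesis by simp
qed

lemmas ptime_rules = plist_rev plist_append plist_concat_map plist_map plist_filter pdec_Bex
  pdec_distinct plist_drop plist_take1 plist_Cons plist_Nil plist_If pdec_Nil pdec_not pdec_conj
  pdec_eq plist_to_list ptime_hd ptime_tl ptime_Pair ptime_If ptime_id

section \<open>The search program\<close>

definition dart_edge :: "tree \<Rightarrow> tree" where "dart_edge d = tree_hd d"
definition dart_src :: "tree \<Rightarrow> tree" where "dart_src d = tree_hd (tree_tl d)"
definition dart_tgt :: "tree \<Rightarrow> tree" where "dart_tgt d = tree_hd (tree_tl (tree_tl d))"
definition dart_col :: "tree \<Rightarrow> tree" where "dart_col d = tree_hd (tree_tl (tree_tl (tree_tl d)))"
text \<open>This is the format of an edge in the input, so the input edges are darts as they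
  stand.\<close>

definition dart :: "tree \<Rightarrow> tree \<Rightarrow> tree \<Rightarrow> tree \<Rightarrow> tree" where
  "dart e u v c = Pair e (Pair u (Pair v (Pair c Atom)))"
definition dart_rev :: "tree \<Rightarrow> tree" where
  "dart_rev d = dart (dart_edge d) (dart_tgt d) (dart_src d) (dart_col d)"
definition last_vertex :: "tree \<Rightarrow> tree" where "last_vertex T = dart_tgt (tree_hd T)"
definition last_col :: "tree \<Rightarrow> tree" where "last_col T = dart_col (tree_hd T)"

lemma ptime_darts:
  assumes "ptime D f"
  shows "ptime D (\<lambda>x. dart_edge (f x))" "ptime D (\<lambda>x. dart_src (f x))" "ptime D (\<lambda>x. dart_tgt (f x))"
    "ptime D (\<lambda>x. dart_col (f x))" "ptime D (\<lambda>x. dart_rev (f x))" "ptime D (\<lambda>x. last_vertex (f x))"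
    "ptime D (\<lambda>x. last_col (f x))"
  unfolding dart_edge_def dart_src_def dart_tgt_def dart_col_def dart_rev_def dart_def last_vertex_def last_col_def
  by (intro ptime_rules ptime_const assms)+

text \<open>This and the following predicates are phrased with equality, negation, conjunction and
  bounded quantifiers over lists, for which closure rules are available.\<close>

definition usable_tree :: "tree \<Rightarrow> tree \<Rightarrow> bool" where
  "usable_tree d T \<longleftrightarrow> dart_src d = last_vertex T \<and> \<not> dart_col d = last_col T \<and>
     \<not> (\<exists>q\<in>set (to_list T). dart_edge q = dart_edge d)"

lemma pdec_usable:
  assumes "ptime D f" "ptime D g"
  shows "pdec D (\<lambda>x. usable_tree (f x) (g x))"
  by (rule ptime_comp2[where F = "\<lambda>a b. tbool (usable_tree a b)", OF _ assms])
    (unfold usable_tree_def, intro ptime_rules ptime_darts)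

definition reached_list :: "tree list \<Rightarrow> tree \<Rightarrow> bool" where
  "reached_list K v \<longleftrightarrow> (\<exists>T\<in>set K. last_vertex T = v)"

definition full_list :: "tree list \<Rightarrow> tree \<Rightarrow> bool" where
  "full_list K v \<longleftrightarrow> (\<exists>T\<in>set K. \<exists>T'\<in>set K. last_vertex T = v \<and> last_vertex T' = v \<and> \<not> last_col T = last_col T')"

lemma plist_comp2:
  assumes "ptime UNIV (\<lambda>z. F (to_list (tree_hd z)) (tree_tl z))" "plist D l" "ptime D g"
  shows "ptime D (\<lambda>x. F (l x) (g x))"
  using ptime_comp2[where F = "\<lambda>a b. F (to_list a) b", OF assms] by simp

lemma pdec_reached:
  assumes "plist D K" "ptime D f"
  shows "pdec D (\<lambda>x. reached_list (K x) (f x))"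
  by (rule plist_comp2[where F = "\<lambda>a b. tbool (reached_list a b)", OF _ assms])
    (unfold reached_list_def, intro ptime_rules ptime_darts)

lemma pdec_full:
  assumes "plist D K" "ptime D f"
  shows "pdec D (\<lambda>x. full_list (K x) (f x))"
  by (rule plist_comp2[where F = "\<lambda>a b. tbool (full_list a b)", OF _ assms])
    (unfold full_list_def, intro ptime_rules ptime_darts)

text \<open>Read as a list, \<open>Pair d T\<close> is already the extended trail
  \<open>d # T\<close>.\<close>

definition growths :: "tree list \<Rightarrow> tree list \<Rightarrow> tree list" where
  "growths E K = concat (map (\<lambda>d. map (\<lambda>T. Pair d T)
     (filter (\<lambda>T. usable_tree d T \<and> \<not> reached_list K (dart_tgt d)) K)) E)"

definition links :: "tree list \<Rightarrow> tree list \<Rightarrow> tree list" where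
  "links E K = concat (map (\<lambda>d. concat (map (\<lambda>T. map (\<lambda>T'. Pair d (Pair T T'))
     (filter (\<lambda>T'. usable_tree (dart_rev d) T') K)) (filter (\<lambda>T. usable_tree d T) K))) E)"

lemma plist_comp_lists:
  assumes "ptime UNIV (\<lambda>z. F (to_list (tree_hd z)) (to_list (tree_tl z)))" "plist D l" "plist D m"
  shows "ptime D (\<lambda>x. F (l x) (m x))"
  using ptime_comp2[where F = "\<lambda>a b. F (to_list a) (to_list b)", OF assms] by simp

lemma plist_growths:
  assumes "plist D E" "plist D K"
  shows "plist D (\<lambda>x. growths (E x) (K x))"
  by (rule plist_comp_lists[where F = "\<lambda>a b. of_list (growths a b)", OF _ assms])
    (unfold growths_def, intro ptime_rules ptime_darts pdec_usable pdec_reached)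

lemma plist_links:
  assumes "plist D E" "plist D K"
  shows "plist D (\<lambda>x. links (E x) (K x))"
  by (rule plist_comp_lists[where F = "\<lambda>a b. of_list (links a b)", OF _ assms])
    (unfold links_def, intro ptime_rules ptime_darts pdec_usable)

text \<open>A link is coded as \<open>(d, T, T')\<close>. For \<open>Tv = Atom\<close>, the empty list, all of \<open>T'\<close> is reversed.\<close>

definition unwind :: "tree \<Rightarrow> tree \<Rightarrow> tree list" where
  "unwind Tv l = map dart_rev (drop (length (to_list Tv)) (rev (to_list (tree_tl (tree_tl l))))) @
     tree_hd l # to_list (tree_hd (tree_tl l))"

definition clean :: "tree list \<Rightarrow> bool" where
  "clean T \<longleftrightarrow> distinct (map dart_edge T)"

definition successes :: "tree list \<Rightarrow> tree list \<Rightarrow> tree list" where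
  "successes E K = filter (\<lambda>l. clean (unwind Atom l)) (links E K)"

definition ends_with :: "tree \<Rightarrow> tree \<Rightarrow> bool" where
  "ends_with T Tv \<longleftrightarrow> rev (drop (length (to_list Tv)) (rev (to_list T))) @ to_list Tv = to_list T"

definition unwindings :: "tree list \<Rightarrow> tree \<Rightarrow> tree list" where
  "unwindings K l = filter (\<lambda>U. clean (to_list U)) (map (\<lambda>Tv. of_list (unwind Tv l))
     (filter (\<lambda>Tv. ends_with (tree_tl (tree_tl l)) Tv \<and> \<not> full_list K (last_vertex Tv)) K))"

definition flip :: "tree \<Rightarrow> tree" where
  "flip l = Pair (dart_rev (tree_hd l)) (Pair (tree_tl (tree_tl l)) (tree_hd (tree_tl l)))"

text \<open>One new trail per end vertex is enough for \<open>merge\<close> and bounds the number of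
  trails added in a round by the number of vertices.\<close>

definition new_trails :: "tree list \<Rightarrow> tree list \<Rightarrow> tree \<Rightarrow> tree list" where
  "new_trails V K l = concat (map (\<lambda>v. take 1 (filter (\<lambda>U. last_vertex U = v)
     (unwindings K l @ unwindings K (flip l)))) V)"

definition merges :: "tree list \<Rightarrow> tree list \<Rightarrow> tree list" where
  "merges E K = filter (\<lambda>l. \<not> unwindings K l = []) (links E K)"

text \<open>Merging waits until there is no success, because then \<open>link_meets\<close>
  guarantees a common ancestor. After a success all remaining rounds are idle.\<close>

definition step :: "tree list \<Rightarrow> tree list \<Rightarrow> tree list \<Rightarrow> tree list" where
  "step V E K = (if growths E K = [] then
     (if successes E K = [] then
        (if merges E K = [] then K else new_trails V K (tree_hd (of_list (merges E K))) @ K)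
      else K)
     else take 1 (growths E K) @ K)"

lemma plist_unwind:
  assumes "ptime D f" "ptime D g"
  shows "plist D (\<lambda>x. unwind (f x) (g x))"
  by (rule ptime_comp2[where F = "\<lambda>a b. of_list (unwind a b)", OF _ assms])
    (unfold unwind_def, intro ptime_rules ptime_darts)

lemma pdec_clean:
  assumes "plist D l"
  shows "pdec D (\<lambda>x. clean (l x))"
  unfolding clean_def by (intro ptime_rules assms ptime_darts)

lemma pdec_ends_with:
  assumes "ptime D f" "ptime D g"
  shows "pdec D (\<lambda>x. ends_with (f x) (g x))"
  unfolding ends_with_def by (intro pdec_listeq ptime_rules assms)

lemma plist_successes:
  assumes "plist D E" "plist D K"
  shows "plist D (\<lambda>x. successes (E x) (K x))"
  unfolding successes_def by (intro ptime_rules plist_links assms pdec_clean plist_unwind ptime_const)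

lemma plist_unwindings:
  assumes "plist D K" "ptime D f"
  shows "plist D (\<lambda>x. unwindings (K x) (f x))"
  by (rule plist_comp2[where F = "\<lambda>a b. of_list (unwindings a b)", OF _ assms])
    (unfold unwindings_def, intro ptime_rules ptime_darts pdec_clean plist_unwind pdec_ends_with pdec_full)

lemma ptime_flip: "ptime D f \<Longrightarrow> ptime D (\<lambda>x. flip (f x))"
  unfolding flip_def by (intro ptime_rules ptime_darts)

lemma plist_new_trails:
  assumes "plist D V" "plist D K" "ptime D f"
  shows "plist D (\<lambda>x. new_trails (V x) (K x) (f x))"
proof -
  have "plist UNIV (\<lambda>z. new_trails (to_list (tree_hd z)) (to_list (tree_hd (tree_tl z))) (tree_tl (tree_tl z)))"
    unfolding new_trails_def by (intro ptime_rules ptime_darts plist_unwindings ptime_flip)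
  from ptime_comp3[where F = "\<lambda>a b c. of_list (new_trails (to_list a) (to_list b) c)", OF this assms]
  show ?thesis by simp
qed

lemma plist_merges:
  assumes "plist D E" "plist D K"
  shows "plist D (\<lambda>x. merges (E x) (K x))"
  by (rule plist_comp_lists[where F = "\<lambda>a b. of_list (merges a b)", OF _ assms])
    (unfold merges_def, intro ptime_rules plist_links plist_unwindings)

lemma plist_step:
  assumes "plist D V" "plist D E" "plist D K"
  shows "plist D (\<lambda>x. step (V x) (E x) (K x))"
  unfolding step_def
  by (intro ptime_rules plist_growths plist_successes plist_merges plist_new_trails assms)

definition all_darts :: "tree list \<Rightarrow> tree list" where
  "all_darts es = es @ map dart_rev es"

text \<open>The tree \<open>Pair tt Atom\<close> is no binary digit, hence the edge name is not the code of a
  number.\<close>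

definition root_dart :: "tree \<Rightarrow> tree \<Rightarrow> tree" where
  "root_dart c s = dart (Pair (Pair tt Atom) s) s s c"

text \<open>Any colour differs from \<open>Atom\<close> or from \<open>tt\<close>, so every edge at
  a terminal can follow one of its two loops.\<close>

definition root_trails :: "tree list \<Rightarrow> tree list" where
  "root_trails ss = concat (map (\<lambda>s. [of_list [root_dart Atom s], of_list [root_dart tt s]]) ss)"

definition in_vs :: "tree \<Rightarrow> tree list" where "in_vs x = to_list (tree_hd x)"
definition in_darts :: "tree \<Rightarrow> tree list" where "in_darts x = all_darts (to_list (tree_hd (tree_tl x)))"
definition in_terminals :: "tree \<Rightarrow> tree list" where "in_terminals x = to_list (tree_tl (tree_tl x))"

text \<open>The vertex list, taken twice, is only a counter of the rounds.\<close>

definition search :: "tree \<Rightarrow> tree list" where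
  "search x = fold (\<lambda>_ K. step (in_vs x) (in_darts x) K) (in_vs x @ in_vs x) (root_trails (in_terminals x))"

text \<open>The unwound list has a fictitious loop at each end. The inner \<open>tree_tl\<close>
  removes the loop of the final terminal, the outer one, after the reversal, that of the initial
  terminal, whose target is the start of the walk.\<close>

definition trail_output :: "tree \<Rightarrow> tree" where
  "trail_output l = (let T = unwind Atom l in Pair Atom
     (Pair (dart_tgt (tree_hd (of_list (rev T))))
       (of_list (map (\<lambda>d. Pair (dart_edge d) (dart_tgt d)) (to_list (tree_tl (of_list (rev (to_list (tree_tl (of_list T)))))))))))"

definition answer :: "tree \<Rightarrow> tree list \<Rightarrow> tree" where
  "answer x K = (if successes (in_darts x) K = []
     then Pair tt (of_list (filter (\<lambda>v. reached_list K v \<and> \<not> full_list K v) (in_vs x)))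
     else trail_output (tree_hd (of_list (successes (in_darts x) K))))"

lemma plist_inputs:
  assumes "ptime D f"
  shows "plist D (\<lambda>x. in_vs (f x))" "plist D (\<lambda>x. in_darts (f x))" "plist D (\<lambda>x. in_terminals (f x))"
  unfolding in_vs_def in_darts_def in_terminals_def all_darts_def
  by (intro ptime_rules ptime_darts assms)+

lemma ptime_trail_output: "ptime D f \<Longrightarrow> ptime D (\<lambda>x. trail_output (f x))"
  unfolding trail_output_def Let_def by (intro ptime_rules ptime_const ptime_darts plist_unwind)

lemma ptime_answer:
  assumes "ptime D f" "plist D K"
  shows "ptime D (\<lambda>x. answer (f x) (K x))"
proof -
  have "ptime UNIV (\<lambda>z. answer (tree_hd z) (to_list (tree_tl z)))"
    unfolding answer_def
    by (intro ptime_rules plist_successes plist_inputs ptime_const pdec_reached pdec_full ptime_trail_output)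
  from ptime_comp2[where F = "\<lambda>a b. answer a (to_list b)", OF this assms] show ?thesis by simp
qed

text \<open>The additive criterion of \<open>ptime_fold\<close> is out of reach: a growth alone
  copies a stored trail and may nearly double the accumulator. The bound is therefore a hypothesis
  on \<open>D\<close>, supplied for encoded instances by \<open>search_size\<close>.\<close>

lemma ptime_search:
  assumes "\<And>x j. x \<in> D \<Longrightarrow> size (of_list (fold (\<lambda>_ K. step (in_vs x) (in_darts x) K)
      (take j (in_vs x @ in_vs x)) (root_trails (in_terminals x)))) \<le> poly B (size x)"
  shows "plist D search"
proof -
  let ?h = "\<lambda>x (e :: tree) K. of_list (step (in_vs x) (in_darts x) (to_list K))"
  have f: "fold (?h x) xs (of_list a) = of_list (fold (\<lambda>_ K. step (in_vs x) (in_darts x) K) xs a)" for x xs a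
    by (induction xs arbitrary: a) auto
  have V: "plist D (\<lambda>x. in_vs x @ in_vs x)"
    by (intro ptime_rules plist_inputs)
  have R: "plist D (\<lambda>x. root_trails (in_terminals x))"
    unfolding root_trails_def root_dart_def dart_def
    by (intro ptime_rules plist_inputs ptime_const)
  have H: "ptime UNIV (\<lambda>z. ?h (tree_hd z) (tree_hd (tree_tl z)) (tree_tl (tree_tl z)))"
    by (intro plist_step plist_inputs ptime_rules)
  have "ptime D (\<lambda>x. fold (?h x) (to_list (of_list (in_vs x @ in_vs x))) (of_list (root_trails (in_terminals x))))"
    by (rule ptime_fold_bounded[where h = ?h, OF V R H, of B]) (use assms f in simp)
  then show ?thesis unfolding search_def by (simp add: f)
qed

section \<open>Correctness of the search\<close>

context dart_graph
begin

section \<open>Reading a connecting trail in forward direction\<close>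

fun dwalk :: "'v \<Rightarrow> 'd list \<Rightarrow> 'v \<Rightarrow> bool" where
  "dwalk v [] w \<longleftrightarrow> v = w"
| "dwalk v (d # ds) w \<longleftrightarrow> d \<in> D \<and> src d = v \<and> dwalk (tgt d) ds w"

lemma dwalk_snoc: "dwalk v (ds @ [d]) w \<longleftrightarrow> d \<in> D \<and> dwalk v ds (src d) \<and> tgt d = w"
  by (induction ds arbitrary: v) auto

lemma alt_dwalk:
  "alt W \<Longrightarrow> \<exists>ds p. W = rev ds @ [p] \<and> p \<in> P \<and> dwalk (tgt p) ds (endv W) \<and>
     successively (\<lambda>a b. clr a \<noteq> clr b) ds"
proof (induction W rule: alt.induct)
  case (2 p)
  then show ?case by (intro exI[of _ "[]"]) auto
next
  case (3 d d' T)
  then obtain ds p where ds: "d' # T = rev ds @ [p]" "p \<in> P" "dwalk (tgt p) ds (tgt d')"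
    "successively (\<lambda>a b. clr a \<noteq> clr b) ds" by auto
  have "ds \<noteq> [] \<Longrightarrow> last ds = d'" using ds(1) by (cases ds rule: rev_cases) auto
  then have "successively (\<lambda>a b. clr a \<noteq> clr b) (ds @ [d])"
    using ds(4) 3(2) by (auto simp: successively_append_iff)
  moreover have "dwalk (tgt p) (ds @ [d]) (tgt d)" using ds(3) 3(2) by (simp add: dwalk_snoc)
  moreover have "d # d' # T = rev (ds @ [d]) @ [p]" using ds(1) by simp
  ultimately show ?case using ds(2) by (metis list.sel(1))
qed simp

text \<open>\<open>T'\<close> is unwound down to its loop alone, which leaves an alternating trail
  between two terminals. Its two loops have distinct edge names, so by \<open>P_inj\<close> the
  terminals differ.\<close>

lemma success_dwalk:
  assumes T: "dtrail T" "dtrail T'" and d: "d \<in> D" "usable d T" "usable (rv d) T'"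
    and dist: "distinct (map eid (map rv (rev T') @ d # T))"
  shows "\<exists>ds p p'. map rv (rev T') @ d # T = rv p' # rev ds @ [p] \<and> p \<in> P \<and> p' \<in> P \<and> tgt p \<noteq> tgt p' \<and>
    dwalk (tgt p) ds (tgt p') \<and> successively (\<lambda>a b. clr a \<noteq> clr b) ds \<and> distinct (map eid ds)"
proof -
  have a: "alt T" "alt T'" using T by (auto simp: dtrail_def)
  from alt_dwalk[OF a(2)] obtain ds' p' where p': "T' = rev ds' @ [p']" "p' \<in> P" by blast
  define W where "W = map rv (rev (rev ds')) @ d # T"
  have "alt (d # T)" using alt_nonempty[OF a(1)] a d by (auto simp: alt_Cons usable_def)
  then have W: "alt W \<and> endv W = endv [p']"
    unfolding W_def using alt_unwind[of "d # T" "rev ds'" "[p']"] a p' d by (auto simp: usable_def)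
  from alt_dwalk[of W] W obtain ds p where ds: "W = rev ds @ [p]" "p \<in> P" "dwalk (tgt p) ds (tgt p')"
     "successively (\<lambda>a b. clr a \<noteq> clr b) ds" by auto
  have e: "map rv (rev T') @ d # T = rv p' # rev ds @ [p]" using p'(1) ds(1) by (simp add: W_def)
  have "distinct (eid p' # rev (map eid ds) @ [eid p])" using dist unfolding e by (simp add: rev_map)
  then have "eid p \<noteq> eid p'" "distinct (map eid ds)" by auto
  then show ?thesis using e ds p' P_inj by blast
qed

end

section \<open>The program as a search for trails\<close>

locale search_graph = dart_graph dart_edge dart_src dart_tgt dart_col dart_rev "set E" "set Ps"
  for E Ps :: "tree list" +
  fixes V :: "tree list"
  assumes tgt_V: "d \<in> set E \<Longrightarrow> dart_tgt d \<in> set V" "p \<in> set Ps \<Longrightarrow> dart_tgt p \<in> set V"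
begin

abbreviation trails :: "tree list \<Rightarrow> tree list set" where
  "trails K \<equiv> to_list ` set K"

definition valid :: "tree list \<Rightarrow> bool" where
  "valid K \<longleftrightarrow> (\<exists>base pv en anc.
     forest dart_edge dart_src dart_tgt dart_col dart_rev (set E) (set Ps) (trails K) base pv en anc)"

lemma valid_dtrail:
  assumes "valid K" "T \<in> set K"
  shows "dtrail (to_list T)"
  using assms forest.K_trail unfolding valid_def by blast

lemma valid_nonempty: "valid K \<Longrightarrow> T \<in> set K \<Longrightarrow> T \<noteq> Atom"
  using valid_dtrail[of K T] by (auto simp: dtrail_def)

lemma tree_hd_hd: "T \<noteq> Atom \<Longrightarrow> tree_hd T = hd (to_list T)"
  by (cases T) auto

lemma last_vertex_endv: "T \<noteq> Atom \<Longrightarrow> last_vertex T = endv (to_list T)"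
  by (simp add: last_vertex_def tree_hd_hd)

lemma last_col_hd: "T \<noteq> Atom \<Longrightarrow> last_col T = dart_col (hd (to_list T))"
  by (simp add: last_col_def tree_hd_hd)

lemma reached_list_iff: "valid K \<Longrightarrow> reached_list K v \<longleftrightarrow> v \<in> reached (trails K)"
  unfolding reached_list_def reached_def
  by (auto simp: last_vertex_endv valid_nonempty image_iff cong: bex_cong)

lemma full_list_iff: "valid K \<Longrightarrow> full_list K v \<longleftrightarrow> full (trails K) v"
  unfolding full_list_def full_def
  by (simp add: last_vertex_endv last_col_hd valid_nonempty cong: bex_cong)

lemma usable_tree_iff: "T \<noteq> Atom \<Longrightarrow> usable_tree d T \<longleftrightarrow> usable d (to_list T)"
  unfolding usable_tree_def usable_def eids_def
  by (auto simp: last_vertex_endv last_col_hd) (metis image_eqI)+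

lemma growths_iff:
  assumes "valid K"
  shows "t \<in> set (growths E K) \<longleftrightarrow> (\<exists>d\<in>set E. \<exists>T\<in>set K. t = Pair d T \<and> usable d (to_list T) \<and>
    dart_tgt d \<notin> reached (trails K))"
proof -
  have "t \<in> set (growths E K) \<longleftrightarrow>
      (\<exists>d\<in>set E. \<exists>T\<in>set K. t = Pair d T \<and> usable_tree d T \<and> \<not> reached_list K (dart_tgt d))"
    unfolding growths_def by auto
  then show ?thesis
    by (simp add: usable_tree_iff valid_nonempty[OF assms] reached_list_iff[OF assms] cong: bex_cong)
qed

lemma links_iff:
  assumes "valid K"
  shows "l \<in> set (links E K) \<longleftrightarrow> (\<exists>d\<in>set E. \<exists>T\<in>set K. \<exists>T'\<in>set K. l = Pair d (Pair T T') \<and>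
    usable d (to_list T) \<and> usable (dart_rev d) (to_list T'))"
proof -
  have "l \<in> set (links E K) \<longleftrightarrow> (\<exists>d\<in>set E. \<exists>T\<in>set K. \<exists>T'\<in>set K. l = Pair d (Pair T T') \<and>
      usable_tree d T \<and> usable_tree (dart_rev d) T')"
    unfolding links_def by auto
  then show ?thesis by (simp add: usable_tree_iff valid_nonempty[OF assms] cong: bex_cong)
qed

lemma links_Bex:
  assumes K: "valid K"
  shows "(\<exists>l\<in>set (links E K). R l) \<longleftrightarrow> (\<exists>d\<in>set E. \<exists>T\<in>set K. \<exists>T'\<in>set K. usable d (to_list T) \<and>
    usable (dart_rev d) (to_list T') \<and> R (Pair d (Pair T T')))" (is "?L \<longleftrightarrow> ?R")
proof
  assume ?L
  then obtain l where l: "l \<in> set (links E K)" "R l" by blast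
  from links_iff[OF K, THEN iffD1, OF l(1)] l(2) show ?R by metis
next
  assume ?R
  then obtain d T T' where l: "d \<in> set E" "T \<in> set K" "T' \<in> set K" "usable d (to_list T)"
    "usable (dart_rev d) (to_list T')" "R (Pair d (Pair T T'))" by blast
  have "Pair d (Pair T T') \<in> set (links E K)"
    unfolding links_iff[OF K] using l by metis
  then show ?L using l(6) by (rule bexI[rotated])
qed

lemma unwind_Pair: "unwind Tv (Pair d (Pair T T')) =
    map dart_rev (drop (length (to_list Tv)) (rev (to_list T'))) @ d # to_list T"
  by (simp add: unwind_def)

lemma ends_with_iff: "ends_with T Tv \<longleftrightarrow> (\<exists>Q. to_list T = Q @ to_list Tv)"
proof
  assume "\<exists>Q. to_list T = Q @ to_list Tv"
  then show "ends_with T Tv" unfolding ends_with_def by auto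
next
  assume "ends_with T Tv"
  then show "\<exists>Q. to_list T = Q @ to_list Tv" unfolding ends_with_def by metis
qed

lemma set_unwindings:
  assumes K: "valid K"
  shows "to_list ` set (unwindings K (Pair d (Pair T T'))) = unwinds (trails K) d (to_list T) (to_list T')"
    (is "?L = ?R")
proof
  \<comment> \<open>The end of a stored trail is reached, so here not being full already means being
    inner.\<close>
  have i: "\<not> full_list K (last_vertex Tv) \<longleftrightarrow> endv (to_list Tv) \<in> inner (trails K)" if "Tv \<in> set K" for Tv
    using that full_list_iff[OF K] last_vertex_endv valid_nonempty[OF K that] unfolding inner_def reached_def by auto
  show "?L \<subseteq> ?R"
  proof
    fix U assume "U \<in> ?L"
    then obtain Tv where Tv: "Tv \<in> set K" "ends_with T' Tv" "\<not> full_list K (last_vertex Tv)"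
      "U = map dart_rev (drop (length (to_list Tv)) (rev (to_list T'))) @ d # to_list T" "clean U"
      by (auto simp: unwindings_def unwind_Pair)
    from Tv(2) obtain Q where Q: "to_list T' = Q @ to_list Tv" by (auto simp: ends_with_iff)
    then have "U = map dart_rev (rev Q) @ d # to_list T" using Tv(4) by simp
    then show "U \<in> ?R" unfolding unwinds_def using Q Tv i[OF Tv(1)] by (auto simp: clean_def)
  qed
  show "?R \<subseteq> ?L"
  proof
    fix U assume "U \<in> ?R"
    then obtain Q Tv where Tv: "to_list T' = Q @ to_list Tv" "Tv \<in> set K" "endv (to_list Tv) \<in> inner (trails K)"
      "U = map dart_rev (rev Q) @ d # to_list T" "distinct (map dart_edge U)"
      unfolding unwinds_def by blast
    have U: "U = unwind Tv (Pair d (Pair T T'))" using Tv(1,4) by (simp add: unwind_Pair)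
    have "of_list U \<in> set (unwindings K (Pair d (Pair T T')))"
    proof -
      have "clean (unwind Tv (Pair d (Pair T T')))" using Tv(5) U by (simp add: clean_def)
      moreover have "ends_with T' Tv" using Tv(1) ends_with_iff by blast
      ultimately show ?thesis unfolding unwindings_def U using Tv(2,3) i[OF Tv(2)] by auto
    qed
    then show "U \<in> ?L" by force
  qed
qed

text \<open>A success counts as final even if merges remain, since \<open>answer\<close> can then
  read off the trail.\<close>

definition stuck :: "tree list \<Rightarrow> bool" where
  "stuck K \<longleftrightarrow> growths E K = [] \<and> (successes E K \<noteq> [] \<or> merges E K = [])"

text \<open>A new vertex may become inner, hence the factor \<open>2\<close>.\<close>

definition remaining :: "tree list \<Rightarrow> nat" where
  "remaining K = 2 * card (set V - reached (trails K)) + card (inner (trails K))"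

lemma step_stuck: "stuck K \<Longrightarrow> step V E K = K"
  by (auto simp: stuck_def step_def)

lemma reached_V:
  assumes "valid K"
  shows "reached (trails K) \<subseteq> set V"
proof
  fix v assume "v \<in> reached (trails K)"
  then obtain T where T: "T \<in> set K" "v = endv (to_list T)" by (auto simp: reached_def)
  have a: "alt (to_list T)" using valid_dtrail[OF assms T(1)] by (auto simp: dtrail_def)
  have "hd (to_list T) \<in> set E \<union> set Ps" using alt_ends[OF a] alt_nonempty[OF a] by auto
  then show "v \<in> set V" using T tgt_V by auto
qed

lemma step_grow:
  assumes K: "valid K" and g: "growths E K \<noteq> []"
  shows "valid (step V E K) \<and> remaining (step V E K) < remaining K"
proof -
  obtain t ts where t: "growths E K = t # ts" using g by (cases "growths E K") auto
  then have "t \<in> set (growths E K)" by simp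
  then obtain d T where d: "d \<in> set E" "T \<in> set K" "t = Pair d T" "usable d (to_list T)"
    "dart_tgt d \<notin> reached (trails K)" using growths_iff[OF K] by blast
  have s: "step V E K = Pair d T # K" using t d by (simp add: step_def)
  obtain base pv en anc where "forest dart_edge dart_src dart_tgt dart_col dart_rev (set E) (set Ps) (trails K) base pv en anc"
    using K by (auto simp: valid_def)
  then interpret forest dart_edge dart_src dart_tgt dart_col dart_rev "set E" "set Ps" "trails K" base pv en anc .
  have T: "to_list T \<in> trails K" using d by auto
  note g = grow[OF T d(1,4,5)]
  have K': "trails (step V E K) = insert (d # to_list T) (trails K)" by (simp add: s)
  have "valid (step V E K)" unfolding valid_def K' using g(1) by blast
  moreover have "remaining (step V E K) < remaining K"
  proof -
    have "set V - insert (dart_tgt d) (reached (trails K)) \<subset> set V - reached (trails K)"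
      using d(1,5) tgt_V by auto
    then have "card (set V - insert (dart_tgt d) (reached (trails K))) < card (set V - reached (trails K))"
      by (intro psubset_card_mono) auto
    moreover have "card (insert (dart_tgt d) (inner (trails K))) \<le> Suc (card (inner (trails K)))"
      by (cases "finite (inner (trails K))") (simp_all add: card_insert_if)
    ultimately show ?thesis unfolding remaining_def K' g(2,3) by linarith
  qed
  ultimately show ?thesis ..
qed

lemma successes_iff:
  assumes "valid K"
  shows "successes E K \<noteq> [] \<longleftrightarrow> (\<exists>d\<in>set E. \<exists>T\<in>trails K. \<exists>T'\<in>trails K. usable d T \<and> usable (dart_rev d) T' \<and>
    distinct (map dart_edge (map dart_rev (rev T') @ d # T)))"
proof -
  have "successes E K \<noteq> [] \<longleftrightarrow> (\<exists>l\<in>set (links E K). clean (unwind Atom l))"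
    by (auto simp: successes_def filter_empty_conv)
  also have "\<dots> \<longleftrightarrow> (\<exists>d\<in>set E. \<exists>T\<in>set K. \<exists>T'\<in>set K. usable d (to_list T) \<and>
      usable (dart_rev d) (to_list T') \<and> clean (unwind Atom (Pair d (Pair T T'))))"
    by (rule links_Bex[OF assms])
  finally show ?thesis by (simp add: unwind_Pair clean_def)
qed

lemma merges_iff:
  assumes "valid K"
  shows "merges E K \<noteq> [] \<longleftrightarrow> (\<exists>d\<in>set E. \<exists>T\<in>trails K. \<exists>T'\<in>trails K. usable d T \<and> usable (dart_rev d) T' \<and>
    unwinds (trails K) d T T' \<noteq> {})"
proof -
  have "unwindings K (Pair d (Pair T T')) \<noteq> [] \<longleftrightarrow> unwinds (trails K) d (to_list T) (to_list T') \<noteq> {}" for d T T'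
    using set_unwindings[OF assms, of d T T'] by (metis image_is_empty set_empty)
  note u = this
  have "merges E K \<noteq> [] \<longleftrightarrow> (\<exists>l\<in>set (links E K). unwindings K l \<noteq> [])"
    by (auto simp: merges_def filter_empty_conv)
  also have "\<dots> \<longleftrightarrow> (\<exists>d\<in>set E. \<exists>T\<in>set K. \<exists>T'\<in>set K. usable d (to_list T) \<and>
      usable (dart_rev d) (to_list T') \<and> unwindings K (Pair d (Pair T T')) \<noteq> [])"
    by (rule links_Bex[OF assms])
  finally show ?thesis by (simp add: u)
qed

lemma growths_empty_iff:
  assumes "valid K"
  shows "growths E K = [] \<longleftrightarrow> (\<forall>d\<in>set E. \<forall>T\<in>trails K. usable d T \<longrightarrow> dart_tgt d \<in> reached (trails K))"
  using growths_iff[OF assms] by (metis (no_types, lifting) ex_in_conv image_iff set_empty)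

lemma stuck_stable:
  assumes "valid K" "stuck K" "successes E K = []"
  shows "stable (trails K)"
proof -
  have g: "growths E K = []" and m: "merges E K = []" using assms by (auto simp: stuck_def)
  show ?thesis
    unfolding stable_def
    using growths_empty_iff[OF assms(1)] g merges_iff[OF assms(1)] m successes_iff[OF assms(1)] assms(3) by blast
qed

lemma step_merge:
  assumes K: "valid K" and g: "growths E K = []" and su: "successes E K = []" and m: "merges E K \<noteq> []"
  shows "valid (step V E K) \<and> remaining (step V E K) < remaining K"
proof -
  obtain l ls where l: "merges E K = l # ls" using m by (cases "merges E K") auto
  then have "l \<in> set (merges E K)" by simp
  then have "l \<in> set (links E K)" and ul: "unwindings K l \<noteq> []" by (auto simp: merges_def)
  then obtain d T T' where d: "d \<in> set E" "T \<in> set K" "T' \<in> set K" "l = Pair d (Pair T T')"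
    "usable d (to_list T)" "usable (dart_rev d) (to_list T')" using links_iff[OF K] by blast
  have s: "step V E K = new_trails V K l @ K" using g su l by (simp add: step_def)
  obtain base pv en anc where "forest dart_edge dart_src dart_tgt dart_col dart_rev (set E) (set Ps) (trails K) base pv en anc"
    using K by (auto simp: valid_def)
  then interpret forest dart_edge dart_src dart_tgt dart_col dart_rev "set E" "set Ps" "trails K" base pv en anc .
  let ?T = "to_list T" and ?T' = "to_list T'"
  define C where "C = unwinds (trails K) d ?T ?T' \<union> unwinds (trails K) (dart_rev d) ?T' ?T"
  define N where "N = to_list ` set (new_trails V K l)"
  have Cs: "to_list ` set (unwindings K l @ unwindings K (flip l)) = C"
    using set_unwindings[OF K, of d T T'] set_unwindings[OF K, of "dart_rev d" T' T]
    by (simp add: C_def d(4) flip_def image_Un)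
  have ne: "U \<noteq> Atom" if "U \<in> set (unwindings K l @ unwindings K (flip l))" for U
  proof -
    have "to_list U \<in> C" using that Cs by blast
    then have "to_list U \<noteq> []" unfolding C_def unwinds_def by auto
    then show ?thesis by auto
  qed
  have "set (new_trails V K l) \<subseteq> set (unwindings K l @ unwindings K (flip l))"
  proof
    fix U assume "U \<in> set (new_trails V K l)"
    then obtain v where "U \<in> set (take 1 (filter (\<lambda>U. last_vertex U = v) (unwindings K l @ unwindings K (flip l))))"
      unfolding new_trails_def set_concat set_map by blast
    from in_set_takeD[OF this] show "U \<in> set (unwindings K l @ unwindings K (flip l))"
      unfolding set_filter by blast
  qed
  then have NC: "N \<subseteq> C" unfolding N_def Cs[symmetric] by blast
  have T_in: "?T \<in> trails K" "?T' \<in> trails K" using d by auto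
  have meet: "\<not> distinct (map dart_edge (map dart_rev (rev ?T') @ d # ?T))"
    using su successes_iff[OF K] d T_in by blast
  \<comment> \<open>Unwindings end at inner vertices, hence in \<open>V\<close>. So
    \<open>new_trails\<close>, which runs through \<open>V\<close>, misses no end vertex.\<close>
  have C_inner: "endv U \<in> inner (trails K)" if "U \<in> C" for U
  proof -
    have aT: "alt ?T" "alt ?T'" using valid_dtrail[OF K] d by (auto simp: dtrail_def)
    have aux: "endv U \<in> inner (trails K)"
      if U: "U \<in> unwinds (trails K) e R R'" and e: "e \<in> set E" "usable e R" "usable (dart_rev e) R'" "alt R" "alt R'" for e R R'
    proof -
      obtain Q Tv where Q: "R' = Q @ Tv" "Tv \<in> trails K" "endv Tv \<in> inner (trails K)" "U = map dart_rev (rev Q) @ e # R"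
        using U by (auto simp: unwinds_def)
      have "alt (e # R)" using alt_nonempty[OF e(4)] e by (auto simp: alt_Cons usable_def)
      moreover have "Tv \<noteq> []" using K_trail[OF Q(2)] by (auto simp: dtrail_def)
      ultimately show ?thesis using alt_unwind[of "e # R" Q Tv] Q e by (auto simp: usable_def)
    qed
    have "dart_rev d \<in> set E" "usable (dart_rev (dart_rev d)) ?T" using d D_rv by (auto simp: usable_def)
    then show ?thesis using that aux[of d ?T ?T'] aux[of "dart_rev d" ?T' ?T] d aT unfolding C_def by blast
  qed
  have NE: "\<exists>U'\<in>N. endv U' = endv U" if U: "U \<in> C" for U
  proof -
    obtain Ut where Ut: "Ut \<in> set (unwindings K l @ unwindings K (flip l))" "U = to_list Ut" using U Cs by blast
    define v where "v = endv U"
    have vV: "v \<in> set V" using C_inner[OF U] reached_V[OF K] by (auto simp: v_def inner_def)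
    let ?F = "filter (\<lambda>U. last_vertex U = v) (unwindings K l @ unwindings K (flip l))"
    have "Ut \<in> set ?F" using Ut last_vertex_endv[OF ne[OF Ut(1)]] by (auto simp: v_def)
    then have "?F \<noteq> []" by (metis empty_iff list.set(1))
    then obtain U' us where F: "?F = U' # us" by (meson neq_Nil_conv)
    then have U': "U' \<in> set ?F" by simp
    have "U' \<in> set (new_trails V K l)"
    proof -
      have "U' \<in> set (take 1 ?F)" unfolding F by simp
      then show ?thesis unfolding new_trails_def set_concat set_map using vV by blast
    qed
    moreover have "endv (to_list U') = v" using U' last_vertex_endv ne by auto
    ultimately show ?thesis unfolding N_def v_def by blast
  qed
  have "C \<noteq> {}" using ul Cs by auto
  then have Nne: "N \<noteq> {}" using NE by blast
  note mg = merge[OF d(1,5,6) T_in meet NC[unfolded C_def] Nne NE[unfolded C_def]]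
  have K': "trails (step V E K) = trails K \<union> N" by (auto simp: s N_def)
  have "valid (step V E K)" unfolding valid_def K' using mg(1) by blast
  moreover have "remaining (step V E K) < remaining K"
  proof -
    have "finite (inner (trails K))" using finite_reached unfolding inner_def by auto
    then have "card (inner (trails K \<union> N)) < card (inner (trails K))" using mg(3) psubset_card_mono by blast
    moreover have "reached (trails (step V E K)) = reached (trails K)"
      "inner (trails (step V E K)) = inner (trails K \<union> N)"
      unfolding K' using mg(2) by simp_all
    ultimately show ?thesis unfolding remaining_def by (simp only:)
  qed
  ultimately show ?thesis ..
qed

lemma step_progress:
  assumes "valid K" "\<not> stuck K"
  shows "valid (step V E K) \<and> remaining (step V E K) < remaining K"
  using step_grow[OF assms(1)] step_merge[OF assms(1)] assms(2) unfolding stuck_def by blast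

lemma valid_step: "valid K \<Longrightarrow> valid (step V E K)"
  using step_progress step_stuck by metis

lemma valid_fold: "valid K \<Longrightarrow> valid (fold (\<lambda>_. step V E) xs K)"
  by (induction xs arbitrary: K) (auto simp: valid_step)

text \<open>Stuck sets are fixed points of \<open>step\<close>, so it suffices that every other
  round lowers \<open>remaining\<close>.\<close>

lemma fold_stuck: "valid K \<Longrightarrow> remaining K \<le> length xs \<Longrightarrow> stuck (fold (\<lambda>_. step V E) xs K)"
proof (induction xs arbitrary: K)
  case Nil
  then show ?case using step_progress[of K] by fastforce
next
  case (Cons x xs)
  show ?case
  proof (cases "stuck K")
    case True
    have "fold (\<lambda>_. step V E) (x # xs) K = K" by (induction xs) (auto simp: step_stuck[OF True])
    then show ?thesis using True by simp
  next
    case False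
    then show ?thesis using step_progress[OF Cons.prems(1) False] Cons by simp
  qed
qed

lemma initial_valid:
  assumes "trails K = (\<lambda>p. [p]) ` set Ps"
  shows "valid K" "remaining K \<le> 2 * length V"
proof -
  show "valid K" using initial_forest(1) unfolding valid_def assms by blast
  have "card (set V - reached (trails K)) \<le> length V"
    by (meson card_length card_mono Diff_subset finite_set le_trans)
  then show "remaining K \<le> 2 * length V"
    using initial_forest(2) unfolding remaining_def assms by simp
qed

section \<open>Number and size of the stored trails\<close>

lemma length_step: "length (step V E K) \<le> length K + length V + 1"
proof -
  have "length (new_trails V K l) \<le> length V" for l
    unfolding new_trails_def by (induction V) (auto intro: le_SucI add_le_mono simp: min_def)
  then show ?thesis unfolding step_def by (auto simp: min_def intro: add_mono le_SucI)
qed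

lemma length_fold: "length (fold (\<lambda>_. step V E) xs K) \<le> length K + length xs * (length V + 1)"
proof (induction xs arbitrary: K)
  case (Cons x xs)
  have "length (fold (\<lambda>_. step V E) xs (step V E K)) \<le> length (step V E K) + length xs * (length V + 1)" by (rule Cons)
  then show ?case using length_step[of K] by simp
qed simp

lemma length_trail:
  assumes "dtrail T"
  shows "length T \<le> length E + length Ps"
proof -
  have "distinct T" using assms by (auto simp: dtrail_def distinct_map)
  then have "length T = card (set T)" by (simp add: distinct_card)
  also have "\<dots> \<le> card (set E \<union> set Ps)"
    using alt_ends assms by (intro card_mono) (auto simp: dtrail_def)
  also have "\<dots> \<le> length E + length Ps"
    by (meson add_mono card_Un_le card_length order_trans)
  finally show ?thesis .
qed

lemma size_valid:
  assumes K: "valid K" and dl: "\<And>d. d \<in> set E \<union> set Ps \<Longrightarrow> size d \<le> M"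
  shows "size (of_list K) \<le> length K * ((length E + length Ps) * (M + 1) + 1)"
proof -
  have el: "size T \<le> (length E + length Ps) * (M + 1)" if "T \<in> set K" for T
  proof -
    have t: "dtrail (to_list T)" using valid_dtrail K that by blast
    have "size d \<le> M" if "d \<in> set (to_list T)" for d
      using alt_ends[of "to_list T" d] t that dl by (auto simp: dtrail_def)
    then have "sum_list (map size (to_list T)) \<le> length (to_list T) * M"
      using sum_list_mono[of "to_list T" size "\<lambda>_. M"] by (simp add: sum_list_triv)
    then have "size T \<le> length (to_list T) * (M + 1)" using size_to_list[of T] by simp
    also have "\<dots> \<le> (length E + length Ps) * (M + 1)" using length_trail[OF t] by (rule mult_le_mono1)
    finally show ?thesis .
  qed
  have "sum_list (map size K) \<le> length K * ((length E + length Ps) * (M + 1))"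
    using sum_list_mono[of K size "\<lambda>_. (length E + length Ps) * (M + 1)"] el by (simp add: sum_list_triv)
  then show ?thesis by (simp add: size_of_list)
qed

end

section \<open>Encoded instances\<close>

lemma enc_nat_inj: "enc_nat m = enc_nat n \<longleftrightarrow> m = n"
proof
  show "enc_nat m = enc_nat n \<Longrightarrow> m = n"
  proof (induction m arbitrary: n rule: less_induct)
    case (less m)
    show ?case
    proof (cases "m = 0 \<or> n = 0")
      case True
      then show ?thesis using less.prems by (auto simp: enc_nat.simps[of m] enc_nat.simps[of n] split: if_splits)
    next
      case False
      then have "even m = even n" "enc_nat (m div 2) = enc_nat (n div 2)"
        using less.prems by (auto simp: enc_nat.simps[of m] enc_nat.simps[of n] split: if_splits)
      moreover have "m div 2 < m" using False by simp
      ultimately have "m div 2 = n div 2" "m mod 2 = n mod 2" using less.IH by (blast, simp add: mod2_eq_if)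
      then show ?thesis by (metis div_mult_mod_eq)
    qed
  qed
qed simp

lemma enc_nat_neq_root: "enc_nat n \<noteq> Pair (Pair tt Atom) s"
  by (subst enc_nat.simps) auto

locale coloured_instance =
  fixes G :: "(nat, nat) multigraph" and C :: "nat set" and col :: "nat \<Rightarrow> nat" and S :: "nat set"
    and vs :: "nat list" and es :: "(nat \<times> nat \<times> nat) list" and ss :: "nat list"
  assumes fin: "finite_multigraph G" and col: "col ` edges G \<subseteq> C" and S: "S \<subseteq> verts G"
    and lists: "lists_instance G S vs es ss"
begin

definition encoding :: tree where "encoding = enc_instance col vs es ss"

definition edge_dart :: "nat \<Rightarrow> nat \<Rightarrow> nat \<Rightarrow> tree" where
  "edge_dart e u v = dart (enc_nat e) (enc_nat u) (enc_nat v) (enc_nat (col e))"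

definition roots :: "tree list" where
  "roots = concat (map (\<lambda>s. [root_dart Atom (enc_nat s), root_dart tt (enc_nat s)]) ss)"

lemma dart_simps [simp]: "dart_edge (dart e u v c) = e" "dart_src (dart e u v c) = u"
  "dart_tgt (dart e u v c) = v" "dart_col (dart e u v c) = c" "dart_rev (dart e u v c) = dart e v u c"
  by (simp_all add: dart_def dart_edge_def dart_src_def dart_tgt_def dart_col_def dart_rev_def)

lemma dart_rev_simps: "dart_edge (dart_rev d) = dart_edge d" "dart_src (dart_rev d) = dart_tgt d"
  "dart_tgt (dart_rev d) = dart_src d" "dart_col (dart_rev d) = dart_col d"
  by (simp_all add: dart_rev_def)

lemma inputs:
  "in_vs encoding = map enc_nat vs"
  "in_darts encoding = all_darts (map (\<lambda>(e, u, v). edge_dart e u v) es)"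
  "in_terminals encoding = map enc_nat ss"
proof -
  have e: "enc_list enc_nat [e, u, v, col e] = edge_dart e u v" for e u v
    by (simp add: edge_dart_def dart_def)
  have *: "(\<lambda>(e, u, v). enc_list enc_nat [e, u, v, col e]) = (\<lambda>(e, u, v). edge_dart e u v)"
    unfolding e ..
  show "in_vs encoding = map enc_nat vs"
    "in_darts encoding = all_darts (map (\<lambda>(e, u, v). edge_dart e u v) es)"
    "in_terminals encoding = map enc_nat ss"
    unfolding in_vs_def in_darts_def in_terminals_def encoding_def enc_instance_def *
    by (simp_all add: enc_list_map[of enc_nat] enc_list_map[of "\<lambda>(e, u, v). edge_dart e u v"])
qed

text \<open>\<open>es\<close> may list the two ends of an edge in either order. Since every entry is
  accompanied by its reverse, the set of darts depends on \<open>G\<close> and \<open>col\<close>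
  only.\<close>

lemma dart_iff: "d \<in> set (in_darts encoding) \<longleftrightarrow>
  (\<exists>e u v. e \<in> edges G \<and> ends G e = {u, v} \<and> d = edge_dart e u v)"
proof -
  have es: "\<forall>(e, u, v)\<in>set es. ends G e = {u, v}" "fst ` set es = edges G"
    using lists by (simp_all add: lists_instance_def)
  have 1: "e \<in> edges G \<and> ends G e = {u, v}" if "(e, u, v) \<in> set es" for e u v
  proof
    have "fst (e, u, v) \<in> fst ` set es" using that by (rule imageI)
    then show "e \<in> edges G" using es(2) by simp
    show "ends G e = {u, v}" using es(1) that by blast
  qed
  have 2: "\<exists>u' v'. (e, u', v') \<in> set es \<and> {u', v'} = {u, v}" if "e \<in> edges G" "ends G e = {u, v}" for e u v
  proof -
    have "e \<in> fst ` set es" using es(2) that by simp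
    then obtain u' v' where "(e, u', v') \<in> set es" by auto
    then show ?thesis using 1 that by blast
  qed
  have 3: "dart_rev (edge_dart e u v) = edge_dart e v u" for e u v by (simp add: edge_dart_def)
  have "d \<in> set (in_darts encoding) \<longleftrightarrow> (\<exists>e u v. (e, u, v) \<in> set es \<and> (d = edge_dart e u v \<or> d = edge_dart e v u))"
    unfolding inputs all_darts_def by (force simp: 3 image_iff)
  also have "\<dots> \<longleftrightarrow> (\<exists>e u v. e \<in> edges G \<and> ends G e = {u, v} \<and> d = edge_dart e u v)"
  proof
    assume "\<exists>e u v. (e, u, v) \<in> set es \<and> (d = edge_dart e u v \<or> d = edge_dart e v u)"
    then show "\<exists>e u v. e \<in> edges G \<and> ends G e = {u, v} \<and> d = edge_dart e u v"
      using 1 by (metis insert_commute)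
  next
    assume "\<exists>e u v. e \<in> edges G \<and> ends G e = {u, v} \<and> d = edge_dart e u v"
    then show "\<exists>e u v. (e, u, v) \<in> set es \<and> (d = edge_dart e u v \<or> d = edge_dart e v u)"
      using 2 by (metis doubleton_eq_iff)
  qed
  finally show ?thesis .
qed

lemma root_iff: "p \<in> set roots \<longleftrightarrow> (\<exists>s\<in>S. \<exists>c\<in>{Atom, tt}. p = root_dart c (enc_nat s))"
  using lists unfolding roots_def lists_instance_def by auto

sublocale search_graph "in_darts encoding" roots "in_vs encoding"
proof
  fix d
  show "dart_edge (dart_rev d) = dart_edge d" "dart_src (dart_rev d) = dart_tgt d"
    "dart_tgt (dart_rev d) = dart_src d" "dart_col (dart_rev d) = dart_col d"
    by (simp_all add: dart_rev_simps)
next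
  fix d assume "d \<in> set (in_darts encoding)"
  then obtain e u v where d: "e \<in> edges G" "ends G e = {u, v}" "d = edge_dart e u v" by (auto simp: dart_iff)
  have "dart_rev d = edge_dart e v u" by (simp add: d edge_dart_def)
  then show "dart_rev d \<in> set (in_darts encoding)" using d unfolding dart_iff by (metis insert_commute)
  have "card {u, v} = 2" "{u, v} \<subseteq> verts G" using fin d unfolding finite_multigraph_def by metis+
  then show "dart_src d \<noteq> dart_tgt d" "dart_tgt d \<in> set (in_vs encoding)"
    using lists by (auto simp: d edge_dart_def enc_nat_inj inputs lists_instance_def card_insert_if split: if_splits)
next
  fix d d' assume dd: "d \<in> set (in_darts encoding)" "d' \<in> set (in_darts encoding)" "dart_edge d = dart_edge d'"
  obtain e u v where d: "e \<in> edges G" "ends G e = {u, v}" "d = edge_dart e u v" using dd by (auto simp: dart_iff)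
  obtain e' u' v' where d': "e' \<in> edges G" "ends G e' = {u', v'}" "d' = edge_dart e' u' v'" using dd by (auto simp: dart_iff)
  have "e = e'" using dd(3) d d' by (simp add: edge_dart_def enc_nat_inj)
  then show "dart_col d = dart_col d' \<and> (dart_src d = dart_src d' \<and> dart_tgt d = dart_tgt d' \<or>
      dart_src d = dart_tgt d' \<and> dart_tgt d = dart_src d')"
    using d d' by (auto simp: edge_dart_def doubleton_eq_iff)
next
  fix p assume p: "p \<in> set roots"
  then obtain s c where s: "s \<in> S" "c \<in> {Atom, tt}" "p = root_dart c (enc_nat s)" by (auto simp: root_iff)
  show "dart_tgt p \<in> set (in_vs encoding)"
    using s S lists by (auto simp: root_dart_def inputs lists_instance_def)
  show "\<exists>p'\<in>set roots. dart_tgt p' = dart_tgt p \<and> dart_col p' \<noteq> dart_col p"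
    using s by (intro bexI[of _ "root_dart (if c = Atom then tt else Atom) (enc_nat s)"])
      (auto simp: root_dart_def root_iff)
  fix d assume "d \<in> set (in_darts encoding)"
  then show "dart_edge p \<noteq> dart_edge d"
    using s enc_nat_neq_root by (auto simp: dart_iff edge_dart_def root_dart_def dest: sym)
next
  fix p p' assume "p \<in> set roots" "p' \<in> set roots"
  then show "dart_edge p = dart_edge p' \<longleftrightarrow> dart_tgt p = dart_tgt p'"
    by (auto simp: root_iff root_dart_def)
qed auto

lemma trails_root: "trails (root_trails (in_terminals encoding)) = (\<lambda>p. [p]) ` set roots"
  unfolding root_trails_def inputs roots_def by (auto simp: image_iff)

lemma search_valid: "valid (search encoding)" and search_stuck: "stuck (search encoding)"
proof -
  note v = initial_valid[OF trails_root]
  show "valid (search encoding)" unfolding search_def by (rule valid_fold[OF v(1)])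
  have "length (in_vs encoding @ in_vs encoding) = 2 * length (in_vs encoding)" by simp
  then show "stuck (search encoding)"
    unfolding search_def using v(2) by (intro fold_stuck[OF v(1)]) (simp only:)
qed

text \<open>The equations between mapped lists later transfer distinctness, alternation and the
  output format to \<open>p\<close>.\<close>

lemma dwalk_decode:
  assumes "dwalk (enc_nat v) ds w'" "v \<in> verts G"
  shows "\<exists>p w. w' = enc_nat w \<and> walk G v p w \<and> map dart_edge ds = map (\<lambda>d. enc_nat (fst d)) p \<and>
    map dart_col ds = map (\<lambda>d. enc_nat (col (fst d))) p \<and>
    map (\<lambda>d. Pair (dart_edge d) (dart_tgt d)) ds = map (\<lambda>(e, w). Pair (enc_nat e) (enc_nat w)) p"
  using assms
proof (induction ds arbitrary: v)
  case Nil
  then show ?case by (intro exI[of _ "[]"]) auto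
next
  case (Cons d ds)
  then obtain e u y where d: "e \<in> edges G" "ends G e = {u, y}" "d = edge_dart e u y" by (auto simp: dart_iff)
  have u: "u = v" using Cons.prems d by (simp add: edge_dart_def enc_nat_inj)
  have "y \<in> verts G" using fin d unfolding finite_multigraph_def by blast
  moreover have "dwalk (enc_nat y) ds w'" using Cons.prems d by (simp add: edge_dart_def)
  ultimately obtain p w where p: "w' = enc_nat w" "walk G y p w" "map dart_edge ds = map (\<lambda>d. enc_nat (fst d)) p"
    "map dart_col ds = map (\<lambda>d. enc_nat (col (fst d))) p"
    "map (\<lambda>d. Pair (dart_edge d) (dart_tgt d)) ds = map (\<lambda>(e, w). Pair (enc_nat e) (enc_nat w)) p"
    using Cons.IH by blast
  show ?case
    by (rule exI[of _ "(e, y) # p"], rule exI[of _ w]) (use p d u in \<open>auto simp: edge_dart_def\<close>)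
qed

lemma trail_answer:
  assumes su: "successes (in_darts encoding) (search encoding) \<noteq> []"
  shows "\<exists>s\<in>S. \<exists>t\<in>S. \<exists>p. s \<noteq> t \<and> trail G s p t \<and> alternating col p \<and>
    answer encoding (search encoding) = enc_trail s p"
proof -
  let ?K = "search encoding"
  obtain l ls where l: "successes (in_darts encoding) ?K = l # ls"
    using su by (cases "successes (in_darts encoding) ?K") auto
  then have "l \<in> set (successes (in_darts encoding) ?K)" by simp
  then have "l \<in> set (links (in_darts encoding) ?K)" and cl: "clean (unwind Atom l)" by (auto simp: successes_def)
  then obtain d T T' where d: "d \<in> set (in_darts encoding)" "T \<in> set ?K" "T' \<in> set ?K"
    "l = Pair d (Pair T T')" "usable d (to_list T)" "usable (dart_rev d) (to_list T')"
    using links_iff[OF search_valid] by blast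
  have U: "unwind Atom l = map dart_rev (rev (to_list T')) @ d # to_list T" by (simp add: d(4) unwind_Pair)
  obtain ds q q' where ds: "unwind Atom l = dart_rev q' # rev ds @ [q]" "q \<in> set roots" "q' \<in> set roots"
    "dart_tgt q \<noteq> dart_tgt q'" "dwalk (dart_tgt q) ds (dart_tgt q')"
    "successively (\<lambda>a b. dart_col a \<noteq> dart_col b) ds" "distinct (map dart_edge ds)"
    using success_dwalk[OF valid_dtrail[OF search_valid d(2)] valid_dtrail[OF search_valid d(3)] d(1,5,6)] cl
    unfolding U clean_def by blast
  obtain s where s: "s \<in> S" "dart_tgt q = enc_nat s" using ds(2) by (auto simp: root_iff root_dart_def)
  obtain t where t: "t \<in> S" "dart_tgt q' = enc_nat t" using ds(3) by (auto simp: root_iff root_dart_def)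
  have st: "s \<noteq> t" using ds(4) s t by auto
  obtain p w where p: "enc_nat t = enc_nat w" "walk G s p w" "map dart_edge ds = map (\<lambda>d. enc_nat (fst d)) p"
    "map dart_col ds = map (\<lambda>d. enc_nat (col (fst d))) p"
    "map (\<lambda>d. Pair (dart_edge d) (dart_tgt d)) ds = map (\<lambda>(e, w). Pair (enc_nat e) (enc_nat w)) p"
    using dwalk_decode[of s ds "enc_nat t"] ds(5) s t S by auto
  have wt: "walk G s p t" using p(1,2) by (simp add: enc_nat_inj)
  have dp: "distinct (map fst p)"
    using ds(7) unfolding p(3) by (auto simp: distinct_map inj_on_def)
  have len: "length ds = length p" using p(3) by (metis length_map)
  have cj: "dart_col (ds ! j) = enc_nat (col (fst (p ! j)))" if "j < length p" for j
    using arg_cong[OF p(4), of "\<lambda>xs. xs ! j"] that len by simp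
  have al: "alternating col p"
    unfolding alternating_def
  proof (intro allI impI)
    fix j assume j: "Suc j < length p"
    then have "dart_col (ds ! j) \<noteq> dart_col (ds ! Suc j)"
      using ds(6) len unfolding successively_conv_nth by auto
    then show "col (fst (p ! j)) \<noteq> col (fst (p ! Suc j))" using cj[of j] cj[of "Suc j"] j by auto
  qed
  have "answer encoding ?K = trail_output l" using l by (simp add: answer_def)
  also have "\<dots> = Pair Atom (Pair (dart_tgt q) (of_list (map (\<lambda>d. Pair (dart_edge d) (dart_tgt d)) ds)))"
    unfolding trail_output_def Let_def ds(1) by simp
  also have "\<dots> = enc_trail s p"
    unfolding p(5) by (simp add: enc_trail_def s(2) enc_list_map[of "\<lambda>(e, w). Pair (enc_nat e) (enc_nat w)"])
  finally show ?thesis using s t st wt dp al unfolding trail_def by blast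
qed

text \<open>A component of \<open>G - A\<close> is entirely reached or entirely unreached, and
  \<open>cls\<close> is constant on it if it is reached. A terminal is its own label, which
  separates terminals. A mismatched edge is determined by the label of its end outside
  \<open>A\<close>, and that label is no terminal. Conditions (a) and (b) follow.\<close>

lemma tutte_answer:
  assumes su: "successes (in_darts encoding) (search encoding) = []"
  shows "\<exists>xs. tutte_set G col C S (set xs) \<and> answer encoding (search encoding) = enc_vertex_set xs"
proof -
  define K where "K = search encoding"
  have K: "valid K" using search_valid by (simp add: K_def)
  have "stable (trails K)" using stuck_stable search_valid search_stuck su by (auto simp: K_def)
  then obtain cls ent where cert: "certificate (trails K) cls ent"
    using stable_certificate K unfolding valid_def by blast
  define xs where "xs = filter (\<lambda>v. reached_list K (enc_nat v) \<and> \<not> full_list K (enc_nat v)) vs"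
  define A where "A = {v \<in> verts G. enc_nat v \<in> inner (trails K)}"
  define R where "R = {v. enc_nat v \<in> reached (trails K)}"
  have sv: "set vs = verts G" using lists by (auto simp: lists_instance_def)
  have xsA: "set xs = A"
    unfolding xs_def A_def using reached_list_iff[OF K] full_list_iff[OF K] sv by (auto simp: inner_def)
  have "answer encoding K = enc_vertex_set xs"
    using su by (simp add: answer_def K_def enc_vertex_set_def xs_def inputs filter_map comp_def enc_list_map[of enc_nat])
  moreover have "tutte_set G col C S A"
  proof -
    define B where "B = (\<lambda>c. {v \<in> A. \<exists>T\<in>trails K. endv T = enc_nat v \<and> dart_col (hd T) = enc_nat c})"
    have cD: "hd T \<in> set (in_darts encoding)" if "T \<in> trails K" "endv T \<in> inner (trails K)" for T
      using cert that unfolding certificate_def by blast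
    have cP: "enc_nat s \<in> reached (trails K) \<and> enc_nat s \<notin> inner (trails K) \<and> cls (enc_nat s) = enc_nat s"
      if "s \<in> S" for s
    proof -
      have r: "root_dart Atom (enc_nat s) \<in> set roots" using that by (auto simp: root_iff)
      have "dart_tgt (root_dart Atom (enc_nat s)) = enc_nat s" by (simp add: root_dart_def)
      then show ?thesis using cert r unfolding certificate_def by metis
    qed
    have tgtP: "dart_tgt ` set roots = enc_nat ` S"
      by (force simp: root_iff root_dart_def image_iff)
    have dE: "edge_dart e u v \<in> set (in_darts encoding)" if "e \<in> edges G" "ends G e = {u, v}" for e u v
      using that by (auto simp: dart_iff)
    have uniq: "dart_col (hd T) = dart_col (hd T')"
      if "T \<in> trails K" "T' \<in> trails K" "endv T = enc_nat v" "endv T' = enc_nat v" "v \<in> A" for T T' v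
      using that unfolding A_def inner_def full_def by blast
    have outer: "u \<in> R \<longrightarrow> v \<in> R \<and> cls (enc_nat u) = cls (enc_nat v)"
      if "e \<in> edges G" "ends G e = {u, v}" "u \<notin> A" "v \<notin> A" for e u v
    proof -
      have "u \<in> verts G" "v \<in> verts G" using fin that unfolding finite_multigraph_def by blast+
      then show ?thesis
        using cert dE[OF that(1,2)] that(3,4) unfolding certificate_def A_def R_def
        by (fastforce simp: edge_dart_def)
    qed
    \<comment> \<open>An edge at \<open>u\<close> whose colour is not that of \<open>u\<close> could
      prolong the trail to \<open>u\<close>. These are the edges at inner vertices about which
      \<open>certificate\<close> speaks.\<close>
    have mixed: "(v \<notin> A \<longrightarrow> v \<in> R \<and> cls (enc_nat v) \<notin> enc_nat ` S \<and> enc_nat e = ent (cls (enc_nat v))) \<and>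
        (v \<in> A \<longrightarrow> v \<in> B d \<longrightarrow> col e = d)"
      if e: "e \<in> edges G" "ends G e = {u, v}" and u: "u \<in> B c" and ne: "col e \<noteq> c" for e u v c d
    proof -
      have vG: "v \<in> verts G" using fin e unfolding finite_multigraph_def by blast
      obtain T where T: "T \<in> trails K" "endv T = enc_nat u" "dart_col (hd T) = enc_nat c" "u \<in> A"
        using u by (auto simp: B_def)
      define f where "f = edge_dart e u v"
      have f: "f \<in> set (in_darts encoding)" "dart_src f = enc_nat u" "dart_tgt f = enc_nat v"
        "dart_col f = enc_nat (col e)" "dart_edge f = enc_nat e"
        using dE[OF e] by (simp_all add: f_def edge_dart_def)
      have "\<exists>T\<in>trails K. endv T = dart_src f \<and> dart_col (hd T) \<noteq> dart_col f"
        using T f ne by (auto simp: enc_nat_inj)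
      moreover have "dart_src f \<in> inner (trails K)" using T f by (auto simp: A_def)
      ultimately have c: "(dart_tgt f \<notin> inner (trails K) \<longrightarrow> dart_tgt f \<in> reached (trails K) \<and>
          cls (dart_tgt f) \<notin> dart_tgt ` set roots \<and> dart_edge f = ent (cls (dart_tgt f))) \<and>
        (dart_tgt f \<in> inner (trails K) \<longrightarrow> (\<forall>T\<in>trails K. endv T = dart_tgt f \<longrightarrow> dart_col (hd T) = dart_col f))"
        using cert f(1) unfolding certificate_def by blast
      show ?thesis
      proof (intro conjI impI)
        assume "v \<notin> A"
        then have "dart_tgt f \<notin> inner (trails K)" using vG f by (auto simp: A_def)
        then show "v \<in> R" "cls (enc_nat v) \<notin> enc_nat ` S" "enc_nat e = ent (cls (enc_nat v))"
          using c f unfolding R_def tgtP by auto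
      next
        assume v: "v \<in> A" "v \<in> B d"
        then have "dart_tgt f \<in> inner (trails K)" using f by (auto simp: A_def)
        moreover obtain T' where "T' \<in> trails K" "endv T' = enc_nat v" "dart_col (hd T') = enc_nat d"
          using v by (auto simp: B_def)
        ultimately show "col e = d" using c f by (auto simp: enc_nat_inj)
      qed
    qed
    \<comment> \<open>By the second half of \<open>mixed\<close>, an edge with both ends in
      \<open>A\<close> matches one of them, so a mismatched edge always has an end outside
      \<open>A\<close>.\<close>
    have mism: "\<exists>u v. u \<in> A \<and> v \<in> verts G \<and> v \<notin> A \<and> ends G e = {u, v} \<and> v \<in> R \<and>
        cls (enc_nat v) \<notin> enc_nat ` S \<and> enc_nat e = ent (cls (enc_nat v))"
      if "mismatched G col C A B e" for e
      using that unfolding mismatched_def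
    proof (elim conjE disjE bexE)
      fix u v c assume *: "e \<in> edges G" "u \<in> A" "v \<in> verts G - A" "ends G e = {u, v}" "u \<in> B c" "col e \<noteq> c"
      then show ?thesis using mixed[OF *(1,4,5,6)] by blast
    next
      fix u v c d assume *: "e \<in> edges G" "u \<in> A" "v \<in> A" "ends G e = {u, v}" "u \<in> B c" "v \<in> B d" "col e \<noteq> c" "col e \<noteq> d"
      then show ?thesis using mixed[OF *(1,4,5,7), of d] by blast
    qed
    have walk_outer: "v \<notin> A \<and> w \<notin> A \<and> (v \<in> R \<longleftrightarrow> w \<in> R) \<and> (v \<in> R \<longrightarrow> cls (enc_nat v) = cls (enc_nat w))"
      if "walk (delete_verts G A) v p w" for v p w
      using that
    proof (induction p arbitrary: v)
      case Nil
      then show ?case by (auto simp: delete_verts_def)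
    next
      case (Cons a p)
      obtain e u where a: "a = (e, u)" by force
      have e: "e \<in> edges G" "ends G e = {v, u}" "v \<notin> A" "u \<notin> A" and pw: "walk (delete_verts G A) u p w"
        using Cons.prems by (auto simp: a delete_verts_def)
      have "ends G e = {u, v}" using e by auto
      from outer[OF e] outer[OF e(1) this e(4,3)] Cons.IH[OF pw] e(3) show ?case by metis
    qed
    have comp: "x \<notin> A \<and> y \<notin> A \<and> (x \<in> R \<longleftrightarrow> y \<in> R) \<and> (x \<in> R \<longrightarrow> cls (enc_nat x) = cls (enc_nat y))"
      if H: "H \<in> components (delete_verts G A)" and xy: "x \<in> H" "y \<in> H" for H x y
    proof -
      obtain v where "H = {w. \<exists>p. walk (delete_verts G A) v p w}"
        using H unfolding components_def by blast
      then obtain p q where "walk (delete_verts G A) v p x" "walk (delete_verts G A) v q y"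
        using xy by blast
      from walk_outer[OF this(1)] walk_outer[OF this(2)] show ?thesis by metis
    qed
    have SR: "s \<in> R \<and> s \<notin> A \<and> cls (enc_nat s) = enc_nat s" if "s \<in> S" for s
      using cP[OF that] by (auto simp: R_def A_def)
    have finS: "finite S" using fin S by (auto simp: finite_multigraph_def dest: finite_subset)
    have finE: "finite (edges G)" using fin by (auto simp: finite_multigraph_def)
    have hit: "\<exists>v\<in>H. v \<in> R \<and> cls (enc_nat v) \<notin> enc_nat ` S \<and> enc_nat e = ent (cls (enc_nat v))"
      if H: "H \<in> components (delete_verts G A)" and e: "mismatched G col C A B e" "ends G e \<inter> H \<noteq> {}" for H e
    proof -
      obtain u v where uv: "u \<in> A" "ends G e = {u, v}" "v \<in> R" "cls (enc_nat v) \<notin> enc_nat ` S"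
        "enc_nat e = ent (cls (enc_nat v))" using mism[OF e(1)] by blast
      have "u \<notin> H" using comp[OF H] uv(1) by blast
      then have "v \<in> H" using e(2) uv(2) by auto
      then show ?thesis using uv by blast
    qed
    show ?thesis
      unfolding tutte_set_def
    proof (intro conjI ballI exI[of _ B] impI)
      show "A \<subseteq> verts G - S" using SR by (auto simp: A_def)
    next
      fix H assume H: "H \<in> components (delete_verts G A)"
      have "s = t" if "s \<in> H \<inter> S" "t \<in> H \<inter> S" for s t
      proof -
        have st: "s \<in> H" "t \<in> H" "s \<in> S" "t \<in> S" using that by auto
        from comp[OF H st(1,2)] SR[OF st(3)] SR[OF st(4)] have "enc_nat s = enc_nat t" by metis
        then show ?thesis by (simp add: enc_nat_inj)
      qed
      then show "card (H \<inter> S) \<le> 1"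
        using finS card_le_Suc0_iff_eq[of "H \<inter> S"] by auto
    next
      show "disjoint_family_on B C"
        unfolding disjoint_family_on_def B_def using uniq by (fastforce simp: enc_nat_inj)
      show "A = (\<Union>c\<in>C. B c)"
      proof
        show "(\<Union>c\<in>C. B c) \<subseteq> A" by (auto simp: B_def)
        show "A \<subseteq> (\<Union>c\<in>C. B c)"
        proof
          fix v assume v: "v \<in> A"
          then have "enc_nat v \<in> inner (trails K)" by (simp add: A_def)
          then have i: "enc_nat v \<in> inner (trails K)" "enc_nat v \<in> endv ` trails K"
            by (simp_all add: inner_def reached_def)
          then obtain T where T: "T \<in> trails K" "endv T = enc_nat v" by (metis (no_types, lifting) imageE)
          \<comment> \<open>The last dart comes from an edge and not from a loop, so its colour lies
            in \<open>C\<close>.\<close>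
          obtain e x y where e: "e \<in> edges G" "hd T = edge_dart e x y"
            using cD[OF T(1)] i(1) unfolding T(2) dart_iff by blast
          have "dart_col (hd T) = enc_nat (col e)" by (simp add: e(2) edge_dart_def)
          then have "v \<in> B (col e)" using v T unfolding B_def by blast
          moreover have "col e \<in> C" using e(1) col by blast
          ultimately show "v \<in> (\<Union>c\<in>C. B c)" by blast
        qed
      qed
    next
      fix H assume H: "H \<in> components (delete_verts G A)" and HS: "H \<inter> S \<noteq> {}"
      show "\<not> (\<exists>e. mismatched G col C A B e \<and> ends G e \<inter> H \<noteq> {})"
      proof
        assume "\<exists>e. mismatched G col C A B e \<and> ends G e \<inter> H \<noteq> {}"
        then obtain e v where v: "v \<in> H" "v \<in> R" "cls (enc_nat v) \<notin> enc_nat ` S" using hit[OF H] by blast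
        obtain s where s: "s \<in> H" "s \<in> S" using HS by auto
        then show False using comp[OF H v(1) s(1)] SR[OF s(2)] v by auto
      qed
    next
      fix H assume H: "H \<in> components (delete_verts G A)"
      let ?M = "{e. mismatched G col C A B e \<and> ends G e \<inter> H \<noteq> {}}"
      have "finite ?M" using finE by (rule rev_finite_subset) (auto simp: mismatched_def)
      moreover have "e = e'" if ee: "e \<in> ?M" "e' \<in> ?M" for e e'
      proof -
        obtain v where v: "v \<in> H" "v \<in> R" "enc_nat e = ent (cls (enc_nat v))"
          using hit[OF H, of e] ee(1) by blast
        obtain v' where v': "v' \<in> H" "v' \<in> R" "enc_nat e' = ent (cls (enc_nat v'))"
          using hit[OF H, of e'] ee(2) by blast
        have "cls (enc_nat v) = cls (enc_nat v')" using comp[OF H v(1) v'(1)] v by auto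
        then have "enc_nat e = enc_nat e'" using v v' by simp
        then show "e = e'" by (simp add: enc_nat_inj)
      qed
      ultimately show "card ?M \<le> 1" using card_le_Suc0_iff_eq[of ?M] by auto
    next
      show "\<not> (\<exists>e. mismatched G col C A B e \<and> ends G e \<subseteq> A)" using mism by blast
    qed
  qed
  ultimately show ?thesis using xsA unfolding K_def by metis
qed

text \<open>Initially there are two trails per terminal, and each of the at most
  \<open>2 * n\<close> rounds adds at most \<open>n + 1\<close>. A trail has at most
  \<open>4 * n\<close> darts, two per edge and two per terminal. A root dart holds three copies of
  its terminal and at most \<open>8\<close> further pairs, whence \<open>3 * n + 8\<close>; the
  remaining units count list cells.\<close>

lemma search_size:
  fixes n :: nat
  defines "n \<equiv> size encoding"
  shows "size (of_list (fold (\<lambda>_. step (in_vs encoding) (in_darts encoding)) (take j (in_vs encoding @ in_vs encoding))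
      (root_trails (in_terminals encoding)))) \<le> (2 * n + 2 * n * (n + 1)) * (4 * n * (3 * n + 9) + 1)"
proof -
  let ?K = "fold (\<lambda>_. step (in_vs encoding) (in_darts encoding)) (take j (in_vs encoding @ in_vs encoding))
      (root_trails (in_terminals encoding))"
  let ?es = "map (\<lambda>(e, u, v). edge_dart e u v) es"
  have "size encoding = size (of_list (map enc_nat vs)) + size (of_list ?es) + size (of_list (map enc_nat ss)) + 2"
  proof -
    have "(\<lambda>(e, u, v). enc_list enc_nat [e, u, v, col e]) = (\<lambda>(e, u, v). edge_dart e u v)"
      by (auto simp: fun_eq_iff edge_dart_def dart_def)
    then have "enc_list (\<lambda>(e, u, v). enc_list enc_nat [e, u, v, col e]) es = of_list ?es"
      by (metis enc_list_map)
    then show ?thesis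
      unfolding encoding_def enc_instance_def by (simp add: enc_list_map[of enc_nat])
  qed
  then have sz: "size (of_list (map enc_nat vs)) \<le> n" "size (of_list ?es) \<le> n" "size (of_list (map enc_nat ss)) \<le> n"
    by (auto simp: n_def)
  have el: "size x \<le> n" if "size (of_list l) \<le> n" "x \<in> set l" for x l
    using that member_le_sum_list[of "size x" "map size l"] by (auto simp: size_of_list)
  have len: "length vs \<le> n" "length es \<le> n" "length ss \<le> n" using sz by (auto simp: size_of_list)
  have dl: "size d \<le> 3 * n + 8" if d: "d \<in> set (in_darts encoding) \<union> set roots" for d
  proof (cases "d \<in> set roots")
    case True
    then obtain s c where s: "s \<in> S" "c \<in> {Atom, tt}" "d = root_dart c (enc_nat s)" by (auto simp: root_iff)
    have "enc_nat s \<in> set (map enc_nat ss)" using s lists by (auto simp: lists_instance_def)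
    then have "size (enc_nat s) \<le> n" using el sz by blast
    then show ?thesis using s by (auto simp: root_dart_def dart_def)
  next
    case False
    then have "d \<in> set (in_darts encoding)" using d by auto
    then have "d \<in> set ?es \<union> dart_rev ` set ?es"
      unfolding inputs(2) all_darts_def by (simp only: set_append set_map)
    then obtain y where y: "y \<in> set ?es" "d = y \<or> d = dart_rev y" by blast
    have "size (dart_rev y) = size y" using y(1) by (auto simp: edge_dart_def dart_def dart_rev_def dart_edge_def dart_src_def dart_tgt_def dart_col_def)
    then show ?thesis using el[OF sz(2) y(1)] y(2) by auto
  qed
  have v: "valid ?K" by (rule valid_fold[OF initial_valid(1)[OF trails_root]])
  have lE: "length (in_darts encoding) = 2 * length es" by (simp add: inputs all_darts_def)
  have lP: "length roots = 2 * length ss" unfolding roots_def by (induction ss) auto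
  have lR: "length (root_trails (in_terminals encoding)) = 2 * length ss"
    unfolding root_trails_def inputs by (induction ss) auto
  have "length ?K \<le> 2 * length ss + length (take j (in_vs encoding @ in_vs encoding)) * (length vs + 1)"
    using length_fold[of "take j (in_vs encoding @ in_vs encoding)" "root_trails (in_terminals encoding)"] lR
    by (simp add: inputs)
  also have "\<dots> \<le> 2 * n + 2 * n * (n + 1)"
    using len by (intro add_mono mult_le_mono) (auto simp: inputs)
  finally have lK: "length ?K \<le> 2 * n + 2 * n * (n + 1)" .
  have "size (of_list ?K) \<le> length ?K * ((length (in_darts encoding) + length roots) * (3 * n + 8 + 1) + 1)"
    by (rule size_valid[OF v dl])
  also have "\<dots> \<le> (2 * n + 2 * n * (n + 1)) * (4 * n * (3 * n + 9) + 1)"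
  proof (rule mult_le_mono[OF lK add_mono[OF mult_le_mono order_refl]])
    show "length (in_darts encoding) + length roots \<le> 4 * n" using len lE lP by linarith
  qed simp
  finally show ?thesis .
qed

end

theorem mainTheorem3:
  shows "\<exists>(prog :: com) (q :: nat poly).
    \<forall>(G :: (nat, nat) multigraph) (C :: nat set) (col :: nat \<Rightarrow> nat) (S :: nat set) vs es ss.
      finite_multigraph G \<and> (\<exists>c\<in>C. \<exists>d\<in>C. c \<noteq> d) \<and> col ` edges G \<subseteq> C \<and> S \<subseteq> verts G \<and>
      lists_instance G S vs es ss \<longrightarrow>
      (\<exists>time out.
         computes prog (enc_instance col vs es ss) time out \<and>
         time \<le> poly q (size (enc_instance col vs es ss)) \<and>
         ((\<exists>s\<in>S. \<exists>t\<in>S. \<exists>p. s \<noteq> t \<and> trail G s p t \<and> alternating col p \<and> out = enc_trail s p) \<or>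
          (\<exists>xs. tutte_set G col C S (set xs) \<and> out = enc_vertex_set xs)))"
proof -
  \<comment> \<open>The set of all legal inputs: one program and one polynomial must serve all
    instances at once, and only on these is the size bound available.\<close>
  define X where "X = {enc_instance col vs es ss | G C col S vs es ss. coloured_instance G C col S vs es ss}"
  \<comment> \<open>The bound of \<open>search_size\<close> as a polynomial: the factors stand for
    \<open>2 * n\<close>, \<open>n + 1\<close>, \<open>4 * n\<close> and
    \<open>3 * n + 9\<close>.\<close>
  define B where "B = ([:0, 2:] + [:0, 2:] * [:1, 1:]) * ([:0, 4:] * [:9, 3:] + 1 :: nat poly)"
  have "plist X search"
  proof (rule ptime_search[of X B])
    fix x j assume "x \<in> X"
    then obtain G C col S vs es ss where c: "coloured_instance G C col S vs es ss" "x = enc_instance col vs es ss"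
      by (auto simp: X_def)
    have x: "x = coloured_instance.encoding col vs es ss" by (simp add: c(2) coloured_instance.encoding_def[OF c(1)])
    show "size (of_list (fold (\<lambda>_ K. step (in_vs x) (in_darts x) K) (take j (in_vs x @ in_vs x))
        (root_trails (in_terminals x)))) \<le> poly B (size x)"
      using coloured_instance.search_size[OF c(1), of j] unfolding x[symmetric]
      by (simp add: B_def algebra_simps)
  qed
  then have "ptime X (\<lambda>x. answer x (search x))" by (intro ptime_answer ptime_id)
  then obtain prog n q where prog: "runs prog n q X (\<lambda>x. answer x (search x))" by (auto simp: ptime_def)
  show ?thesis
  proof (intro exI[of _ prog] exI[of _ q] allI impI)
    fix G :: "(nat, nat) multigraph" and C :: "nat set" and col S vs es ss
    assume a: "finite_multigraph G \<and> (\<exists>c\<in>C. \<exists>d\<in>C. c \<noteq> d) \<and> col ` edges G \<subseteq> C \<and> S \<subseteq> verts G \<and>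
      lists_instance G S vs es ss"
    then interpret coloured_instance G C col S vs es ss by unfold_locales auto
    let ?x = "enc_instance col vs es ss"
    have "?x \<in> X" unfolding X_def using coloured_instance_axioms by blast
    then have x0: "((\<lambda>_. Atom)(0 := ?x)) 0 \<in> X" by simp
    obtain t s' where t: "exec prog ((\<lambda>_. Atom)(0 := ?x)) t s'" "s' 0 = answer ?x (search ?x)" "t \<le> poly q (size ?x)"
      using prog[unfolded runs_def, rule_format, of "(\<lambda>_. Atom)(0 := ?x)", OF x0] by auto
    have "computes prog ?x t (answer ?x (search ?x))" unfolding computes_def using t by blast
    moreover have "(\<exists>s\<in>S. \<exists>t\<in>S. \<exists>p. s \<noteq> t \<and> trail G s p t \<and> alternating col p \<and> answer ?x (search ?x) = enc_trail s p) \<or>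
          (\<exists>xs. tutte_set G col C S (set xs) \<and> answer ?x (search ?x) = enc_vertex_set xs)"
      using trail_answer tutte_answer unfolding encoding_def by blast
    ultimately show "\<exists>time out. computes prog ?x time out \<and> time \<le> poly q (size ?x) \<and>
         ((\<exists>s\<in>S. \<exists>t\<in>S. \<exists>p. s \<noteq> t \<and> trail G s p t \<and> alternating col p \<and> out = enc_trail s p) \<or>
          (\<exists>xs. tutte_set G col C S (set xs) \<and> out = enc_vertex_set xs))"
      using t(3) by blast
  qed
qed

end
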